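(* Given an input data stream $\sigma=(\sigma_1,\dots,\sigma_n)\in U^n$ of length $n$ and a similarity function $f:U\times U\to[0,1]$, for any $\epsilon\in(0,1)$, Algorithm B (the explicit three-pass procedure written out in the context) is a $(1+\epsilon,o(1))$-$L_{\mathrm{DI}}$-sampler; it uses three passes and $O\left(\frac{1}{\epsilon^2}\sqrt{n}\log n\right)$ words of space.
   Context: Similarity graph. $U$ is a universe of items and $f:U\times U\to[0,1]$ is a symmetric similarity function with $f(x,x)=1$ for all $x\in U$. For a stream $\sigma=(\sigma_1,\dots,\sigma_n)\in U^n$, the similarity graph $G^\sigma$ is the complete weighted graph (with self-loops) on node set $[n]=\{1,\dots,n\}$ with weights $w(i,j)=f(\sigma_i,\sigma_j)$. The degree of node $i$ is $d_i=\sum_{j\in[n]} f(\sigma_i,\sigma_j)$, and the diversity index is $\mathrm{DI}(\sigma)=\sum_{i\in[n]} d_i^{-1}$. Each stream position is a distinct node; node $i$ is represented by the pair $(i,\sigma_i)$. Sampler. A $(1+\epsilon,\delta)$-$L_{\mathrm{DI}}$-sampler on $G^\sigma$ fails with probability at most $\delta$ and, conditioned on no failure, outputs node $i$ with a probability $p_i$ satisfying $(1-\epsilon)\frac{d_i^{-1}}{\mathrm{DI}(\sigma)}\le p_i\le(1+\epsilon)\frac{d_i^{-1}}{\mathrm{DI}(\sigma)}$, for every $i\in[n]$. The $o(1)$ is as $n\to\infty$. Node-arrival streaming model. The items $\sigma_1,\dots,\sigma_n$ arrive sequentially; a pass is one linear scan of the stream. Edge weights are not given; $f(x,y)$ is evaluated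 on demand, only when both items are in memory (the currently arriving item counts as being in memory). The length $n$ is known in advance. Space is measured in words in a unit-cost RAM model: each stream item, each value returned by $f$ and each arithmetic quantity maintained takes $O(1)$ words. Algorithm B (input: $\sigma$, $f$, $\epsilon$). All random choices are independent; $\log$ is the natural logarithm; array sizes are rounded to integers. Set $t=12\sqrt n\log n$, $\theta=\frac{96\log n}{(\epsilon/4)^2}$, $t_1=\frac{48\sqrt n\log n}{(\epsilon/4)^2}$, $t_2=\frac{36\sqrt n\log n}{(\epsilon/4)^2}$. Initialize $W_H=0$, $n_H=n_L=0$, $r_H=r_L=\text{null}$, an array $S_1$ of size $t_1$, arrays $S_2,D$ of size $t_2$, and arrays $S_H,D_H,S_L,D_L$ of size $t$, all entries $0$. Pass 1: for each arriving $\sigma_j$ and each $i=1,\dots,t_1$, with probability $1/j$ set $S_1[i]\leftarrow\sigma_j$. Pass 2: for each arriving $\sigma_j$, compute $Y_j=\sum_{i\in[t_1]} f(S_1[i],\sigma_j)$. If $Y_j\ge\theta$: set $W_H\leftarrow W_H+\left(\frac{n}{t_1}Y_j\right)^{-1}$ and $n_H\leftarrow n_H+1$, and for each $i=1,\dots,t$, with probability $1/n_H$ set $S_H[i]\leftarrow\sigma_j$. Otherwise: set $n_L\leftarrow n_L+1$; for each $i=1,\dots,t$, with probability $1/n_L$ set $S_L[i]\leftarrow\sigma_j$; and for each $i=1,\dots,t_2$, with probability $1/n_L$ set $S_2[i]\leftarrow\sigma_j$. Pass 3: for each arriving $\sigma_j$: for each $i=1,\dots,t_2$ set $D[i]\leftarrow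 D[i]+f(S_2[i],\sigma_j)$; for each $i=1,\dots,t$ set $D_H[i]\leftarrow D_H[i]+f(S_H[i],\sigma_j)$ and $D_L[i]\leftarrow D_L[i]+f(S_L[i],\sigma_j)$. Then set $W_L=\frac{n_L}{t_2}\sum_{i\in[t_2]}\frac1{D[i]}$ (with $W_L=0$ if $n_L=0$). Output step: if $n_H>0$, for $i=1,\dots,t$ in order, with probability $\min\{1,\sqrt n/D_H[i]\}$ set $r_H\leftarrow S_H[i]$ and stop this loop. If $n_L>0$, for $i=1,\dots,t$ in order, with probability $1/D_L[i]$ set $r_L\leftarrow S_L[i]$ and stop this loop. If ($r_H=\text{null}$ and $n_H>0$) or ($r_L=\text{null}$ and $n_L>0$), return Fail. Otherwise return $r_H$ with probability $\frac{W_H}{W_H+W_L}$, and $r_L$ otherwise. *)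

theory Defs
  imports "HOL-Probability.Probability"
begin

section \<open>Similarity graphs and diversity samplers\<close>

text \<open>The universe of items is the type \<open>'a\<close>. Streams are lists, and the nodes of the similarity
  graph are the positions \<open>1, \<dots>, n\<close>; node \<open>i\<close> is represented by the pair \<open>(i, \<sigma>\<^sub>i)\<close>.\<close>

type_synonym 'a node = "nat \<times> 'a"

definition similarity :: "('a \<Rightarrow> 'a \<Rightarrow> real) \<Rightarrow> bool" where
  "similarity f \<longleftrightarrow>
     (\<forall>x y. 0 \<le> f x y \<and> f x y \<le> 1) \<and> (\<forall>x y. f x y = f y x) \<and> (\<forall>x. f x x = 1)"

definition item :: "'a list \<Rightarrow> nat \<Rightarrow> 'a" where
  "item \<sigma> i = \<sigma> ! (i - 1)"

definition weight :: "('a \<Rightarrow> 'a \<Rightarrow> real) \<Rightarrow> 'a list \<Rightarrow> nat \<Rightarrow> nat \<Rightarrow> real" where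
  "weight f \<sigma> i j = f (item \<sigma> i) (item \<sigma> j)"

definition degree :: "('a \<Rightarrow> 'a \<Rightarrow> real) \<Rightarrow> 'a list \<Rightarrow> nat \<Rightarrow> real" where
  "degree f \<sigma> i = (\<Sum>j\<in>{1..length \<sigma>}. weight f \<sigma> i j)"

definition diversity_index :: "('a \<Rightarrow> 'a \<Rightarrow> real) \<Rightarrow> 'a list \<Rightarrow> real" where
  "diversity_index f \<sigma> = (\<Sum>i\<in>{1..length \<sigma>}. inverse (degree f \<sigma> i))"

text \<open>\<open>Return None\<close> stands for returning the null reference without declaring failure; it counts
  neither as a failure nor as the output of a node.\<close>

datatype 'a result = Fail | Return "'a node option"

text \<open>The output distribution \<open>p\<close> is that of a \<open>(1 + \<epsilon>, \<delta>)\<close>-sampler. The conditional distribution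
  exists only if \<open>Fail\<close> is not almost sure, whence the guard in front of \<open>cond_pmf\<close>.\<close>

definition L_DI_sampler ::
  "real \<Rightarrow> real \<Rightarrow> ('a \<Rightarrow> 'a \<Rightarrow> real) \<Rightarrow> 'a list \<Rightarrow> 'a result pmf \<Rightarrow> bool" where
  "L_DI_sampler \<epsilon> \<delta> f \<sigma> p \<longleftrightarrow>
     pmf p Fail \<le> \<delta> \<and>
     (pmf p Fail < 1 \<longrightarrow>
       (\<forall>i\<in>{1..length \<sigma>}.
          let q = inverse (degree f \<sigma> i) / diversity_index f \<sigma>;
              p\<^sub>i = pmf (cond_pmf p (- {Fail})) (Return (Some (i, item \<sigma> i)))
          in (1 - \<epsilon>) * q \<le> p\<^sub>i \<and> p\<^sub>i \<le> (1 + \<epsilon>) * q))"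


section \<open>Multi-pass streaming algorithms\<close>

text \<open>A machine word holds nothing, one stream item, or one number.\<close>

datatype 'a word = Null | Item 'a | Num real

text \<open>An instruction is a randomised memory update that may query the similarity function.
  A streaming algorithm consists of an initial memory, for each pass the instructions to be executed
  on the arrival of a node, the instructions to be executed after the last pass, and the final
  answer. The field \<open>cells\<close> lists the words that a memory occupies.\<close>

type_synonym ('a, 'm) instr = "('a \<Rightarrow> 'a \<Rightarrow> real) \<Rightarrow> 'm \<Rightarrow> 'm pmf"

record ('a, 'm, 'r) stream_alg =
  initial :: 'm
  passes :: "('a node \<Rightarrow> ('a, 'm) instr list) list"
  final :: "('a, 'm) instr list"
  answer :: "'m \<Rightarrow> 'r pmf"
  cells :: "'m \<Rightarrow> 'a word list"

text \<open>The instructions in the order of execution, each paired with the node that is arriving while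
  it is executed (if any). Every pass is one scan of the stream.\<close>

definition pass_schedule ::
  "'a list \<Rightarrow> ('a node \<Rightarrow> ('a, 'm) instr list) \<Rightarrow> ('a node option \<times> ('a, 'm) instr) list" where
  "pass_schedule \<sigma> body =
     concat (map (\<lambda>x. map (Pair (Some x)) (body x)) (List.enumerate 1 \<sigma>))"

definition schedule ::
  "('a, 'm, 'r) stream_alg \<Rightarrow> 'a list \<Rightarrow> ('a node option \<times> ('a, 'm) instr) list" where
  "schedule alg \<sigma> =
     concat (map (pass_schedule \<sigma>) (passes alg)) @ map (Pair None) (final alg)"

primrec exec ::
  "('a \<Rightarrow> 'a \<Rightarrow> real) \<Rightarrow> ('a node option \<times> ('a, 'm) instr) list \<Rightarrow> 'm \<Rightarrow> 'm pmf" where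
  "exec f [] m = return_pmf m"
| "exec f (c # cs) m = bind_pmf (snd c f m) (exec f cs)"

definition run ::
  "('a, 'm, 'r) stream_alg \<Rightarrow> ('a \<Rightarrow> 'a \<Rightarrow> real) \<Rightarrow> 'a list \<Rightarrow> 'r pmf" where
  "run alg f \<sigma> = bind_pmf (exec f (schedule alg \<sigma>) (initial alg)) (answer alg)"

text \<open>The memories that can occur after \<open>k\<close> instructions.\<close>

definition reachable ::
  "('a, 'm, 'r) stream_alg \<Rightarrow> ('a \<Rightarrow> 'a \<Rightarrow> real) \<Rightarrow> 'a list \<Rightarrow> nat \<Rightarrow> 'm set" where
  "reachable alg f \<sigma> k = set_pmf (exec f (take k (schedule alg \<sigma>)) (initial alg))"

definition available :: "('a, 'm, 'r) stream_alg \<Rightarrow> 'a node option \<Rightarrow> 'm \<Rightarrow> 'a set" where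
  "available alg cur m = {x. Item x \<in> set (cells alg m)} \<union> snd ` set_option cur"

text \<open>\<open>f\<close> is evaluated only on pairs of items that are in memory or arriving: the effect of each
  instruction is unchanged if \<open>f\<close> is replaced by any \<open>g\<close> that agrees with \<open>f\<close> on those pairs.\<close>

definition queries_only_memory ::
  "('a, 'm, 'r) stream_alg \<Rightarrow> ('a \<Rightarrow> 'a \<Rightarrow> real) \<Rightarrow> 'a list \<Rightarrow> bool" where
  "queries_only_memory alg f \<sigma> \<longleftrightarrow>
     (\<forall>k < length (schedule alg \<sigma>). \<forall>m \<in> reachable alg f \<sigma> k.
        let (cur, c) = schedule alg \<sigma> ! k; A = available alg cur m
        in \<forall>g. (\<forall>x\<in>A. \<forall>y\<in>A. g x y = f x y) \<longrightarrow> c g m = c f m)"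

text \<open>Besides the cells of the memory, space is charged for the registers needed to execute an
  instruction: the arriving node (two words), the last value of \<open>f\<close>, the pass number, the loop
  index and three intermediate results.\<close>

definition words :: "('a, 'm, 'r) stream_alg \<Rightarrow> 'm \<Rightarrow> nat" where
  "words alg m = 8 + length (cells alg m)"

definition space_bounded_by ::
  "('a, 'm, 'r) stream_alg \<Rightarrow> ('a \<Rightarrow> 'a \<Rightarrow> real) \<Rightarrow> 'a list \<Rightarrow> real \<Rightarrow> bool" where
  "space_bounded_by alg f \<sigma> b \<longleftrightarrow>
     (\<forall>k \<le> length (schedule alg \<sigma>). \<forall>m \<in> reachable alg f \<sigma> k. real (words alg m) \<le> b)"


section \<open>The three-pass algorithm\<close>

text \<open>Array sizes are rounded up. Arrays are indexed from \<open>0\<close>.\<close>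

definition size_t :: "nat \<Rightarrow> nat" where
  "size_t n = nat \<lceil>12 * sqrt (real n) * ln (real n)\<rceil>"

definition size_t1 :: "nat \<Rightarrow> real \<Rightarrow> nat" where
  "size_t1 n \<epsilon> = nat \<lceil>48 * sqrt (real n) * ln (real n) / (\<epsilon> / 4)\<^sup>2\<rceil>"

definition size_t2 :: "nat \<Rightarrow> real \<Rightarrow> nat" where
  "size_t2 n \<epsilon> = nat \<lceil>36 * sqrt (real n) * ln (real n) / (\<epsilon> / 4)\<^sup>2\<rceil>"

definition threshold :: "nat \<Rightarrow> real \<Rightarrow> real" where
  "threshold n \<epsilon> = 96 * ln (real n) / (\<epsilon> / 4)\<^sup>2"

record 'a mem =
  S1 :: "'a node option list"
  S2 :: "'a node option list"
  SH :: "'a node option list"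
  SL :: "'a node option list"
  DD :: "real list"
  DH :: "real list"
  DL :: "real list"
  WH :: real
  WL :: real
  nH :: nat
  nL :: nat
  rH :: "'a node option"
  rL :: "'a node option"
  YY :: real

definition initial_mem :: "nat \<Rightarrow> real \<Rightarrow> 'a mem" where
  "initial_mem n \<epsilon> =
     \<lparr> S1 = replicate (size_t1 n \<epsilon>) None,
       S2 = replicate (size_t2 n \<epsilon>) None,
       SH = replicate (size_t n) None,
       SL = replicate (size_t n) None,
       DD = replicate (size_t2 n \<epsilon>) 0,
       DH = replicate (size_t n) 0,
       DL = replicate (size_t n) 0,
       WH = 0, WL = 0, nH = 0, nL = 0, rH = None, rL = None, YY = 0 \<rparr>"

fun node_cells :: "'a node option \<Rightarrow> 'a word list" where
  "node_cells None = [Null, Null]"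
| "node_cells (Some (j, x)) = [Num (real j), Item x]"

definition mem_cells :: "nat \<Rightarrow> real \<Rightarrow> 'a mem \<Rightarrow> 'a word list" where
  "mem_cells n \<epsilon> m =
     map Num [real n, \<epsilon>, real (size_t n), real (size_t1 n \<epsilon>), real (size_t2 n \<epsilon>), threshold n \<epsilon>] @
     concat (map node_cells (S1 m @ S2 m @ SH m @ SL m @ [rH m, rL m])) @
     map Num (DD m @ DH m @ DL m @ [WH m, WL m, real (nH m), real (nL m), YY m])"

text \<open>An array entry that has not been assigned yet contributes nothing to a sum of similarities.
  For a nonempty stream such entries only occur in arrays that do not influence the answer.\<close>

fun sim :: "('a \<Rightarrow> 'a \<Rightarrow> real) \<Rightarrow> 'a node option \<Rightarrow> 'a node \<Rightarrow> real" where
  "sim f None y = 0"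
| "sim f (Some x) y = f (snd x) (snd y)"

definition det :: "(('a \<Rightarrow> 'a \<Rightarrow> real) \<Rightarrow> 'm \<Rightarrow> 'm) \<Rightarrow> ('a, 'm) instr" where
  "det u = (\<lambda>f m. return_pmf (u f m))"

definition with_prob :: "('m \<Rightarrow> real) \<Rightarrow> ('m \<Rightarrow> 'm) \<Rightarrow> ('a, 'm) instr" where
  "with_prob p u = (\<lambda>f m. map_pmf (\<lambda>b. if b then u m else m) (bernoulli_pmf (p m)))"

definition guarded :: "('m \<Rightarrow> bool) \<Rightarrow> ('a, 'm) instr \<Rightarrow> ('a, 'm) instr" where
  "guarded b c = (\<lambda>f m. if b m then c f m else return_pmf m)"

definition pass1 :: "nat \<Rightarrow> real \<Rightarrow> 'a node \<Rightarrow> ('a, 'a mem) instr list" where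
  "pass1 n \<epsilon> x =
     map (\<lambda>i. with_prob (\<lambda>m. 1 / real (fst x)) (\<lambda>m. m\<lparr>S1 := (S1 m)[i := Some x]\<rparr>))
       [0..<size_t1 n \<epsilon>]"

definition pass2 :: "nat \<Rightarrow> real \<Rightarrow> 'a node \<Rightarrow> ('a, 'a mem) instr list" where
  "pass2 n \<epsilon> x =
     (let heavy = (\<lambda>m. YY m \<ge> threshold n \<epsilon>) in
     [det (\<lambda>f m. m\<lparr>YY := 0\<rparr>)] @
     map (\<lambda>i. det (\<lambda>f m. m\<lparr>YY := YY m + sim f (S1 m ! i) x\<rparr>)) [0..<size_t1 n \<epsilon>] @
     [guarded heavy
        (det (\<lambda>f m. m\<lparr>WH := WH m + inverse (real n / real (size_t1 n \<epsilon>) * YY m),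
                      nH := nH m + 1\<rparr>)),
      guarded (\<lambda>m. \<not> heavy m) (det (\<lambda>f m. m\<lparr>nL := nL m + 1\<rparr>))] @
     map (\<lambda>i. guarded heavy
        (with_prob (\<lambda>m. 1 / real (nH m)) (\<lambda>m. m\<lparr>SH := (SH m)[i := Some x]\<rparr>))) [0..<size_t n] @
     map (\<lambda>i. guarded (\<lambda>m. \<not> heavy m)
        (with_prob (\<lambda>m. 1 / real (nL m)) (\<lambda>m. m\<lparr>SL := (SL m)[i := Some x]\<rparr>))) [0..<size_t n] @
     map (\<lambda>i. guarded (\<lambda>m. \<not> heavy m)
        (with_prob (\<lambda>m. 1 / real (nL m)) (\<lambda>m. m\<lparr>S2 := (S2 m)[i := Some x]\<rparr>)))
       [0..<size_t2 n \<epsilon>])"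

definition pass3 :: "nat \<Rightarrow> real \<Rightarrow> 'a node \<Rightarrow> ('a, 'a mem) instr list" where
  "pass3 n \<epsilon> x =
     map (\<lambda>i. det (\<lambda>f m. m\<lparr>DD := (DD m)[i := DD m ! i + sim f (S2 m ! i) x]\<rparr>))
       [0..<size_t2 n \<epsilon>] @
     map (\<lambda>i. det (\<lambda>f m. m\<lparr>DH := (DH m)[i := DH m ! i + sim f (SH m ! i) x]\<rparr>)) [0..<size_t n] @
     map (\<lambda>i. det (\<lambda>f m. m\<lparr>DL := (DL m)[i := DL m ! i + sim f (SL m ! i) x]\<rparr>)) [0..<size_t n]"

text \<open>First \<open>W\<^sub>L\<close> is computed from the array \<open>D\<close>, then the two rejection loops are run. A loop has been
  stopped iff its reference is no longer null.\<close>

definition final_phase :: "nat \<Rightarrow> real \<Rightarrow> ('a, 'a mem) instr list" where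
  "final_phase n \<epsilon> =
     map (\<lambda>i. guarded (\<lambda>m. nL m > 0) (det (\<lambda>f m. m\<lparr>WL := WL m + 1 / DD m ! i\<rparr>)))
       [0..<size_t2 n \<epsilon>] @
     [guarded (\<lambda>m. nL m > 0) (det (\<lambda>f m. m\<lparr>WL := real (nL m) / real (size_t2 n \<epsilon>) * WL m\<rparr>))] @
     map (\<lambda>i. guarded (\<lambda>m. nH m > 0 \<and> rH m = None)
        (with_prob (\<lambda>m. min 1 (sqrt (real n) / DH m ! i)) (\<lambda>m. m\<lparr>rH := SH m ! i\<rparr>)))
       [0..<size_t n] @
     map (\<lambda>i. guarded (\<lambda>m. nL m > 0 \<and> rL m = None)
        (with_prob (\<lambda>m. 1 / DL m ! i) (\<lambda>m. m\<lparr>rL := SL m ! i\<rparr>)))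
       [0..<size_t n]"

definition final_answer :: "'a mem \<Rightarrow> 'a result pmf" where
  "final_answer m =
     (if (rH m = None \<and> nH m > 0) \<or> (rL m = None \<and> nL m > 0) then return_pmf Fail
      else map_pmf (\<lambda>b. Return (if b then rH m else rL m))
             (bernoulli_pmf (WH m / (WH m + WL m))))"

definition algorithm_B :: "nat \<Rightarrow> real \<Rightarrow> ('a, 'a mem, 'a result) stream_alg" where
  "algorithm_B n \<epsilon> =
     \<lparr> initial = initial_mem n \<epsilon>,
       passes = [pass1 n \<epsilon>, pass2 n \<epsilon>, pass3 n \<epsilon>],
       final = final_phase n \<epsilon>,
       answer = final_answer,
       cells = mem_cells n \<epsilon> \<rparr>"

end

theory Submission
  imports Defs
begin

text \<open>The cells of each array behave as independent reservoirs, so given the array \<open>S\<^sub>1\<close> (whose cells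
  are independent uniform nodes) the arrays \<open>S\<^sub>H\<close>, \<open>S\<^sub>L\<close>, \<open>S\<^sub>2\<close> consist of independent uniform heavy or
  light nodes. Call \<open>S\<^sub>1\<close> good if every node of degree at least \<open>\<surd>n\<close> has its degree estimated up to a
  factor in \<open>(1/2, 3/2)\<close> and every other node is light; this fails with probability at most
  \<open>\<epsilon> / (100 n\<^sup>2)\<close>, which is negligible because every target probability is at least \<open>1 / n\<^sup>2\<close>.

  For good \<open>S\<^sub>1\<close> heavy nodes have degree at least \<open>\<surd>n\<close> and light ones at most \<open>4\<surd>n\<close>. Hence both
  rejection loops succeed with high probability, and conditionally on success they select a heavy
  or light node with probability proportional to its inverse degree. Failure is independent of the
  selected nodes and of \<open>S\<^sub>2\<close>, so it only remains to compare the expectation of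
  \<open>W\<^sub>H / (W\<^sub>H + W\<^sub>L)\<close> with the true share of the heavy nodes. The relative errors of \<open>W\<^sub>H\<close> and \<open>W\<^sub>L\<close>
  are bounded in expectation by exponential moments, which gives an error proportional to \<open>\<epsilon>\<close>.\<close>

section \<open>Exponential moments of sums of independent samples\<close>

text \<open>The relative error \<epsilon> is demanded at every length; only the failure probability
  may be treated asymptotically. An additive error is thus affordable only if it is a small multiple
  of \<epsilon> / n^2, where 1 / n^2 bounds the targets from below. A bad \<open>S1\<close> meets
  this: its exponents are multiples of ln n / \<epsilon>^2, which yields a factor \<epsilon> besides
  powers of 1 / n. Deviations of the weights of order \<epsilon> do not, so they are averaged
  instead of excluded.

  Every selection probability is compared with its target times the probability of success, so that
  failing is not itself an error. The budget is 13/30 \<epsilon> for \<open>WL\<close>, 10/48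
  \<epsilon> for \<open>WH\<close> and \<epsilon> / 100 for bad samples, together below 3/4
  \<epsilon>. For n \<ge> 2 a run succeeds with probability at least 3/4, and dividing by that
  probability turns 3/4 \<epsilon> into \<epsilon>.\<close>

lemma expectation_mono_finite_pmf:
  fixes g h :: "'b \<Rightarrow> real"
  assumes "finite (set_pmf p)" "\<And>x. x \<in> set_pmf p \<Longrightarrow> g x \<le> h x"
  shows "measure_pmf.expectation p g \<le> measure_pmf.expectation p h"
  by (rule integral_mono_AE) (auto simp: AE_measure_pmf_iff assms integrable_measure_pmf_finite)

lemma expectation_cong_pmf:
  fixes g h :: "'b \<Rightarrow> real"
  assumes "\<And>x. x \<in> set_pmf p \<Longrightarrow> g x = h x"
  shows "measure_pmf.expectation p g = measure_pmf.expectation p h"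
  by (rule integral_cong_AE) (auto simp: AE_measure_pmf_iff assms)

text \<open>The distributions that are averaged over have finite support, so iterated expectations
  are finite sums and integrability comes for free.\<close>

lemma expectation_bind_finite_pmf:
  fixes h :: "'c \<Rightarrow> real"
  assumes "finite (set_pmf p)" "\<And>x. x \<in> set_pmf p \<Longrightarrow> finite (set_pmf (k x))"
  shows "measure_pmf.expectation (bind_pmf p k) h =
    measure_pmf.expectation p (\<lambda>x. measure_pmf.expectation (k x) h)"
  using assms
  by (simp add: pmf_expectation_bind[of "set_pmf p"] integral_measure_pmf[of "set_pmf p"])

lemma finite_set_replicate_pmf:
  assumes "finite (set_pmf p)"
  shows "finite (set_pmf (replicate_pmf t p))"
proof -
  have "set_pmf (replicate_pmf t p) = {xs. set xs \<subseteq> set_pmf p \<and> length xs = t}"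
    by (auto simp: set_replicate_pmf)
  then show ?thesis using finite_lists_length_eq[OF assms] by simp
qed

text \<open>The entries are independent, so a product with one factor per entry has the product of
  the means as its mean. With exponential factors this is the moment generating function of a
  sum.\<close>

lemma expectation_replicate_pmf_prod_list:
  fixes g :: "'b \<Rightarrow> real"
  assumes fin: "finite (set_pmf p)"
  shows "measure_pmf.expectation (replicate_pmf t p) (\<lambda>xs. prod_list (map g xs)) =
    measure_pmf.expectation p g ^ t"
proof (induction t)
  case (Suc t)
  have "measure_pmf.expectation (replicate_pmf (Suc t) p) (\<lambda>xs. prod_list (map g xs)) =
      measure_pmf.expectation p (\<lambda>x.
        measure_pmf.expectation (replicate_pmf t p) (\<lambda>xs. g x * prod_list (map g xs)))"
    by (simp add: expectation_bind_finite_pmf fin finite_set_replicate_pmf)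
  then show ?case
    by (simp add: Suc)
qed simp

lemma exp_sum_list: "exp (s * sum_list (map g xs)) = prod_list (map (\<lambda>x. exp (s * g x :: real)) xs)"
  by (induction xs) (auto simp: distrib_left exp_add)

text \<open>Convexity on [0, 1]. The chord is linear in \<open>x\<close>, so the moment generating
  function of a variable with values in [0, 1] is controlled by its mean alone.\<close>

lemma exp_le_chord:
  fixes x s :: real
  assumes "0 \<le> x" "x \<le> 1"
  shows "exp (s * x) \<le> 1 + x * (exp s - 1)"
proof -
  have "exp ((1 - x) *\<^sub>R 0 + x *\<^sub>R s) \<le> (1 - x) * exp 0 + x * exp s"
    by (rule convex_onD[OF exp_convex]) (use assms in auto)
  then show ?thesis by (simp add: algebra_simps)
qed

lemma exp_minus_one_le:
  fixes s :: real
  assumes "\<bar>s\<bar> \<le> 1"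
  shows "exp s - 1 \<le> s + s\<^sup>2"
proof (cases "s \<ge> 0")
  case True
  then show ?thesis using exp_bound[of s] assms by simp
next
  case False
  define u where "u = - s"
  have u: "0 \<le> u" "u \<le> 1" using False assms by (auto simp: u_def)
  \<comment> \<open>The product equals 1 + u^3.\<close>
  have "1 \<le> (1 + u) * (1 - u + u\<^sup>2)"
    using u by (simp add: algebra_simps power2_eq_square)
  also have "\<dots> \<le> exp u * (1 - u + u\<^sup>2)"
    using u exp_ge_add_one_self[of u] by (intro mult_right_mono) auto
  finally have "exp (- u) \<le> 1 - u + u\<^sup>2"
    by (simp add: exp_minus field_simps)
  then show ?thesis by (simp add: u_def)
qed

text \<open>Chernoff's argument: chord bound, then 1 + y \<le> exp y, then independence. The
  exponent s + s^2 in place of exp s - 1 keeps the later choices of \<open>s\<close>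
  explicit.\<close>

lemma expectation_exp_sum_list_le:
  fixes Z :: "'b \<Rightarrow> real"
  assumes fin: "finite (set_pmf p)" and Z: "\<And>x. x \<in> set_pmf p \<Longrightarrow> 0 \<le> Z x \<and> Z x \<le> 1"
    and s: "\<bar>s\<bar> \<le> 1"
  shows "measure_pmf.expectation (replicate_pmf t p) (\<lambda>xs. exp (s * sum_list (map Z xs))) \<le>
    exp (real t * measure_pmf.expectation p Z * (s + s\<^sup>2))"
proof -
  let ?E = "measure_pmf.expectation p"
  have EZ: "0 \<le> ?E Z"
    using expectation_mono_finite_pmf[OF fin, of "\<lambda>_. 0" Z] Z by simp
  have "?E (\<lambda>x. exp (s * Z x)) \<le> ?E (\<lambda>x. 1 + Z x * (exp s - 1))"
    by (rule expectation_mono_finite_pmf[OF fin]) (use Z exp_le_chord in auto)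
  also have "\<dots> = 1 + ?E Z * (exp s - 1)"
    by (simp add: integrable_measure_pmf_finite[OF fin] Bochner_Integration.integral_add)
  also have "\<dots> \<le> 1 + ?E Z * (s + s\<^sup>2)"
    using EZ exp_minus_one_le[OF s] by (intro add_left_mono mult_left_mono) auto
  also have "\<dots> \<le> exp (?E Z * (s + s\<^sup>2))"
    by (rule exp_ge_add_one_self)
  finally have "?E (\<lambda>x. exp (s * Z x)) ^ t \<le> exp (?E Z * (s + s\<^sup>2)) ^ t"
    by (intro power_mono) auto
  then show ?thesis
    by (simp add: exp_sum_list expectation_replicate_pmf_prod_list[OF fin] mult.assoc
        flip: exp_of_nat_mult)
qed

text \<open>For s = k / m the linear term of the exponent cancels against the centring factor exp (-
  k). What remains says that the relative error of a sum of mean \<open>m\<close> is sub-Gaussian at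
  scale 1 / sqrt m.\<close>

lemma expectation_exp_relative_le:
  fixes Z :: "'b \<Rightarrow> real"
  assumes fin: "finite (set_pmf p)" and Z: "\<And>x. x \<in> set_pmf p \<Longrightarrow> 0 \<le> Z x \<and> Z x \<le> 1"
    and m: "m = real t * measure_pmf.expectation p Z" "m > 0" and k: "\<bar>k\<bar> \<le> m"
  shows "measure_pmf.expectation (replicate_pmf t p) (\<lambda>xs. exp (k * (sum_list (map Z xs) / m - 1)))
    \<le> exp (k\<^sup>2 / m)"
proof -
  have "measure_pmf.expectation (replicate_pmf t p) (\<lambda>xs. exp (k * (sum_list (map Z xs) / m - 1)))
    = exp (- k) * measure_pmf.expectation (replicate_pmf t p)
        (\<lambda>xs. exp (k / m * sum_list (map Z xs)))"
    by (simp add: exp_diff exp_minus field_simps)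
  also have "\<dots> \<le> exp (- k) * exp (m * (k / m + (k / m)\<^sup>2))"
    using expectation_exp_sum_list_le[where p = p and Z = Z and s = "k / m" and t = t] fin Z m k
    by (auto simp: field_simps)
  also have "\<dots> = exp (k\<^sup>2 / m)"
    using m(2) by (simp add: power2_eq_square field_simps flip: exp_add)
  finally show ?thesis .
qed

text \<open>Turns exponential moments into a bound on the absolute value without Jensen's inequality.\<close>

lemma abs_le_cosh_bound:
  fixes l y B :: real
  assumes "l > 0" "B > 0"
  shows "\<bar>y\<bar> \<le> (ln B - 1 + (exp (l * y) + exp (- l * y)) / B) / l"
proof -
  \<comment> \<open>\<open>B\<close> is free. Choosing it as an upper bound on the mean of the two
    exponentials leaves at most ln B / l after taking expectations.\<close>
  have "1 + (l * \<bar>y\<bar> - ln B) \<le> exp (l * \<bar>y\<bar> - ln B)"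
    by (rule exp_ge_add_one_self)
  also have "\<dots> = exp (l * \<bar>y\<bar>) / B"
    using assms by (simp add: exp_diff)
  also have "\<dots> \<le> (exp (l * y) + exp (- l * y)) / B"
    using assms by (intro divide_right_mono) (auto simp: abs_if)
  finally show ?thesis using assms by (simp add: field_simps)
qed

section \<open>Loops over independent cells\<close>

lemma exec_append: "exec f (cs @ ds) m = bind_pmf (exec f cs m) (exec f ds)"
  by (induction cs arbitrary: m) (auto simp: bind_return_pmf bind_assoc_pmf intro!: bind_pmf_cong)

primrec resample :: "real \<Rightarrow> 'b \<Rightarrow> 'b list \<Rightarrow> 'b list pmf" where
  "resample p x [] = return_pmf []"
| "resample p x (y # ys) =
     do {b \<leftarrow> bernoulli_pmf p; zs \<leftarrow> resample p x ys; return_pmf ((if b then x else y) # zs)}"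

text \<open>A coin that accepts an empty cell does not end the loop, because the program recognises
  a stopped loop by a reference that is no longer null.\<close>

primrec rej :: "('b option \<Rightarrow> real) \<Rightarrow> 'b option list \<Rightarrow> 'b option pmf" where
  "rej g [] = return_pmf None"
| "rej g (c # cs) =
     do {b \<leftarrow> bernoulli_pmf (g c); if b \<and> c \<noteq> None then return_pmf c else rej g cs}"

lemma exec_guarded_loop_idle:
  assumes "\<not> b m"
  shows "exec f (map (\<lambda>i. (c, guarded b (k i))) is) m = return_pmf m"
  using assms by (induction "is") (auto simp: guarded_def bind_return_pmf)

text \<open>\<open>get\<close> and \<open>put\<close> act as a lens onto the array that the loop
  rewrites. Probability and guard must not depend on that array, or earlier iterations would
  influence later ones. The prefix \<open>as\<close> collects the cells already treated, which is
  the generalisation that the induction needs.\<close>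

lemma exec_resample_loop_from:
  assumes gs: "\<And>m s. get (put s m) = s" "\<And>m s s'. put s (put s' m) = put s m"
    and p: "\<And>m s. p (put s m) = p m" and b: "\<And>m s. b (put s m) = b m" "b m"
  shows "exec f (map (\<lambda>i. (c, guarded b (with_prob p (\<lambda>m. put ((get m)[i := x]) m))))
      [length as..<length as + length bs]) (put (as @ bs) m) =
    map_pmf (\<lambda>s. put (as @ s) m) (resample (p m) x bs)"
proof (induction bs arbitrary: as)
  case (Cons y ys)
  let ?I = "\<lambda>i. guarded b (with_prob p (\<lambda>m. put ((get m)[i := x]) m))"
  have step: "?I i f (put xs m) =
      map_pmf (\<lambda>z. put (if z then xs[i := x] else xs) m) (bernoulli_pmf (p m))" for i xs
    by (auto simp: guarded_def with_prob_def b p gs if_distrib intro!: map_pmf_cong)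
  have upt: "[length as..<length as + length (y # ys)] =
      length as # [Suc (length as)..<Suc (length as + length ys)]"
    by (simp add: upt_conv_Cons del: upt_Suc)
  have IH: "exec f (map (\<lambda>i. (c, ?I i)) [Suc (length as)..<Suc (length as + length ys)])
      (put (as @ z # ys) m) = map_pmf (\<lambda>s. put (as @ z # s) m) (resample (p m) x ys)" for z
    using Cons[of "as @ [z]"] by (simp del: upt_Suc)
  have "exec f (map (\<lambda>i. (c, ?I i)) [length as..<length as + length (y # ys)])
      (put (as @ y # ys) m) =
    bind_pmf (bernoulli_pmf (p m)) (\<lambda>z.
      exec f (map (\<lambda>i. (c, ?I i)) [Suc (length as)..<Suc (length as + length ys)])
        (put (as @ (if z then x else y) # ys) m))"
    unfolding upt
    by (auto simp del: upt_Suc simp add: step bind_map_pmf intro!: bind_pmf_cong)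
  also have "\<dots> = map_pmf (\<lambda>s. put (as @ s) m) (resample (p m) x (y # ys))"
    unfolding IH by (simp add: map_bind_pmf map_pmf_def bind_assoc_pmf bind_return_pmf)
  finally show ?case .
qed simp

lemma exec_resample_loop:
  assumes gs: "\<And>m s. get (put s m) = s" "\<And>m s s'. put s (put s' m) = put s m"
      "\<And>m. put (get m) m = m"
    and p: "\<And>m s. p (put s m) = p m" and b: "\<And>m s. b (put s m) = b m" 
    and t: "length (get m) = t"
  shows "exec f (map (\<lambda>i. (c, guarded b (with_prob p (\<lambda>m. put ((get m)[i := x]) m)))) [0..<t]) m =
    (if b m then map_pmf (\<lambda>s. put s m) (resample (p m) x (get m)) else return_pmf m)"
  using exec_resample_loop_from[of get put p b m f c x "[]" "get m", OF gs(1,2) p b]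
  by (simp add: gs(3) t exec_guarded_loop_idle)

text \<open>Testing \<open>get m = None\<close> again in every iteration realises the early exit:
  once the reference is set, the rest of the loop is idle. The acceptance probability has to match
  \<open>g\<close> only at the indices of the loop, since the degree arrays describe the sampled
  cells only within their bounds.\<close>

lemma exec_rej_loop:
  assumes gs: "\<And>m s. get (put s m) = s" "\<And>m s s'. put s (put s' m) = put s m"
      "\<And>m. put (get m) m = m"
    and v: "\<And>m s i. v i (put s m) = v i m" and b: "\<And>m s. b (put s m) = b m"
    and p: "\<And>m s i. p i (put s m) = p i m"  "\<And>i. i \<in> set is \<Longrightarrow> p i m = g (v i m)"
  shows "exec f (map (\<lambda>i. (c, guarded (\<lambda>m. b m \<and> get m = None)
      (with_prob (p i) (\<lambda>m. put (v i m) m)))) is) m =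
    (if b m \<and> get m = None then map_pmf (\<lambda>s. put s m) (rej g (map (\<lambda>i. v i m) is))
     else return_pmf m)"
  using p(2)
proof (induction "is")
  case Nil
  then show ?case using gs(3)[of m] by auto
next
  case (Cons i "is")
  let ?I = "\<lambda>i. guarded (\<lambda>m. b m \<and> get m = None) (with_prob (p i) (\<lambda>m. put (v i m) m))"
  have put_None: "put None m = m" if "get m = None" using gs(3)[of m] that by simp
  show ?case
  proof (cases "b m \<and> get m = None")
    case True
    have "?I i f m = map_pmf (\<lambda>z. put (if z then v i m else None) m) (bernoulli_pmf (g (v i m)))"
      using True Cons(2)[of i] put_None
      by (auto simp: guarded_def with_prob_def intro!: map_pmf_cong)
    then have "exec f (map (\<lambda>i. (c, ?I i)) (i # is)) m = bind_pmf (bernoulli_pmf (g (v i m)))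
        (\<lambda>z. exec f (map (\<lambda>i. (c, ?I i)) is) (put (if z then v i m else None) m))"
      by (simp add: bind_map_pmf)
    also have "\<dots> = bind_pmf (bernoulli_pmf (g (v i m))) (\<lambda>z. if z \<and> v i m \<noteq> None
        then return_pmf (put (v i m) m) else map_pmf (\<lambda>s. put s m) (rej g (map (\<lambda>i. v i m) is)))"
    proof (rule bind_pmf_cong[OF refl], goal_cases)
      case (1 z)
      show ?case
      proof (cases "z \<and> v i m \<noteq> None")
        case True
        then show ?thesis by (auto simp: gs exec_guarded_loop_idle)
      next
        case False
        \<comment> \<open>Accepting an empty cell writes null over null and so amounts to a
          rejection.\<close>
        then have "(if z then v i m else None) = None" by auto
        then show ?thesis using Cons True put_None False by auto
      qed
    qed
    also have "\<dots> = map_pmf (\<lambda>s. put s m) (rej g (map (\<lambda>i. v i m) (i # is)))"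
      by (auto simp: map_bind_pmf intro!: bind_pmf_cong)
    finally show ?thesis using True by simp
  next
    case False
    show ?thesis
      unfolding if_not_P[OF False]
      by (rule exec_guarded_loop_idle[of "\<lambda>m. b m \<and> get m = None", OF False])
  qed
qed

lemma exec_det_loop_from:
  assumes gs: "\<And>m s. get (put s m) = s" "\<And>m s s'. put s (put s' m) = put s m"
    and h: "\<And>m s i f. h f i (put s m) = h f i m"
  shows "exec f (map (\<lambda>i. (c, det (\<lambda>f m. put ((get m)[i := get m ! i + h f i m]) m)))
      [length as..<length as + length bs]) (put (as @ bs) m) =
    return_pmf (put (as @ map (\<lambda>i. bs ! i + h f (length as + i) m) [0..<length bs]) m)"
proof (induction bs arbitrary: as)
  case (Cons y ys)
  have upt: "[length as..<length as + length (y # ys)] =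
      length as # [Suc (length as)..<Suc (length as + length ys)]"
    by (simp add: upt_conv_Cons del: upt_Suc)
  have *: "[0..<length (y # ys)] = 0 # map Suc [0..<length ys]"
    by (simp add: map_Suc_upt upt_conv_Cons del: upt_Suc)
  show ?case
    unfolding upt * using Cons[of "as @ [y + h f (length as) m]"]
    by (simp add: det_def bind_return_pmf gs h nth_append list_update_append comp_def del: upt_Suc)
qed simp

lemma exec_det_loop:
  assumes gs: "\<And>m s. get (put s m) = s" "\<And>m s s'. put s (put s' m) = put s m"
      "\<And>m. put (get m) m = m"
    and h: "\<And>m s i f. h f i (put s m) = h f i m" and t: "length (get m) = t"
  shows "exec f (map (\<lambda>i. (c, det (\<lambda>f m. put ((get m)[i := get m ! i + h f i m]) m))) [0..<t]) m =
    return_pmf (put (map (\<lambda>i. get m ! i + h f i m) [0..<t]) m)"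
  using exec_det_loop_from[of get put h f c "[]" "get m" m, OF gs(1,2) h]
  by (simp add: gs(3) t)

lemma exec_acc_loop:
  fixes get :: "'m \<Rightarrow> real"
  assumes gs: "\<And>m s. get (put s m) = s" "\<And>m s s'. put s (put s' m) = put s m"
      "\<And>m. put (get m) m = m"
    and h: "\<And>m s i. h i (put s m) = h i m" and b: "\<And>m s. b (put s m) = b m"
  shows "exec f (map (\<lambda>i. (c, guarded b (det (\<lambda>f m. put (get m + h i m) m)))) is) m =
    return_pmf (if b m then put (get m + (\<Sum>i\<leftarrow>is. h i m)) m else m)"
proof (induction "is" arbitrary: m)
  case (Cons i "is")
  then show ?case
    by (auto simp: guarded_def det_def bind_return_pmf gs h b add.assoc)
qed (simp add: gs)

section \<open>Reservoir sampling\<close>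

lemma replicate_pmf_resample:
  "bind_pmf (replicate_pmf t q) (resample p x) =
   replicate_pmf t (bind_pmf q (\<lambda>y. map_pmf (\<lambda>b. if b then x else y) (bernoulli_pmf p)))"
proof (induction t)
  case (Suc t)
  have "bind_pmf (replicate_pmf (Suc t) q) (resample p x) =
    bind_pmf q (\<lambda>y. bind_pmf (replicate_pmf t q) (\<lambda>ys. bind_pmf (bernoulli_pmf p) (\<lambda>b.
      bind_pmf (resample p x ys) (\<lambda>zs. return_pmf ((if b then x else y) # zs)))))"
    by (simp add: bind_assoc_pmf bind_return_pmf)
  \<comment> \<open>The coin of the first cell commutes with the draw of the other cells, so
    independent cells remain independent after a round of overwriting.\<close>
  also have "\<dots> = bind_pmf q (\<lambda>y. bind_pmf (bernoulli_pmf p) (\<lambda>b.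
      bind_pmf (bind_pmf (replicate_pmf t q) (resample p x))
        (\<lambda>zs. return_pmf ((if b then x else y) # zs))))"
    by (subst bind_commute_pmf) (simp add: bind_assoc_pmf)
  finally show ?case
    by (simp add: Suc bind_map_pmf bind_assoc_pmf)
qed (simp add: bind_return_pmf)

text \<open>The point mass at \<open>None\<close> models a reservoir that has received nothing yet,
  so the invariants of the passes already hold in the initial memory.\<close>

definition uniform_item :: "'b set \<Rightarrow> 'b option pmf" where
  "uniform_item A = (if A = {} then return_pmf None else pmf_of_set (Some ` A))"

text \<open>With k nodes seen so far, the new one enters with probability 1 / (k + 1), and each old
  one stays with probability 1 / k * k / (k + 1), the same value. For k = 0 the coin is certain and
  replaces the null entry.\<close>

lemma reservoir_step:
  assumes "finite A" "x \<notin> A"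
  shows "bind_pmf (uniform_item A)
      (\<lambda>y. map_pmf (\<lambda>b. if b then Some x else y) (bernoulli_pmf (1 / real (Suc (card A))))) =
    uniform_item (insert x A)"
proof (cases "A = {}")
  case True
  then show ?thesis
    by (intro pmf_eqI) (auto simp: uniform_item_def bind_return_pmf map_pmf_def pmf_bind indicator_def)
next
  case False
  define k where "k = real (card A)"
  have k: "k > 0" using False assms by (simp add: k_def card_gt_0_iff)
  have cards: "card (Some ` B) = card B" for B :: "'a set"
    by (simp add: card_image)
  show ?thesis
  proof (rule pmf_eqI)
    fix z
    have "pmf (bind_pmf (uniform_item A)
      (\<lambda>y. map_pmf (\<lambda>b. if b then Some x else y) (bernoulli_pmf (1 / real (Suc (card A)))))) z =
      (\<Sum>y\<in>A. indicator {z} (Some x) / (k + 1) + indicator {z} (Some y) * (k / (k + 1))) / k"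
    proof -
      have "pmf (map_pmf (\<lambda>b. if b then Some x else y) (bernoulli_pmf (1 / real (Suc (card A))))) z =
          indicator {z} (Some x) / (k + 1) + indicator {z} y * (k / (k + 1))" for y
        using k by (simp add: map_pmf_def pmf_bind field_simps indicator_def flip: k_def)
      then show ?thesis
        using False assms
        by (simp add: uniform_item_def pmf_bind integral_pmf_of_set cards sum.reindex k_def)
    qed
    also have "\<dots> = indicator {z} (Some x) / (k + 1) + (\<Sum>y\<in>A. indicator {z} (Some y)) / (k + 1)"
      using k by (simp add: sum.distrib add_divide_distrib k_def flip: sum_divide_distrib sum_distrib_right)
    also have "\<dots> = indicator (Some ` insert x A) z / (k + 1)"
    proof -
      have "(\<Sum>y\<in>A. indicator {z} (Some y)) = (indicator (Some ` A) z :: real)"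
      proof (cases z)
        case (Some w)
        then have "(\<Sum>y\<in>A. indicator {z} (Some y)) = (\<Sum>y\<in>A. if y = w then 1 else 0 :: real)"
          by (intro sum.cong) (auto simp: indicator_def)
        then show ?thesis using Some assms by (auto simp: indicator_def)
      qed (auto simp: indicator_def)
      then show ?thesis using assms by (auto simp: indicator_def)
    qed
    finally show "pmf (bind_pmf (uniform_item A)
      (\<lambda>y. map_pmf (\<lambda>b. if b then Some x else y) (bernoulli_pmf (1 / real (Suc (card A)))))) z =
      pmf (uniform_item (insert x A)) z"
      using assms by (simp add: uniform_item_def cards k_def add.commute del: image_insert)
  qed
qed

lemma replicate_pmf_return: "replicate_pmf t (return_pmf x) = return_pmf (replicate t x)"
  by (induction t) (auto simp: bind_return_pmf)

lemma reservoir_list_step: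
  assumes "finite A" "x \<notin> A"
  shows "bind_pmf (replicate_pmf t (uniform_item A)) (resample (1 / real (Suc (card A))) (Some x)) =
    replicate_pmf t (uniform_item (insert x A))"
  unfolding replicate_pmf_resample reservoir_step[OF assms] ..

section \<open>The program as a distribution\<close>

abbreviation scan :: "('a node \<Rightarrow> ('a, 'm) instr list) \<Rightarrow> 'a node list \<Rightarrow>
    ('a node option \<times> ('a, 'm) instr) list" where
  "scan body xs \<equiv> concat (map (\<lambda>x. map (Pair (Some x)) (body x)) xs)"

text \<open>The invariant of a pass speaks of the prefix read so far, so the inductions peel off the
  last node.\<close>

lemma exec_scan_snoc:
  "exec f (scan body (xs @ [x])) m =
   bind_pmf (exec f (scan body xs) m) (exec f (map (Pair (Some x)) (body x)))"
  by (simp add: exec_append)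

lemma exec_Nil: "exec f [] = return_pmf"
  by (simp add: fun_eq_iff)

lemma exec_singleton: "exec f [c] = snd c f"
  by (simp add: fun_eq_iff exec_Nil bind_return_pmf' del: exec.simps(1))

lemma exec_append_fun: "exec f (cs @ ds) = (\<lambda>m. bind_pmf (exec f cs m) (exec f ds))"
  by (simp add: fun_eq_iff exec_append)

lemma guarded_True: "guarded (\<lambda>_. True) c = c"
  by (simp add: guarded_def)

text \<open>The position of a node is the number of arrivals up to it, which makes
  \<open>1 / real (fst x)\<close> the reservoir probability of the first pass. It also keeps nodes
  distinct when items repeat.\<close>

definition arrival_order :: "'a node list \<Rightarrow> bool" where
  "arrival_order xs \<longleftrightarrow> map fst xs = [1..<Suc (length xs)]"

lemma arrival_order_snoc:
  "arrival_order (xs @ [x]) \<longleftrightarrow> arrival_order xs \<and> fst x = Suc (length xs)"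
  by (auto simp: arrival_order_def)

lemma arrival_order_distinct: "arrival_order xs \<Longrightarrow> distinct xs"
  unfolding arrival_order_def by (metis distinct_map distinct_upt)

lemma arrival_order_enumerate: "arrival_order (List.enumerate 1 \<sigma>)"
  by (simp add: arrival_order_def)

section \<open>The first pass: independent uniform nodes\<close>

lemma exec_pass1_node:
  assumes "length (S1 m) = size_t1 n \<epsilon>"
  shows "exec f (map (Pair c) (pass1 n \<epsilon> x)) m =
    map_pmf (\<lambda>s. m\<lparr>S1 := s\<rparr>) (resample (1 / real (fst x)) (Some x) (S1 m))"
  using exec_resample_loop[of S1 "\<lambda>s m. m\<lparr>S1 := s\<rparr>" "\<lambda>_. 1 / real (fst x)" "\<lambda>_. True" m
      "size_t1 n \<epsilon>" f c "Some x"] assms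
  by (simp add: pass1_def guarded_True comp_def)

lemma exec_pass1:
  assumes "arrival_order xs"
  shows "exec f (scan (pass1 n \<epsilon>) xs) (initial_mem n \<epsilon>) =
    map_pmf (\<lambda>s. (initial_mem n \<epsilon>)\<lparr>S1 := s\<rparr>)
      (replicate_pmf (size_t1 n \<epsilon>) (uniform_item (set xs)))"
  using assms
proof (induction xs rule: rev_induct)
  case Nil
  then show ?case by (simp add: uniform_item_def replicate_pmf_return initial_mem_def)
next
  case (snoc x xs)
  let ?m = "\<lambda>s. (initial_mem n \<epsilon>)\<lparr>S1 := s\<rparr>"
  have x: "fst x = Suc (card (set xs))" "x \<notin> set xs"
    using snoc.prems arrival_order_distinct[of "xs @ [x]"]
    by (auto simp: arrival_order_snoc distinct_card)
  have "exec f (scan (pass1 n \<epsilon>) (xs @ [x])) (initial_mem n \<epsilon>) =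
    bind_pmf (replicate_pmf (size_t1 n \<epsilon>) (uniform_item (set xs)))
      (\<lambda>s. map_pmf ?m (resample (1 / real (Suc (card (set xs)))) (Some x) s))"
    unfolding exec_scan_snoc using snoc
    by (auto simp: arrival_order_snoc bind_map_pmf exec_pass1_node x set_replicate_pmf
        intro!: bind_pmf_cong)
  also have "\<dots> = map_pmf ?m (replicate_pmf (size_t1 n \<epsilon>) (uniform_item (insert x (set xs))))"
    by (subst reservoir_list_step[symmetric]) (auto simp: map_bind_pmf x)
  finally show ?case by simp
qed

section \<open>The second pass: classification and three independent arrays\<close>

definition score :: "('a \<Rightarrow> 'a \<Rightarrow> real) \<Rightarrow> 'a node option list \<Rightarrow> 'a node \<Rightarrow> real" where
  "score f s x = (\<Sum>c\<leftarrow>s. sim f c x)"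

definition heavy :: "nat \<Rightarrow> real \<Rightarrow> ('a \<Rightarrow> 'a \<Rightarrow> real) \<Rightarrow> 'a node option list \<Rightarrow> 'a node set \<Rightarrow> 'a node set"
  where "heavy n \<epsilon> f s A = {x \<in> A. threshold n \<epsilon> \<le> score f s x}"

definition light :: "nat \<Rightarrow> real \<Rightarrow> ('a \<Rightarrow> 'a \<Rightarrow> real) \<Rightarrow> 'a node option list \<Rightarrow> 'a node set \<Rightarrow> 'a node set"
  where "light n \<epsilon> f s A = {x \<in> A. \<not> threshold n \<epsilon> \<le> score f s x}"

definition heavy_weight ::
  "nat \<Rightarrow> real \<Rightarrow> ('a \<Rightarrow> 'a \<Rightarrow> real) \<Rightarrow> 'a node option list \<Rightarrow> 'a node set \<Rightarrow> real" where
  "heavy_weight n \<epsilon> f s A =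
     (\<Sum>x\<in>heavy n \<epsilon> f s A. inverse (real n / real (size_t1 n \<epsilon>) * score f s x))"

text \<open>The exact memory after the prefix \<open>xs\<close>. The register \<open>YY\<close>
  still contains the score of the last node, as it is reset only when the next one arrives.\<close>

definition mem2 :: "nat \<Rightarrow> real \<Rightarrow> ('a \<Rightarrow> 'a \<Rightarrow> real) \<Rightarrow> 'a node option list \<Rightarrow> 'a node list \<Rightarrow>
    'a node option list \<Rightarrow> 'a node option list \<Rightarrow> 'a node option list \<Rightarrow> 'a mem" where
  "mem2 n \<epsilon> f s xs sh sl s2 = (initial_mem n \<epsilon>)
     \<lparr>S1 := s, S2 := s2, SH := sh, SL := sl, WH := heavy_weight n \<epsilon> f s (set xs),
      nH := card (heavy n \<epsilon> f s (set xs)), nL := card (light n \<epsilon> f s (set xs)),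
      YY := (if xs = [] then 0 else score f s (last xs))\<rparr>"

lemma heavy_insert:
  "heavy n \<epsilon> f s (insert x A) =
     (if threshold n \<epsilon> \<le> score f s x then insert x (heavy n \<epsilon> f s A) else heavy n \<epsilon> f s A)"
  by (auto simp: heavy_def)

lemma light_insert:
  "light n \<epsilon> f s (insert x A) =
     (if threshold n \<epsilon> \<le> score f s x then light n \<epsilon> f s A else insert x (light n \<epsilon> f s A))"
  by (auto simp: light_def)

lemma finite_heavy: "finite A \<Longrightarrow> finite (heavy n \<epsilon> f s A)"
  by (simp add: heavy_def)

lemma finite_light: "finite A \<Longrightarrow> finite (light n \<epsilon> f s A)"
  by (simp add: light_def)

lemma exec_pass2_score:
  assumes "length (S1 m) = size_t1 n \<epsilon>"
  shows "exec f (map (\<lambda>i. (c, det (\<lambda>f m. m\<lparr>YY := YY m + sim f (S1 m ! i) x\<rparr>))) [0..<size_t1 n \<epsilon>])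
      (m\<lparr>YY := 0\<rparr>) = return_pmf (m\<lparr>YY := score f (S1 m) x\<rparr>)"
proof -
  have "exec f (map (\<lambda>i. (c, det (\<lambda>f m. m\<lparr>YY := YY m + sim f (S1 m ! i) x\<rparr>))) is) m =
      return_pmf (m\<lparr>YY := YY m + (\<Sum>i\<leftarrow>is. sim f (S1 m ! i) x)\<rparr>)" for "is" m
    by (induction "is" arbitrary: m) (simp_all add: det_def bind_return_pmf add.assoc)
  from this[of "[0..<size_t1 n \<epsilon>]" "m\<lparr>YY := 0\<rparr>"]
  have acc: "exec f (map (\<lambda>i. (c, det (\<lambda>f m. m\<lparr>YY := YY m + sim f (S1 m ! i) x\<rparr>))) [0..<size_t1 n \<epsilon>])
      (m\<lparr>YY := 0\<rparr>) = return_pmf (m\<lparr>YY := \<Sum>i\<leftarrow>[0..<size_t1 n \<epsilon>]. sim f (S1 m ! i) x\<rparr>)"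
    by simp
  have eq: "map (\<lambda>i. sim f (S1 m ! i) x) [0..<size_t1 n \<epsilon>] = map (\<lambda>c. sim f c x) (S1 m)"
    using assms by (intro nth_equalityI) auto
  show ?thesis
    unfolding score_def eq[symmetric] by (rule acc)
qed

text \<open>After the score is computed no instruction for this node changes \<open>YY\<close>, so
  all guards take the same branch. The counter is increased before the arrays are sampled, whence
  the successor of the cardinality.\<close>

lemma exec_pass2_node:
  assumes len: "length s = size_t1 n \<epsilon>" "length sh = size_t n" "length sl = size_t n"
      "length s2 = size_t2 n \<epsilon>"
    and x: "x \<notin> set xs"
  shows "exec f (map (Pair c) (pass2 n \<epsilon> x)) (mem2 n \<epsilon> f s xs sh sl s2) =
    (if threshold n \<epsilon> \<le> score f s x
     then map_pmf (\<lambda>sh'. mem2 n \<epsilon> f s (xs @ [x]) sh' sl s2)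
       (resample (1 / real (Suc (card (heavy n \<epsilon> f s (set xs))))) (Some x) sh)
     else bind_pmf (resample (1 / real (Suc (card (light n \<epsilon> f s (set xs))))) (Some x) sl)
       (\<lambda>sl'. map_pmf (\<lambda>s2'. mem2 n \<epsilon> f s (xs @ [x]) sh sl' s2')
         (resample (1 / real (Suc (card (light n \<epsilon> f s (set xs))))) (Some x) s2)))"
proof -
  define m where "m = mem2 n \<epsilon> f s xs sh sl s2"
  let ?hv = "\<lambda>m. threshold n \<epsilon> \<le> YY m"
  define m1 where "m1 = m\<lparr>YY := score f s x\<rparr>"
  define m2 where "m2 = (if ?hv m1
     then m1\<lparr>WH := WH m1 + inverse (real n / real (size_t1 n \<epsilon>) * YY m1), nH := nH m1 + 1\<rparr>
     else m1\<lparr>nL := nL m1 + 1\<rparr>)"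
  have S1: "S1 m = s" by (simp add: m_def mem2_def)
  have lens: "length (SH m) = size_t n" "length (SL m) = size_t n" "length (S2 m) = size_t2 n \<epsilon>"
    using len by (auto simp: m_def mem2_def)
  have sel: "SH m2 = SH m" "SL m2 = SL m" "S2 m2 = S2 m" "YY m2 = YY m1"
    by (auto simp: m2_def m1_def)
  have init: "exec f ([(c, det (\<lambda>f m. m\<lparr>YY := 0\<rparr>))] @
      map (\<lambda>i. (c, det (\<lambda>f m. m\<lparr>YY := YY m + sim f (S1 m ! i) x\<rparr>))) [0..<size_t1 n \<epsilon>] @
      [(c, guarded ?hv (det (\<lambda>f m. m\<lparr>WH := WH m + inverse (real n / real (size_t1 n \<epsilon>) * YY m),
                      nH := nH m + 1\<rparr>))),
       (c, guarded (\<lambda>m. \<not> ?hv m) (det (\<lambda>f m. m\<lparr>nL := nL m + 1\<rparr>)))]) m = return_pmf m2"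
    using exec_pass2_score[of m n \<epsilon> f c x] len(1)
    by (auto simp: exec_append S1 det_def[of "\<lambda>f m. m\<lparr>YY := 0\<rparr>"] bind_return_pmf guarded_def m2_def m1_def)
       (auto simp: det_def bind_return_pmf)
  have SH: "exec f (map (\<lambda>i. (c, guarded ?hv (with_prob (\<lambda>m. 1 / real (nH m))
      (\<lambda>m. m\<lparr>SH := (SH m)[i := Some x]\<rparr>)))) [0..<size_t n]) m =
      (if ?hv m then map_pmf (\<lambda>s. m\<lparr>SH := s\<rparr>) (resample (1 / real (nH m)) (Some x) (SH m))
       else return_pmf m)" if "length (SH m) = size_t n" for m :: "'a mem"
    using exec_resample_loop[of SH "\<lambda>s m. m\<lparr>SH := s\<rparr>" "\<lambda>m. 1 / real (nH m)" ?hv m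
      "size_t n" f c "Some x"] that by simp
  have SL: "exec f (map (\<lambda>i. (c, guarded (\<lambda>m. \<not> ?hv m) (with_prob (\<lambda>m. 1 / real (nL m))
      (\<lambda>m. m\<lparr>SL := (SL m)[i := Some x]\<rparr>)))) [0..<size_t n]) m =
      (if \<not> ?hv m then map_pmf (\<lambda>s. m\<lparr>SL := s\<rparr>) (resample (1 / real (nL m)) (Some x) (SL m))
       else return_pmf m)" if "length (SL m) = size_t n" for m :: "'a mem"
    using exec_resample_loop[of SL "\<lambda>s m. m\<lparr>SL := s\<rparr>" "\<lambda>m. 1 / real (nL m)" "\<lambda>m. \<not> ?hv m" m
      "size_t n" f c "Some x"] that by simp
  have S2: "exec f (map (\<lambda>i. (c, guarded (\<lambda>m. \<not> ?hv m) (with_prob (\<lambda>m. 1 / real (nL m))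
      (\<lambda>m. m\<lparr>S2 := (S2 m)[i := Some x]\<rparr>)))) [0..<size_t2 n \<epsilon>]) m =
      (if \<not> ?hv m then map_pmf (\<lambda>s. m\<lparr>S2 := s\<rparr>) (resample (1 / real (nL m)) (Some x) (S2 m))
       else return_pmf m)" if "length (S2 m) = size_t2 n \<epsilon>" for m :: "'a mem"
    using exec_resample_loop[of S2 "\<lambda>s m. m\<lparr>S2 := s\<rparr>" "\<lambda>m. 1 / real (nL m)" "\<lambda>m. \<not> ?hv m" m
      "size_t2 n \<epsilon>" f c "Some x"] that by simp
  have "exec f (map (Pair c) (pass2 n \<epsilon> x)) m =
     bind_pmf (bind_pmf (bind_pmf (return_pmf m2)
      (exec f (map (\<lambda>i. (c, guarded ?hv (with_prob (\<lambda>m. 1 / real (nH m))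
         (\<lambda>m. m\<lparr>SH := (SH m)[i := Some x]\<rparr>)))) [0..<size_t n])))
      (exec f (map (\<lambda>i. (c, guarded (\<lambda>m. \<not> ?hv m) (with_prob (\<lambda>m. 1 / real (nL m))
         (\<lambda>m. m\<lparr>SL := (SL m)[i := Some x]\<rparr>)))) [0..<size_t n])))
      (exec f (map (\<lambda>i. (c, guarded (\<lambda>m. \<not> ?hv m) (with_prob (\<lambda>m. 1 / real (nL m))
         (\<lambda>m. m\<lparr>S2 := (S2 m)[i := Some x]\<rparr>)))) [0..<size_t2 n \<epsilon>]))"
    unfolding init[symmetric] exec_append[symmetric]
    by (simp only: pass2_def Let_def map_append map_map comp_def list.map append_assoc)
  also have "\<dots> = (if ?hv m1
     then map_pmf (\<lambda>s. m2\<lparr>SH := s\<rparr>) (resample (1 / real (nH m2)) (Some x) (SH m2))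
     else bind_pmf (resample (1 / real (nL m2)) (Some x) (SL m2)) (\<lambda>sl.
        map_pmf (\<lambda>s. m2\<lparr>SL := sl, S2 := s\<rparr>) (resample (1 / real (nL m2)) (Some x) (S2 m2))))"
    by (simp add: bind_return_pmf bind_return_pmf' SH SL S2 sel lens bind_map_pmf)
       (simp add: map_pmf_def S2 SL sel lens bind_assoc_pmf bind_return_pmf bind_return_pmf')
  also have "\<dots> = (if threshold n \<epsilon> \<le> score f s x
     then map_pmf (\<lambda>sh'. mem2 n \<epsilon> f s (xs @ [x]) sh' sl s2)
       (resample (1 / real (Suc (card (heavy n \<epsilon> f s (set xs))))) (Some x) sh)
     else bind_pmf (resample (1 / real (Suc (card (light n \<epsilon> f s (set xs))))) (Some x) sl)
       (\<lambda>sl'. map_pmf (\<lambda>s2'. mem2 n \<epsilon> f s (xs @ [x]) sh sl' s2')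
         (resample (1 / real (Suc (card (light n \<epsilon> f s (set xs))))) (Some x) s2)))"
  proof -
    have "x \<notin> heavy n \<epsilon> f s (set xs)" "x \<notin> light n \<epsilon> f s (set xs)"
      using x by (auto simp: heavy_def light_def)
    then show ?thesis
      by (auto simp: m2_def m1_def m_def mem2_def heavy_weight_def heavy_insert light_insert
          finite_heavy finite_light add.commute intro!: map_pmf_cong bind_pmf_cong mem.equality)
  qed
  finally show ?thesis by (simp add: m_def)
qed

lemma exec_pass2:
  assumes "distinct xs" "length s = size_t1 n \<epsilon>"
  shows "exec f (scan (pass2 n \<epsilon>) xs) ((initial_mem n \<epsilon>)\<lparr>S1 := s\<rparr>) =
    do {sh \<leftarrow> replicate_pmf (size_t n) (uniform_item (heavy n \<epsilon> f s (set xs)));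
        sl \<leftarrow> replicate_pmf (size_t n) (uniform_item (light n \<epsilon> f s (set xs)));
        s2 \<leftarrow> replicate_pmf (size_t2 n \<epsilon>) (uniform_item (light n \<epsilon> f s (set xs)));
        return_pmf (mem2 n \<epsilon> f s xs sh sl s2)}"
  using assms(1)
proof (induction xs rule: rev_induct)
  case Nil
  then show ?case
    by (simp add: heavy_def light_def uniform_item_def replicate_pmf_return bind_return_pmf
        mem2_def initial_mem_def heavy_weight_def)
next
  case (snoc x xs)
  let ?H = "heavy n \<epsilon> f s (set xs)" and ?L = "light n \<epsilon> f s (set xs)"
  let ?pH = "replicate_pmf (size_t n) (uniform_item ?H)"
  let ?pL = "replicate_pmf (size_t n) (uniform_item ?L)"
  let ?p2 = "replicate_pmf (size_t2 n \<epsilon>) (uniform_item ?L)"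
  let ?rH = "resample (1 / real (Suc (card ?H))) (Some x)"
  let ?rL = "resample (1 / real (Suc (card ?L))) (Some x)"
  let ?m = "mem2 n \<epsilon> f s (xs @ [x])"
  have x: "x \<notin> set xs" "x \<notin> ?H" "x \<notin> ?L" using snoc.prems by (auto simp: heavy_def light_def)
  have "exec f (scan (pass2 n \<epsilon>) (xs @ [x])) ((initial_mem n \<epsilon>)\<lparr>S1 := s\<rparr>) =
    do {sh \<leftarrow> ?pH; sl \<leftarrow> ?pL; s2 \<leftarrow> ?p2;
        exec f (map (Pair (Some x)) (pass2 n \<epsilon> x)) (mem2 n \<epsilon> f s xs sh sl s2)}"
    unfolding exec_scan_snoc using snoc by (simp add: bind_assoc_pmf bind_return_pmf)
  also have "\<dots> = do {sh \<leftarrow> ?pH; sl \<leftarrow> ?pL; s2 \<leftarrow> ?p2;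
      if threshold n \<epsilon> \<le> score f s x then map_pmf (\<lambda>sh'. ?m sh' sl s2) (?rH sh)
      else bind_pmf (?rL sl) (\<lambda>sl'. map_pmf (?m sh sl') (?rL s2))}"
    by (intro bind_pmf_cong refl exec_pass2_node) (use assms x in \<open>auto simp: set_replicate_pmf\<close>)
  also have "\<dots> = do {sh \<leftarrow> replicate_pmf (size_t n) (uniform_item (heavy n \<epsilon> f s (set (xs @ [x]))));
        sl \<leftarrow> replicate_pmf (size_t n) (uniform_item (light n \<epsilon> f s (set (xs @ [x]))));
        s2 \<leftarrow> replicate_pmf (size_t2 n \<epsilon>) (uniform_item (light n \<epsilon> f s (set (xs @ [x]))));
        return_pmf (?m sh sl s2)}"
  proof (cases "threshold n \<epsilon> \<le> score f s x")
    case True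
    \<comment> \<open>Independent draws commute. This moves the overwriting of an array next to the
      draw of the same array, where the reservoir step applies; the arrays of the other class are
      untouched.\<close>
    have "do {sh \<leftarrow> ?pH; sl \<leftarrow> ?pL; s2 \<leftarrow> ?p2; map_pmf (\<lambda>sh'. ?m sh' sl s2) (?rH sh)} =
      do {sh \<leftarrow> ?pH; sl \<leftarrow> ?pL; sh' \<leftarrow> ?rH sh; s2 \<leftarrow> ?p2; return_pmf (?m sh' sl s2)}"
      unfolding map_pmf_def by (intro bind_pmf_cong refl bind_commute_pmf)
    also have "\<dots> = do {sh \<leftarrow> ?pH; sh' \<leftarrow> ?rH sh; sl \<leftarrow> ?pL; s2 \<leftarrow> ?p2; return_pmf (?m sh' sl s2)}"
      by (intro bind_pmf_cong refl bind_commute_pmf)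
    also have "\<dots> = do {sh' \<leftarrow> bind_pmf ?pH ?rH; sl \<leftarrow> ?pL; s2 \<leftarrow> ?p2; return_pmf (?m sh' sl s2)}"
      by (simp add: bind_assoc_pmf)
    finally show ?thesis
      using True x by (simp add: heavy_insert light_insert reservoir_list_step finite_heavy
          del: of_nat_Suc)
  next
    case False
    have "do {sh \<leftarrow> ?pH; sl \<leftarrow> ?pL; s2 \<leftarrow> ?p2; sl' \<leftarrow> ?rL sl; map_pmf (?m sh sl') (?rL s2)} =
      do {sh \<leftarrow> ?pH; sl \<leftarrow> ?pL; sl' \<leftarrow> ?rL sl; s2 \<leftarrow> ?p2; map_pmf (?m sh sl') (?rL s2)}"
      by (intro bind_pmf_cong refl bind_commute_pmf)
    also have "\<dots> = do {sh \<leftarrow> ?pH; sl' \<leftarrow> bind_pmf ?pL ?rL; s2' \<leftarrow> bind_pmf ?p2 ?rL;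
        return_pmf (?m sh sl' s2')}"
      by (simp add: bind_assoc_pmf map_pmf_def)
    finally show ?thesis
      using False x by (simp add: heavy_insert light_insert reservoir_list_step finite_light
          del: of_nat_Suc)
  qed
  finally show ?case .
qed

section \<open>The third pass and the rejection loops\<close>

definition node_degree :: "('a \<Rightarrow> 'a \<Rightarrow> real) \<Rightarrow> 'a node list \<Rightarrow> 'a node option \<Rightarrow> real" where
  "node_degree f xs c = (\<Sum>y\<leftarrow>xs. sim f c y)"

lemma exec_pass3_node:
  assumes "length (DD m) = size_t2 n \<epsilon>" "length (DH m) = size_t n" "length (DL m) = size_t n"
  shows "exec f (map (Pair c) (pass3 n \<epsilon> x)) m = return_pmf (m
    \<lparr>DD := map (\<lambda>i. DD m ! i + sim f (S2 m ! i) x) [0..<size_t2 n \<epsilon>],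
     DH := map (\<lambda>i. DH m ! i + sim f (SH m ! i) x) [0..<size_t n],
     DL := map (\<lambda>i. DL m ! i + sim f (SL m ! i) x) [0..<size_t n]\<rparr>)"
proof -
  have DD: "exec f (map (\<lambda>i. (c, det (\<lambda>f m. m\<lparr>DD := (DD m)[i := DD m ! i + sim f (S2 m ! i) x]\<rparr>)))
      [0..<size_t2 n \<epsilon>]) m =
    return_pmf (m\<lparr>DD := map (\<lambda>i. DD m ! i + sim f (S2 m ! i) x) [0..<size_t2 n \<epsilon>]\<rparr>)"
    if "length (DD m) = size_t2 n \<epsilon>" for m :: "'a mem"
    using exec_det_loop[of DD "\<lambda>s m. m\<lparr>DD := s\<rparr>" "\<lambda>f i m. sim f (S2 m ! i) x" m "size_t2 n \<epsilon>" f c]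
      that by simp
  have DH: "exec f (map (\<lambda>i. (c, det (\<lambda>f m. m\<lparr>DH := (DH m)[i := DH m ! i + sim f (SH m ! i) x]\<rparr>)))
      [0..<size_t n]) m =
    return_pmf (m\<lparr>DH := map (\<lambda>i. DH m ! i + sim f (SH m ! i) x) [0..<size_t n]\<rparr>)"
    if "length (DH m) = size_t n" for m :: "'a mem"
    using exec_det_loop[of DH "\<lambda>s m. m\<lparr>DH := s\<rparr>" "\<lambda>f i m. sim f (SH m ! i) x" m "size_t n" f c]
      that by simp
  have DL: "exec f (map (\<lambda>i. (c, det (\<lambda>f m. m\<lparr>DL := (DL m)[i := DL m ! i + sim f (SL m ! i) x]\<rparr>)))
      [0..<size_t n]) m =
    return_pmf (m\<lparr>DL := map (\<lambda>i. DL m ! i + sim f (SL m ! i) x) [0..<size_t n]\<rparr>)"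
    if "length (DL m) = size_t n" for m :: "'a mem"
    using exec_det_loop[of DL "\<lambda>s m. m\<lparr>DL := s\<rparr>" "\<lambda>f i m. sim f (SL m ! i) x" m "size_t n" f c]
      that by simp
  show ?thesis
    by (simp add: pass3_def exec_append comp_def DD DH DL bind_return_pmf assms)
qed

lemma exec_pass3:
  assumes "DD m = replicate (size_t2 n \<epsilon>) 0" "DH m = replicate (size_t n) 0"
    "DL m = replicate (size_t n) 0"
  shows "exec f (scan (pass3 n \<epsilon>) xs) m = return_pmf (m
    \<lparr>DD := map (\<lambda>i. node_degree f xs (S2 m ! i)) [0..<size_t2 n \<epsilon>],
     DH := map (\<lambda>i. node_degree f xs (SH m ! i)) [0..<size_t n],
     DL := map (\<lambda>i. node_degree f xs (SL m ! i)) [0..<size_t n]\<rparr>)"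
proof (induction xs rule: rev_induct)
  case Nil
  then show ?case
    using assms by (simp add: node_degree_def map_replicate_const)
next
  case (snoc x xs)
  show ?case
    unfolding exec_scan_snoc snoc bind_return_pmf
    by (subst exec_pass3_node) (auto simp: node_degree_def intro!: mem.equality)
qed

text \<open>The flags say whether the heavy and the light class are non-empty. With them in place of
  the counters, the result depends on the memory only through the two picks and the two
  weights.\<close>

definition decide :: "bool \<Rightarrow> bool \<Rightarrow> real \<Rightarrow> 'a node option \<Rightarrow> 'a node option \<Rightarrow> real \<Rightarrow> 'a result pmf"
  where "decide h l a rh rl w =
    (if (rh = None \<and> h) \<or> (rl = None \<and> l) then return_pmf Fail
     else map_pmf (\<lambda>b. Return (if b then rh else rl)) (bernoulli_pmf (a / (a + w))))"

definition light_weight ::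
    "nat \<Rightarrow> real \<Rightarrow> ('a \<Rightarrow> 'a \<Rightarrow> real) \<Rightarrow> 'a node list \<Rightarrow> nat \<Rightarrow> 'a node option list \<Rightarrow> real" where
  "light_weight n \<epsilon> f xs k s2 =
     (if k > 0 then real k / real (size_t2 n \<epsilon>) * (\<Sum>c\<leftarrow>s2. 1 / node_degree f xs c) else 0)"

definition pick_heavy where
  "pick_heavy n f xs = rej (\<lambda>c. min 1 (sqrt (real n) / node_degree f xs c))"

definition pick_light where
  "pick_light f xs = rej (\<lambda>c. 1 / node_degree f xs c)"

lemma exec_final:
  assumes len: "length (SH m) = size_t n" "length (SL m) = size_t n" "length (S2 m) = size_t2 n \<epsilon>"
    and D: "DD m = map (\<lambda>i. node_degree f xs (S2 m ! i)) [0..<size_t2 n \<epsilon>]"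
      "DH m = map (\<lambda>i. node_degree f xs (SH m ! i)) [0..<size_t n]"
      "DL m = map (\<lambda>i. node_degree f xs (SL m ! i)) [0..<size_t n]"
    and z: "WL m = 0" "rH m = None" "rL m = None"
  shows "bind_pmf (exec f (map (Pair None) (final_phase n \<epsilon>)) m) final_answer =
    do {rh \<leftarrow> if nH m > 0 then pick_heavy n f xs (SH m) else return_pmf None;
        rl \<leftarrow> if nL m > 0 then pick_light f xs (SL m) else return_pmf None;
        decide (nH m > 0) (nL m > 0) (WH m) rh rl (light_weight n \<epsilon> f xs (nL m) (S2 m))}"
proof -
  let ?N = "None :: 'a node option"
  define W where "W = light_weight n \<epsilon> f xs (nL m) (S2 m)"
  have acc: "exec f (map (\<lambda>i. (?N, guarded (\<lambda>m. nL m > 0) (det (\<lambda>f m. m\<lparr>WL := WL m + 1 / DD m ! i\<rparr>))))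
      [0..<size_t2 n \<epsilon>]) m =
    return_pmf (if nL m > 0 then m\<lparr>WL := \<Sum>i\<leftarrow>[0..<size_t2 n \<epsilon>]. 1 / DD m ! i\<rparr> else m)"
    using exec_acc_loop[of WL "\<lambda>s m. m\<lparr>WL := s\<rparr>" "\<lambda>i m. 1 / DD m ! i" "\<lambda>m. nL m > 0" f ?N
      "[0..<size_t2 n \<epsilon>]" m] z by simp
  have sum: "(\<Sum>i\<leftarrow>[0..<size_t2 n \<epsilon>]. 1 / DD m ! i) = (\<Sum>c\<leftarrow>S2 m. 1 / node_degree f xs c)"
  proof -
    have "map (\<lambda>i. 1 / DD m ! i) [0..<size_t2 n \<epsilon>] = map (\<lambda>c. 1 / node_degree f xs c) (S2 m)"
      using len(3) D(1) by (intro nth_equalityI) auto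
    then show ?thesis by simp
  qed
  have rH: "exec f (map (\<lambda>i. (?N, guarded (\<lambda>m. nH m > 0 \<and> rH m = None)
        (with_prob (\<lambda>m. min 1 (sqrt (real n) / DH m ! i)) (\<lambda>m. m\<lparr>rH := SH m ! i\<rparr>)))) [0..<size_t n])
        (m\<lparr>WL := w\<rparr>) =
     (if nH m > 0 then map_pmf (\<lambda>r. m\<lparr>WL := w, rH := r\<rparr>) (pick_heavy n f xs (SH m))
      else return_pmf (m\<lparr>WL := w\<rparr>))" for w
  proof -
    have "map (\<lambda>i. SH m ! i) [0..<size_t n] = SH m"
      using len by (metis map_nth)
    then show ?thesis
      using exec_rej_loop[of rH "\<lambda>s m. m\<lparr>rH := s\<rparr>" "\<lambda>i m. SH m ! i" "\<lambda>m. nH m > 0"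
          "\<lambda>i m. min 1 (sqrt (real n) / DH m ! i)" "[0..<size_t n]" "m\<lparr>WL := w\<rparr>"
          "\<lambda>c. min 1 (sqrt (real n) / node_degree f xs c)" f ?N] z len D
      by (simp add: pick_heavy_def)
  qed
  have rL: "exec f (map (\<lambda>i. (?N, guarded (\<lambda>m. nL m > 0 \<and> rL m = None)
        (with_prob (\<lambda>m. 1 / DL m ! i) (\<lambda>m. m\<lparr>rL := SL m ! i\<rparr>)))) [0..<size_t n])
        (m\<lparr>WL := w, rH := r\<rparr>) =
     (if nL m > 0 then map_pmf (\<lambda>r'. m\<lparr>WL := w, rH := r, rL := r'\<rparr>) (pick_light f xs (SL m))
      else return_pmf (m\<lparr>WL := w, rH := r\<rparr>))" for w r
  proof -
    have "map (\<lambda>i. SL m ! i) [0..<size_t n] = SL m"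
      using len by (metis map_nth)
    then show ?thesis
      using exec_rej_loop[of rL "\<lambda>s m. m\<lparr>rL := s\<rparr>" "\<lambda>i m. SL m ! i" "\<lambda>m. nL m > 0"
          "\<lambda>i m. 1 / DL m ! i" "[0..<size_t n]" "m\<lparr>WL := w, rH := r\<rparr>"
          "\<lambda>c. 1 / node_degree f xs c" f ?N] z len D
      by (simp add: pick_light_def)
  qed
  \<comment> \<open>Both references are still null, so a skipped loop can be described as one that
    writes \<open>None\<close>. This removes the case distinctions on the counters.\<close>
  have keep: "m\<lparr>WL := w\<rparr> = m\<lparr>WL := w, rH := None\<rparr>" 
    "m\<lparr>WL := w, rH := r\<rparr> = m\<lparr>WL := w, rH := r, rL := None\<rparr>" for w r
    using z by (auto intro!: mem.equality)
  have "exec f (map (Pair None) (final_phase n \<epsilon>)) m = bind_pmf (bind_pmf (bind_pmf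
     (exec f (map (\<lambda>i. (?N, guarded (\<lambda>m. nL m > 0) (det (\<lambda>f m. m\<lparr>WL := WL m + 1 / DD m ! i\<rparr>))))
      [0..<size_t2 n \<epsilon>]) m)
     (guarded (\<lambda>m. nL m > 0) (det (\<lambda>f m. m\<lparr>WL := real (nL m) / real (size_t2 n \<epsilon>) * WL m\<rparr>)) f))
     (exec f (map (\<lambda>i. (?N, guarded (\<lambda>m. nH m > 0 \<and> rH m = None)
        (with_prob (\<lambda>m. min 1 (sqrt (real n) / DH m ! i)) (\<lambda>m. m\<lparr>rH := SH m ! i\<rparr>)))) [0..<size_t n])))
     (exec f (map (\<lambda>i. (?N, guarded (\<lambda>m. nL m > 0 \<and> rL m = None)
        (with_prob (\<lambda>m. 1 / DL m ! i) (\<lambda>m. m\<lparr>rL := SL m ! i\<rparr>)))) [0..<size_t n]))"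
    by (simp only: final_phase_def map_append map_map comp_def list.map exec_append_fun exec_singleton
        bind_assoc_pmf snd_conv)
  also have "\<dots> = do {rh \<leftarrow> if nH m > 0 then pick_heavy n f xs (SH m) else return_pmf None;
        rl \<leftarrow> if nL m > 0 then pick_light f xs (SL m) else return_pmf None;
        return_pmf (m\<lparr>WL := W, rH := rh, rL := rl\<rparr>)}"
  proof -
    have W: "guarded (\<lambda>m. nL m > 0) (det (\<lambda>f m. m\<lparr>WL := real (nL m) / real (size_t2 n \<epsilon>) * WL m\<rparr>)) f
       (if nL m > 0 then m\<lparr>WL := \<Sum>i\<leftarrow>[0..<size_t2 n \<epsilon>]. 1 / DD m ! i\<rparr> else m) = 
       return_pmf (m\<lparr>WL := W\<rparr>)"
      using z(1) unfolding sum
      by (auto simp: guarded_def det_def W_def light_weight_def intro!: mem.equality)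
    have 1: "(if nH m > 0 then map_pmf (\<lambda>r. m\<lparr>WL := W, rH := r\<rparr>) (pick_heavy n f xs (SH m))
        else return_pmf (m\<lparr>WL := W\<rparr>)) = map_pmf (\<lambda>r. m\<lparr>WL := W, rH := r\<rparr>)
          (if nH m > 0 then pick_heavy n f xs (SH m) else return_pmf None)"
      using keep(1) by auto
    have 2: "(if nL m > 0 then map_pmf (\<lambda>r'. m\<lparr>WL := w, rH := r, rL := r'\<rparr>) (pick_light f xs (SL m))
        else return_pmf (m\<lparr>WL := w, rH := r\<rparr>)) = map_pmf (\<lambda>r'. m\<lparr>WL := w, rH := r, rL := r'\<rparr>)
          (if nL m > 0 then pick_light f xs (SL m) else return_pmf None)" for w r
      using keep(2) by auto
    show ?thesis
      unfolding acc bind_return_pmf W rH 1 bind_map_pmf comp_def rL 2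
      by (simp add: map_pmf_def)
  qed
  finally have run: "exec f (map (Pair None) (final_phase n \<epsilon>)) m = \<dots>" .
  have "final_answer (m\<lparr>WL := W, rH := rh, rL := rl\<rparr>) =
      decide (nH m > 0) (nL m > 0) (WH m) rh rl W" for rh rl
    by (simp add: final_answer_def decide_def cong: if_cong)
  then show ?thesis
    by (simp only: run bind_assoc_pmf bind_return_pmf W_def)
qed

section \<open>The law of the whole run, conditioned on the array \<open>S1\<close>\<close>

definition outcome :: "nat \<Rightarrow> real \<Rightarrow> ('a \<Rightarrow> 'a \<Rightarrow> real) \<Rightarrow> 'a node list \<Rightarrow> 'a node option list \<Rightarrow>
    'a result pmf" where
  "outcome n \<epsilon> f xs s =
     (let H = heavy n \<epsilon> f s (set xs); L = light n \<epsilon> f s (set xs) in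
      do {rh \<leftarrow> if H \<noteq> {} then bind_pmf (replicate_pmf (size_t n) (uniform_item H)) (pick_heavy n f xs)
                else return_pmf None;
          rl \<leftarrow> if L \<noteq> {} then bind_pmf (replicate_pmf (size_t n) (uniform_item L)) (pick_light f xs)
                else return_pmf None;
          w \<leftarrow> map_pmf (light_weight n \<epsilon> f xs (card L)) (replicate_pmf (size_t2 n \<epsilon>) (uniform_item L));
          decide (H \<noteq> {}) (L \<noteq> {}) (heavy_weight n \<epsilon> f s (set xs)) rh rl w})"

text \<open>The program draws all arrays first and consumes them later. Commuting independent draws
  puts each array next to its consumer, which exhibits the heavy pick, the light pick and the light
  weight as independent given \<open>S1\<close>.\<close>

lemma run_algorithm_B:
  "run (algorithm_B n \<epsilon>) f \<sigma> =
   bind_pmf (replicate_pmf (size_t1 n \<epsilon>) (uniform_item (set (List.enumerate 1 \<sigma>))))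
     (outcome n \<epsilon> f (List.enumerate 1 \<sigma>))"
proof -
  define xs where "xs = List.enumerate 1 \<sigma>"
  have xs: "arrival_order xs" "distinct xs"
    using arrival_order_enumerate arrival_order_distinct by (auto simp: xs_def)
  let ?P = "replicate_pmf (size_t1 n \<epsilon>) (uniform_item (set xs))"
  let ?I = "initial_mem n \<epsilon>"
  have "run (algorithm_B n \<epsilon>) f \<sigma> = bind_pmf (exec f (scan (pass1 n \<epsilon>) xs) ?I) (\<lambda>m.
    bind_pmf (exec f (scan (pass2 n \<epsilon>) xs) m) (\<lambda>m. bind_pmf (exec f (scan (pass3 n \<epsilon>) xs) m)
     (\<lambda>m. bind_pmf (exec f (map (Pair None) (final_phase n \<epsilon>)) m) final_answer)))"
    by (simp add: run_def schedule_def algorithm_B_def pass_schedule_def xs_def exec_append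
        bind_assoc_pmf)
  also have "\<dots> = bind_pmf ?P (\<lambda>s. bind_pmf (exec f (scan (pass2 n \<epsilon>) xs) (?I\<lparr>S1 := s\<rparr>))
     (\<lambda>m. bind_pmf (exec f (scan (pass3 n \<epsilon>) xs) m)
     (\<lambda>m. bind_pmf (exec f (map (Pair None) (final_phase n \<epsilon>)) m) final_answer)))"
    by (simp add: exec_pass1[OF xs(1)] bind_map_pmf)
  also have "\<dots> = bind_pmf ?P (outcome n \<epsilon> f xs)"
  proof (intro bind_pmf_cong refl)
    fix s assume "s \<in> set_pmf ?P"
    then have s: "length s = size_t1 n \<epsilon>" by (simp add: set_replicate_pmf)
    define H L where "H = heavy n \<epsilon> f s (set xs)" and "L = light n \<epsilon> f s (set xs)"
    have fin: "card H > 0 \<longleftrightarrow> H \<noteq> {}" "card L > 0 \<longleftrightarrow> L \<noteq> {}"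
      using finite_heavy[of "set xs"] finite_light[of "set xs"]
      by (auto simp: H_def L_def card_gt_0_iff)
    let ?pH = "replicate_pmf (size_t n) (uniform_item H)"
    let ?pL = "replicate_pmf (size_t n) (uniform_item L)"
    let ?p2 = "replicate_pmf (size_t2 n \<epsilon>) (uniform_item L)"
    let ?d = "decide (H \<noteq> {}) (L \<noteq> {}) (heavy_weight n \<epsilon> f s (set xs))"
    let ?w = "light_weight n \<epsilon> f xs (card L)"
    let ?rh = "\<lambda>sh. if H \<noteq> {} then pick_heavy n f xs sh else return_pmf None"
    let ?rl = "\<lambda>sl. if L \<noteq> {} then pick_light f xs sl else return_pmf None"
    have "bind_pmf (exec f (scan (pass2 n \<epsilon>) xs) (?I\<lparr>S1 := s\<rparr>))
     (\<lambda>m. bind_pmf (exec f (scan (pass3 n \<epsilon>) xs) m)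
     (\<lambda>m. bind_pmf (exec f (map (Pair None) (final_phase n \<epsilon>)) m) final_answer)) =
     do {sh \<leftarrow> ?pH; sl \<leftarrow> ?pL; s2 \<leftarrow> ?p2; rh \<leftarrow> ?rh sh; rl \<leftarrow> ?rl sl; ?d rh rl (?w s2)}"
      unfolding exec_pass2[OF xs(2) s] bind_assoc_pmf bind_return_pmf H_def[symmetric] L_def[symmetric]
    proof (intro bind_pmf_cong refl, goal_cases)
      case (1 sh sl s2)
      define m where "m = mem2 n \<epsilon> f s xs sh sl s2"
      have m: "length sh = size_t n" "length sl = size_t n" "length s2 = size_t2 n \<epsilon>"
        using 1 by (auto simp: set_replicate_pmf)
      have "exec f (scan (pass3 n \<epsilon>) xs) m = return_pmf (m
        \<lparr>DD := map (\<lambda>i. node_degree f xs (S2 m ! i)) [0..<size_t2 n \<epsilon>],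
         DH := map (\<lambda>i. node_degree f xs (SH m ! i)) [0..<size_t n],
         DL := map (\<lambda>i. node_degree f xs (SL m ! i)) [0..<size_t n]\<rparr>)"
        by (rule exec_pass3) (simp_all add: m_def mem2_def initial_mem_def)
      then have "bind_pmf (exec f (scan (pass3 n \<epsilon>) xs) m)
          (\<lambda>m. bind_pmf (exec f (map (Pair None) (final_phase n \<epsilon>)) m) final_answer) =
        bind_pmf (exec f (map (Pair None) (final_phase n \<epsilon>)) (m
        \<lparr>DD := map (\<lambda>i. node_degree f xs (S2 m ! i)) [0..<size_t2 n \<epsilon>],
         DH := map (\<lambda>i. node_degree f xs (SH m ! i)) [0..<size_t n],
         DL := map (\<lambda>i. node_degree f xs (SL m ! i)) [0..<size_t n]\<rparr>)) final_answer"
        by (simp add: bind_return_pmf)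
      also have "\<dots> = do {rh \<leftarrow> ?rh sh; rl \<leftarrow> ?rl sl; ?d rh rl (?w s2)}"
        by (subst exec_final[where xs = xs])
           (simp_all add: m_def mem2_def initial_mem_def m fin flip: H_def L_def)
      finally show ?case by (simp add: m_def)
    qed
    also have "\<dots> = do {sh \<leftarrow> ?pH; sl \<leftarrow> ?pL; rh \<leftarrow> ?rh sh; s2 \<leftarrow> ?p2; rl \<leftarrow> ?rl sl; ?d rh rl (?w s2)}"
      by (intro bind_pmf_cong refl bind_commute_pmf)
    also have "\<dots> = do {sh \<leftarrow> ?pH; rh \<leftarrow> ?rh sh; sl \<leftarrow> ?pL; s2 \<leftarrow> ?p2; rl \<leftarrow> ?rl sl; ?d rh rl (?w s2)}"
      by (intro bind_pmf_cong refl bind_commute_pmf)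
    also have "\<dots> = do {sh \<leftarrow> ?pH; rh \<leftarrow> ?rh sh; sl \<leftarrow> ?pL; rl \<leftarrow> ?rl sl; s2 \<leftarrow> ?p2; ?d rh rl (?w s2)}"
      by (intro bind_pmf_cong refl bind_commute_pmf)
    also have "\<dots> = do {rh \<leftarrow> bind_pmf ?pH ?rh; rl \<leftarrow> bind_pmf ?pL ?rl; w \<leftarrow> map_pmf ?w ?p2; ?d rh rl w}"
      by (simp add: bind_assoc_pmf bind_map_pmf)
    also have "\<dots> = outcome n \<epsilon> f xs s"
      by (simp add: outcome_def Let_def flip: H_def L_def)
    finally show "bind_pmf (exec f (scan (pass2 n \<epsilon>) xs) (?I\<lparr>S1 := s\<rparr>))
     (\<lambda>m. bind_pmf (exec f (scan (pass3 n \<epsilon>) xs) m)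
     (\<lambda>m. bind_pmf (exec f (map (Pair None) (final_phase n \<epsilon>)) m) final_answer)) = outcome n \<epsilon> f xs s" .
  qed
  finally show ?thesis by (simp add: xs_def)
qed

section \<open>Queries and space\<close>

text \<open>An invariant of every instruction. It gives the space bound and keeps the array accesses
  within bounds.\<close>

definition arrays_sized :: "nat \<Rightarrow> real \<Rightarrow> 'a mem \<Rightarrow> bool" where
  "arrays_sized n \<epsilon> m \<longleftrightarrow>
     length (S1 m) = size_t1 n \<epsilon> \<and> length (S2 m) = size_t2 n \<epsilon> \<and>
     length (SH m) = size_t n \<and> length (SL m) = size_t n \<and>
     length (DD m) = size_t2 n \<epsilon> \<and> length (DH m) = size_t n \<and> length (DL m) = size_t n"

lemma set_schedule:
  assumes "(cur, c) \<in> set (schedule (algorithm_B n \<epsilon>) \<sigma>)"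
  shows "(\<exists>x. cur = Some x \<and> c \<in> set (pass1 n \<epsilon> x) \<union> set (pass2 n \<epsilon> x) \<union> set (pass3 n \<epsilon> x))
    \<or> cur = None \<and> c \<in> set (final_phase n \<epsilon>)"
  using assms by (auto simp: schedule_def algorithm_B_def pass_schedule_def)

lemma arrays_sized_step:
  assumes "(cur, c) \<in> set (schedule (algorithm_B n \<epsilon>) \<sigma>)" "arrays_sized n \<epsilon> m" "m' \<in> set_pmf (c f m)"
  shows "arrays_sized n \<epsilon> m'"
  using set_schedule[OF assms(1)] assms(2,3)
  by (elim disjE conjE exE)
     (auto simp: pass1_def pass2_def pass3_def final_phase_def det_def guarded_def with_prob_def
       arrays_sized_def Let_def split: if_splits)

lemma arrays_sized_exec:
  assumes "set cs \<subseteq> set (schedule (algorithm_B n \<epsilon>) \<sigma>)" "arrays_sized n \<epsilon> m" "m' \<in> set_pmf (exec f cs m)"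
  shows "arrays_sized n \<epsilon> m'"
  using assms
proof (induction cs arbitrary: m)
  case (Cons c cs)
  then show ?case
    using arrays_sized_step[of "fst c" "snd c" n \<epsilon> \<sigma> m _ f] by auto
qed simp

lemma arrays_sized_reachable:
  assumes "m \<in> reachable (algorithm_B n \<epsilon>) f \<sigma> k"
  shows "arrays_sized n \<epsilon> m"
proof -
  have "arrays_sized n \<epsilon> (initial_mem n \<epsilon>)"
    by (simp add: arrays_sized_def initial_mem_def)
  then show ?thesis
    using assms arrays_sized_exec[OF set_take_subset]
    by (auto simp: reachable_def algorithm_B_def)
qed

lemma sim_cong:
  assumes "\<forall>x\<in>A. \<forall>y\<in>A. g x y = f x y" "snd x \<in> A"
    "i < length s" "\<And>z. s ! i = Some z \<Longrightarrow> snd z \<in> A"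
  shows "sim g (s ! i) x = sim f (s ! i) x"
  using assms by (cases "s ! i") auto

lemma stored_available:
  assumes "s \<in> {S1 m, S2 m, SH m, SL m}" "i < length s" "s ! i = Some z"
  shows "snd z \<in> available (algorithm_B n \<epsilon>) cur m"
proof -
  have "Some z \<in> set s" using assms(2,3) by (metis nth_mem)
  moreover have "Item (snd z) \<in> set (node_cells (Some z))" by (cases z) auto
  ultimately show ?thesis
    using assms(1)
    by (auto simp: available_def algorithm_B_def mem_cells_def simp del: node_cells.simps)
qed

lemma queries_only_memory_algorithm_B: "queries_only_memory (algorithm_B n \<epsilon>) f \<sigma>"
  unfolding queries_only_memory_def Let_def
proof (intro allI impI ballI, clarify)
  fix k m cur c g
  assume k: "k < length (schedule (algorithm_B n \<epsilon>) \<sigma>)"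
    and m: "m \<in> reachable (algorithm_B n \<epsilon>) f \<sigma> k"
    and c: "schedule (algorithm_B n \<epsilon>) \<sigma> ! k = (cur, c)"
    and g: "\<forall>x\<in>available (algorithm_B n \<epsilon>) cur m. \<forall>y\<in>available (algorithm_B n \<epsilon>) cur m. g x y = f x y"
  note len = arrays_sized_reachable[OF m, unfolded arrays_sized_def]
  have "(cur, c) \<in> set (schedule (algorithm_B n \<epsilon>) \<sigma>)"
    using k c by (metis nth_mem)
  from set_schedule[OF this] show "c g m = c f m"
  proof (elim disjE exE conjE)
    fix x assume x: "cur = Some x"
      and c: "c \<in> set (pass1 n \<epsilon> x) \<union> set (pass2 n \<epsilon> x) \<union> set (pass3 n \<epsilon> x)"
    \<comment> \<open>Queries occur only through \<open>sim\<close>, between a stored node and the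
      arriving one. The index must be in range: otherwise \<open>s ! i\<close> is unspecified and
      need not be in memory.\<close>
    have "sim g (s ! i) x = sim f (s ! i) x"
      if "s \<in> {S1 m, S2 m, SH m, SL m}" "i < length s" for s i
    proof (rule sim_cong[OF g _ that(2)])
      show "snd x \<in> available (algorithm_B n \<epsilon>) cur m"
        using x by (simp add: available_def)
    qed (rule stored_available[OF that])
    then show ?thesis
      using c len
      by (auto simp: pass1_def pass2_def pass3_def det_def guarded_def with_prob_def Let_def)
  qed (auto simp: final_phase_def det_def guarded_def with_prob_def)
qed

lemma length_node_cells: "length (node_cells c) = 2"
  by (cases c rule: node_cells.cases) auto

lemma length_mem_cells:
  assumes "arrays_sized n \<epsilon> m"
  shows "length (mem_cells n \<epsilon> m) = 2 * size_t1 n \<epsilon> + 3 * size_t2 n \<epsilon> + 6 * size_t n + 15"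
proof -
  have "length (concat (map node_cells cs)) = 2 * length cs" for cs :: "'a node option list"
    by (induction cs) (auto simp: length_node_cells)
  from this[of "S1 m @ S2 m @ SH m @ SL m @ [rH m, rL m]"] show ?thesis
    using assms by (simp add: mem_cells_def arrays_sized_def length_node_cells)
qed

text \<open>The arrays contribute 2 * 768 + 3 * 576 + 6 * 12 = 3336 multiples of \<open>v\<close>,
  where 768 = 48 * 16 and 576 = 36 * 16. Rounding and registers add 34 words, at most 68 * v because
  v \<ge> 1 / 2. The latter uses n \<ge> 2, as the logarithm vanishes at 1.\<close>

lemma space_bounded_by_algorithm_B:
  assumes e: "0 < \<epsilon>" "\<epsilon> < 1" and n: "n \<ge> 2"
  shows "space_bounded_by (algorithm_B n \<epsilon>) f \<sigma> (4000 * (1 / \<epsilon>\<^sup>2 * sqrt (real n) * ln (real n)))"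
  unfolding space_bounded_by_def
proof (intro allI impI ballI)
  fix k m assume "m \<in> reachable (algorithm_B n \<epsilon>) f \<sigma> k"
  define u where "u = sqrt (real n) * ln (real n)"
  define v where "v = u / \<epsilon>\<^sup>2"
  have "1 * (1 / 2) \<le> u"
    unfolding u_def
  proof (intro mult_mono)
    have "1 / 2 \<le> ln (2::real)" using ln2_ge_two_thirds by simp
    also have "\<dots> \<le> ln (real n)" using n by simp
    finally show "1 / 2 \<le> ln (real n)" .
  qed (use n in auto)
  then have u: "1 / 2 \<le> u" by simp
  have "u * 1 \<le> u * (1 / \<epsilon>\<^sup>2)"
    using u e by (intro mult_left_mono) (auto simp: power_le_one)
  then have uv: "u \<le> v" by (simp add: v_def)
  have "real (size_t n) \<le> 12 * u + 1" "real (size_t1 n \<epsilon>) \<le> 768 * v + 1" "real (size_t2 n \<epsilon>) \<le> 576 * v + 1"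
    using u uv
    by (simp_all add: size_t_def size_t1_def size_t2_def u_def v_def power_divide field_simps)
       linarith+
  then have "real (words (algorithm_B n \<epsilon>) m) \<le> 4000 * v"
    using uv u length_mem_cells[OF arrays_sized_reachable[OF \<open>m \<in> _\<close>]]
    by (simp add: words_def algorithm_B_def)
  then show "real (words (algorithm_B n \<epsilon>) m) \<le> 4000 * (1 / \<epsilon>\<^sup>2 * sqrt (real n) * ln (real n))"
    by (simp add: v_def u_def)
qed

section \<open>Rejection sampling and the final decision\<close>

lemma set_uniform_item: "finite B \<Longrightarrow> set_pmf (uniform_item B) = (if B = {} then {None} else Some ` B)"
  by (simp add: uniform_item_def)

lemma finite_set_uniform_item: "finite B \<Longrightarrow> finite (set_pmf (uniform_item B))"
  by (simp add: set_uniform_item)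

lemma expectation_uniform_item:
  assumes "finite B" "B \<noteq> {}"
  shows "measure_pmf.expectation (uniform_item B) h = (\<Sum>x\<in>B. h (Some x)) / real (card B)"
  using assms by (simp add: uniform_item_def integral_pmf_of_set sum.reindex card_image)

lemma expectation_replicate_pmf_sum_list:
  fixes g :: "'b \<Rightarrow> real"
  assumes fin: "finite (set_pmf p)"
  shows "measure_pmf.expectation (replicate_pmf t p) (\<lambda>xs. sum_list (map g xs)) =
    real t * measure_pmf.expectation p g"
proof (induction t)
  case (Suc t)
  have "measure_pmf.expectation (replicate_pmf (Suc t) p) (\<lambda>xs. sum_list (map g xs)) =
      measure_pmf.expectation p (\<lambda>x.
        measure_pmf.expectation (replicate_pmf t p) (\<lambda>xs. g x + sum_list (map g xs)))"
    by (simp add: expectation_bind_finite_pmf fin finite_set_replicate_pmf)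
  also have "\<dots> = measure_pmf.expectation p (\<lambda>x. g x + real t * measure_pmf.expectation p g)"
    by (simp add: Bochner_Integration.integral_add integrable_measure_pmf_finite fin finite_set_replicate_pmf Suc)
  also have "\<dots> = real (Suc t) * measure_pmf.expectation p g"
    by (simp add: Bochner_Integration.integral_add integrable_measure_pmf_finite fin algebra_simps)
  finally show ?case .
qed simp

text \<open>Condition on the first cell and its coin: either it is accepted, or the loop restarts
  with one cell less. Here \<open>a\<close> is the mean acceptance probability of one round.\<close>

lemma pmf_rej_step:
  assumes B: "finite B" "B \<noteq> {}" and g: "\<And>x. x \<in> B \<Longrightarrow> 0 \<le> g (Some x) \<and> g (Some x) \<le> 1"
  defines "a \<equiv> (\<Sum>x\<in>B. g (Some x)) / real (card B)"
  shows "pmf (bind_pmf (replicate_pmf (Suc t) (uniform_item B)) (rej g)) z =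
    (\<Sum>x\<in>B. g (Some x) * indicator {Some x} z) / real (card B) +
    (1 - a) * pmf (bind_pmf (replicate_pmf t (uniform_item B)) (rej g)) z"
proof -
  let ?R = "bind_pmf (replicate_pmf t (uniform_item B)) (rej g)"
  have "bind_pmf (replicate_pmf (Suc t) (uniform_item B)) (rej g) =
    bind_pmf (uniform_item B) (\<lambda>c. bind_pmf (replicate_pmf t (uniform_item B)) (\<lambda>cs.
      bind_pmf (bernoulli_pmf (g c)) (\<lambda>b. if b \<and> c \<noteq> None then return_pmf c else rej g cs)))"
    by (simp add: bind_assoc_pmf bind_return_pmf)
  also have "\<dots> = bind_pmf (uniform_item B) (\<lambda>c. bind_pmf (bernoulli_pmf (g c)) (\<lambda>b.
      bind_pmf (replicate_pmf t (uniform_item B)) (\<lambda>cs. if b \<and> c \<noteq> None then return_pmf c else rej g cs)))"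
    by (intro bind_pmf_cong refl bind_commute_pmf)
  finally have "pmf (bind_pmf (replicate_pmf (Suc t) (uniform_item B)) (rej g)) z =
    (\<Sum>x\<in>B. pmf (bind_pmf (bernoulli_pmf (g (Some x))) (\<lambda>b.
      bind_pmf (replicate_pmf t (uniform_item B)) (\<lambda>cs. if b then return_pmf (Some x) else rej g cs))) z) /
      real (card B)"
    by (simp add: pmf_bind[of "uniform_item B"] expectation_uniform_item[OF B])
  also have "(\<Sum>x\<in>B. pmf (bind_pmf (bernoulli_pmf (g (Some x))) (\<lambda>b.
      bind_pmf (replicate_pmf t (uniform_item B)) (\<lambda>cs. if b then return_pmf (Some x) else rej g cs))) z) =
    (\<Sum>x\<in>B. g (Some x) * indicator {Some x} z + (1 - g (Some x)) * pmf ?R z)"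
    using g by (intro sum.cong refl) (auto simp: pmf_bind[of "bernoulli_pmf _"] indicator_def)
  also have "\<dots> / real (card B) = (\<Sum>x\<in>B. g (Some x) * indicator {Some x} z) / real (card B) +
      (1 - a) * pmf ?R z"
    using B by (simp add: sum.distrib sum_subtractf a_def add_divide_distrib diff_divide_distrib
        card_gt_0_iff left_diff_distrib flip: sum_distrib_right)
  finally show ?thesis .
qed

text \<open>Solution of the recurrence. Every round accepts in proportion to \<open>g\<close>, so
  the number of rounds affects the chance of success but not the distribution given success.\<close>

lemma pmf_rej:
  fixes t :: nat
  assumes B: "finite B" "B \<noteq> {}" and g: "\<And>x. x \<in> B \<Longrightarrow> 0 \<le> g (Some x) \<and> g (Some x) \<le> 1"
    and pos: "(\<Sum>x\<in>B. g (Some x)) > 0"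
  defines "a \<equiv> (\<Sum>x\<in>B. g (Some x)) / real (card B)"
  defines "R \<equiv> bind_pmf (replicate_pmf t (uniform_item B)) (rej g)"
  shows "pmf R None = (1 - a) ^ t"
    and "x \<in> B \<Longrightarrow> pmf R (Some x) = g (Some x) / (\<Sum>x\<in>B. g (Some x)) * (1 - (1 - a) ^ t)"
proof -
  have card: "real (card B) > 0" using B by (simp add: card_gt_0_iff)
  show "pmf R None = (1 - a) ^ t"
    unfolding R_def
    by (induction t) (simp add: bind_return_pmf, subst pmf_rej_step[where B = B and g = g, OF B g], auto simp: a_def)
  show "pmf R (Some x) = g (Some x) / (\<Sum>x\<in>B. g (Some x)) * (1 - (1 - a) ^ t)" if "x \<in> B"
    unfolding R_def
  proof (induction t)
    case (Suc t)
    have "(\<Sum>y\<in>B. g (Some y) * indicator {Some y} (Some x)) = (\<Sum>y\<in>B. if y = x then g (Some x) else 0)"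
      by (intro sum.cong) auto
    also have "\<dots> = g (Some x)" using that B by simp
    finally have sum: "(\<Sum>y\<in>B. g (Some y) * indicator {Some y} (Some x)) = g (Some x)" .
    define c where "c = g (Some x) / (\<Sum>x\<in>B. g (Some x))"
    have c: "g (Some x) / real (card B) = c * a"
      using pos by (simp add: a_def c_def)
    have "pmf (bind_pmf (replicate_pmf (Suc t) (uniform_item B)) (rej g)) (Some x) =
        (\<Sum>y\<in>B. g (Some y) * indicator {Some y} (Some x)) / real (card B) + (1 - a) *
        pmf (bind_pmf (replicate_pmf t (uniform_item B)) (rej g)) (Some x)"
      unfolding a_def by (rule pmf_rej_step[where g = g, OF B]) (rule g)
    also have "\<dots> = c * a + (1 - a) * (c * (1 - (1 - a) ^ t))"
      unfolding sum c Suc c_def[symmetric] ..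
    finally have "pmf (bind_pmf (replicate_pmf (Suc t) (uniform_item B)) (rej g)) (Some x) =
      c * a + (1 - a) * (c * (1 - (1 - a) ^ t))" .
    then show ?case
      unfolding c_def[symmetric] by (simp add: algebra_simps)
  qed (simp add: bind_return_pmf)
qed

lemma set_rej: "set_pmf (rej g cs) \<subseteq> insert None (set cs)"
  by (induction cs) (auto split: if_splits)

section \<open>The final decision and the expected share of a class\<close>

definition accepted :: "bool \<Rightarrow> 'b option \<Rightarrow> bool" where
  "accepted b r \<longleftrightarrow> \<not> (r = None \<and> b)"

lemma pmf_decide:
  assumes "0 \<le> a" "0 \<le> w"
  shows "pmf (decide h l a rh rl w) Fail = 1 - of_bool (accepted h rh) * of_bool (accepted l rl)"
    and "pmf (decide h l a rh rl w) (Return z) = of_bool (accepted h rh) * of_bool (accepted l rl) *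
      (of_bool (rh = z) * (a / (a + w)) + of_bool (rl = z) * (1 - a / (a + w)))"
proof -
  have b: "0 \<le> a / (a + w)" "a / (a + w) \<le> 1"
    using assms by (auto simp: divide_le_eq_1)
  have "pmf (map_pmf (\<lambda>b. Return (if b then rh else rl)) (bernoulli_pmf (a / (a + w)))) v =
      of_bool (Return rh = v) * (a / (a + w)) + of_bool (Return rl = v) * (1 - a / (a + w))" for v
    using b by (simp add: map_pmf_def pmf_bind indicator_def)
  then show "pmf (decide h l a rh rl w) Fail = 1 - of_bool (accepted h rh) * of_bool (accepted l rl)"
    "pmf (decide h l a rh rl w) (Return z) = of_bool (accepted h rh) * of_bool (accepted l rl) *
      (of_bool (rh = z) * (a / (a + w)) + of_bool (rl = z) * (1 - a / (a + w)))"
    by (auto simp: decide_def accepted_def)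
qed

text \<open>The picks and the weight are independent, so the probabilities factor, and failure does
  not involve the weight. The support conditions express that a node of one class is never the pick
  of the other; an empty class counts as accepted and cannot cause failure.\<close>

lemma pmf_bind_decide:
  fixes ph pl :: "'a node option pmf" and h l :: bool
  assumes fin: "finite (set_pmf ph)" "finite (set_pmf pl)" "finite (set_pmf pw)"
    and a: "0 \<le> a" and w: "\<And>w. w \<in> set_pmf pw \<Longrightarrow> 0 \<le> w"
  defines "T \<equiv> do {rh \<leftarrow> ph; rl \<leftarrow> pl; w \<leftarrow> pw; decide h l a rh rl w}"
  defines "ah \<equiv> measure_pmf.expectation ph (\<lambda>r. of_bool (accepted h r))"
    and "al \<equiv> measure_pmf.expectation pl (\<lambda>r. of_bool (accepted l r))"
  shows "pmf T Fail = 1 - ah * al"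
    and "Some x \<notin> set_pmf pl \<Longrightarrow>
      pmf T (Return (Some x)) = pmf ph (Some x) * al * measure_pmf.expectation pw (\<lambda>w. a / (a + w))"
    and "Some x \<notin> set_pmf ph \<Longrightarrow>
      pmf T (Return (Some x)) = ah * pmf pl (Some x) * measure_pmf.expectation pw (\<lambda>w. 1 - a / (a + w))"
proof -
  note int = integrable_measure_pmf_finite[OF fin(1)] integrable_measure_pmf_finite[OF fin(2)] integrable_measure_pmf_finite[OF fin(3)]
  have pmf_T: "pmf T z = measure_pmf.expectation ph (\<lambda>rh. measure_pmf.expectation pl (\<lambda>rl.
      measure_pmf.expectation pw (\<lambda>w. pmf (decide h l a rh rl w) z)))" for z
    by (simp add: T_def pmf_bind)
  have "measure_pmf.expectation pw (\<lambda>w. pmf (decide h l a rh rl w) Fail) =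
      1 - of_bool (accepted h rh) * of_bool (accepted l rl)" for rh rl :: "'a node option"
  proof -
    have "measure_pmf.expectation pw (\<lambda>w. pmf (decide h l a rh rl w) Fail) =
      measure_pmf.expectation pw (\<lambda>w. 1 - of_bool (accepted h rh) * of_bool (accepted l rl))"
      by (intro expectation_cong_pmf pmf_decide(1) a w)
    then show ?thesis by simp
  qed
  then show "pmf T Fail = 1 - ah * al"
    by (simp add: pmf_T int ah_def al_def)
  have pmf_Some: "pmf ph (Some x) = measure_pmf.expectation ph (\<lambda>r. of_bool (r = Some x))" for x and ph :: "'a node option pmf"
  proof -
    have "measure_pmf.expectation ph (\<lambda>r. of_bool (r = Some x)) =
       measure_pmf.expectation ph (indicat_real {Some x})"
      by (intro expectation_cong_pmf) (auto simp: indicator_def)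
    then show ?thesis by (simp add: measure_pmf_single)
  qed
  show "pmf T (Return (Some x)) = pmf ph (Some x) * al * measure_pmf.expectation pw (\<lambda>w. a / (a + w))"
    if x: "Some x \<notin> set_pmf pl"
  proof -
    have "measure_pmf.expectation pw (\<lambda>w. pmf (decide h l a rh rl w) (Return (Some x))) =
       of_bool (rh = Some x) * of_bool (accepted l rl) * measure_pmf.expectation pw (\<lambda>w. a / (a + w))"
      if "rl \<in> set_pmf pl" for rh rl
    proof -
      have "measure_pmf.expectation pw (\<lambda>w. pmf (decide h l a rh rl w) (Return (Some x))) =
        measure_pmf.expectation pw (\<lambda>w. of_bool (rh = Some x) * of_bool (accepted l rl) * (a / (a + w)))"
        using x that
        by (intro expectation_cong_pmf) (auto simp: pmf_decide(2)[OF a w] accepted_def)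
      then show ?thesis by simp
    qed
    then have "pmf T (Return (Some x)) = measure_pmf.expectation ph (\<lambda>rh. measure_pmf.expectation pl (\<lambda>rl.
      of_bool (rh = Some x) * of_bool (accepted l rl) * measure_pmf.expectation pw (\<lambda>w. a / (a + w))))"
      unfolding pmf_T by (intro expectation_cong_pmf) auto
    then show ?thesis by (simp add: pmf_Some al_def)
  qed
  show "pmf T (Return (Some x)) = ah * pmf pl (Some x) * measure_pmf.expectation pw (\<lambda>w. 1 - a / (a + w))"
    if x: "Some x \<notin> set_pmf ph"
  proof -
    have "measure_pmf.expectation pw (\<lambda>w. pmf (decide h l a rh rl w) (Return (Some x))) =
       of_bool (accepted h rh) * of_bool (rl = Some x) * measure_pmf.expectation pw (\<lambda>w. 1 - a / (a + w))"
      if "rh \<in> set_pmf ph" for rh rl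
    proof -
      have "measure_pmf.expectation pw (\<lambda>w. pmf (decide h l a rh rl w) (Return (Some x))) =
        measure_pmf.expectation pw (\<lambda>w. of_bool (accepted h rh) * of_bool (rl = Some x) * (1 - a / (a + w)))"
        using x that
        by (intro expectation_cong_pmf) (auto simp: pmf_decide(2)[OF a w] accepted_def)
      then show ?thesis by simp
    qed
    then have "pmf T (Return (Some x)) = measure_pmf.expectation ph (\<lambda>rh. measure_pmf.expectation pl (\<lambda>rl.
      of_bool (accepted h rh) * of_bool (rl = Some x) * measure_pmf.expectation pw (\<lambda>w. 1 - a / (a + w))))"
      unfolding pmf_T by (intro expectation_cong_pmf) auto
    then show ?thesis by (simp add: pmf_Some ah_def)
  qed
qed

text \<open>The lower bound on the first and the upper bound on the second expectation are Jensen's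
  inequality; the term \<open>(w - \<mu>)\<^sup>2 / (w * \<mu>)\<close> bounds the second-order remainder.\<close>

lemma expectation_share_bounds:
  fixes pw :: "real pmf"
  assumes fin: "finite (set_pmf pw)" and w: "\<And>w. w \<in> set_pmf pw \<Longrightarrow> w > 0"
    and \<mu>: "measure_pmf.expectation pw (\<lambda>w. w) = \<mu>" "\<mu> > 0" and a: "a \<ge> 0"
    and V: "V = measure_pmf.expectation pw (\<lambda>w. (w - \<mu>)\<^sup>2 / (w * \<mu>))"
  shows "a / (a + \<mu>) \<le> measure_pmf.expectation pw (\<lambda>w. a / (a + w))"
    "measure_pmf.expectation pw (\<lambda>w. a / (a + w)) \<le> (1 + V) * (a / (a + \<mu>))"
    "(1 - V) * (\<mu> / (a + \<mu>)) \<le> measure_pmf.expectation pw (\<lambda>w. 1 - a / (a + w))"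
    "measure_pmf.expectation pw (\<lambda>w. 1 - a / (a + w)) \<le> \<mu> / (a + \<mu>)"
proof -
  let ?E = "measure_pmf.expectation pw"
  define r where "r = (\<lambda>w. (w - \<mu>)\<^sup>2 / (w * \<mu>))"
  note int = integrable_measure_pmf_finite[OF fin]
  have lin: "?E (\<lambda>w. b + c * (w - \<mu>) + d * r w) = b + d * V" for b c d
    by (simp add: int Bochner_Integration.integral_add \<mu>(1) V flip: r_def)
  have pw: "0 \<le> a / (a + w) - (a / (a + \<mu>) + (- a / (a + \<mu>)\<^sup>2) * (w - \<mu>))"
      "a / (a + w) - (a / (a + \<mu>) + (- a / (a + \<mu>)\<^sup>2) * (w - \<mu>)) \<le> a / (a + \<mu>) * r w"
      "a / (a + w) - (a / (a + \<mu>) + (- a / (a + \<mu>)\<^sup>2) * (w - \<mu>)) \<le> \<mu> / (a + \<mu>) * r w"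
    if "w > 0" for w
  proof -
    have p: "a + w > 0" "a + \<mu> > 0" using that \<mu> a by auto
    \<comment> \<open>Exact remainder of the tangent at \<mu>. The linear part has mean 0, so only
      this term contributes to the expectation.\<close>
    have eq: "a / (a + w) - (a / (a + \<mu>) + (- a / (a + \<mu>)\<^sup>2) * (w - \<mu>)) =
      a / (a + \<mu>) * ((w - \<mu>)\<^sup>2 / ((a + w) * (a + \<mu>)))"
      using p by (simp add: divide_simps power2_eq_square) (simp add: algebra_simps)
    show "0 \<le> a / (a + w) - (a / (a + \<mu>) + (- a / (a + \<mu>)\<^sup>2) * (w - \<mu>))"
      unfolding eq using p a by simp
    have "(w - \<mu>)\<^sup>2 / ((a + w) * (a + \<mu>)) \<le> r w"
      unfolding r_def using that \<mu> a by (intro divide_left_mono mult_mono) auto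
    then show "a / (a + w) - (a / (a + \<mu>) + (- a / (a + \<mu>)\<^sup>2) * (w - \<mu>)) \<le> a / (a + \<mu>) * r w"
      unfolding eq using p a by (intro mult_left_mono) auto
    \<comment> \<open>A second bound on the same remainder, relative to the light share this time.
      Either share may be tiny, so each needs an error proportional to itself.\<close>
    have "a / (a + \<mu>) * ((w - \<mu>)\<^sup>2 / ((a + w) * (a + \<mu>))) \<le> 1 * ((w - \<mu>)\<^sup>2 / (w * (a + \<mu>)))"
      using that \<mu> a p by (intro mult_mono divide_left_mono) auto
    also have "\<dots> = \<mu> / (a + \<mu>) * r w"
      using that \<mu> p by (simp add: r_def)
    finally show "a / (a + w) - (a / (a + \<mu>) + (- a / (a + \<mu>)\<^sup>2) * (w - \<mu>)) \<le> \<mu> / (a + \<mu>) * r w"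
      unfolding eq .
  qed
  have 1: "?E (\<lambda>w. a / (a + \<mu>) + (- a / (a + \<mu>)\<^sup>2) * (w - \<mu>) + 0 * r w) \<le> ?E (\<lambda>w. a / (a + w))"
  proof (rule expectation_mono_finite_pmf[OF fin], goal_cases)
    case (1 w)
    show ?case unfolding mult_zero_left using pw(1)[OF w[OF 1]] by linarith
  qed
  have 2: "?E (\<lambda>w. a / (a + w)) \<le>
      ?E (\<lambda>w. a / (a + \<mu>) + (- a / (a + \<mu>)\<^sup>2) * (w - \<mu>) + a / (a + \<mu>) * r w)"
  proof (rule expectation_mono_finite_pmf[OF fin], goal_cases)
    case (1 w)
    show ?case using pw(2)[OF w[OF 1]] by linarith
  qed
  have 3: "?E (\<lambda>w. a / (a + w)) \<le>
      ?E (\<lambda>w. a / (a + \<mu>) + (- a / (a + \<mu>)\<^sup>2) * (w - \<mu>) + \<mu> / (a + \<mu>) * r w)"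
  proof (rule expectation_mono_finite_pmf[OF fin], goal_cases)
    case (1 w)
    show ?case using pw(3)[OF w[OF 1]] by linarith
  qed
  have comp: "1 - a / (a + \<mu>) = \<mu> / (a + \<mu>)"
    using a \<mu> by (simp add: field_simps)
  show "a / (a + \<mu>) \<le> ?E (\<lambda>w. a / (a + w))"
    using 1 unfolding lin by simp
  have "a / (a + \<mu>) + a / (a + \<mu>) * V = (1 + V) * (a / (a + \<mu>))"
    by (simp only: distrib_right mult_1_left mult.commute)
  then show "?E (\<lambda>w. a / (a + w)) \<le> (1 + V) * (a / (a + \<mu>))"
    using 2 unfolding lin by linarith
  have "?E (\<lambda>w. 1 - a / (a + w)) = 1 - ?E (\<lambda>w. a / (a + w))"
    by (simp add: int)
  then show "(1 - V) * (\<mu> / (a + \<mu>)) \<le> ?E (\<lambda>w. 1 - a / (a + w))"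
    "?E (\<lambda>w. 1 - a / (a + w)) \<le> \<mu> / (a + \<mu>)"
    using 1 3 unfolding lin left_diff_distrib by (simp_all add: mult.commute[of V] flip: comp)
qed

text \<open>\<open>e\<close> is the probability of deciding for the heavy class, and
  \<open>e / SH\<close> is what one unit of inverse degree receives. Multiplied by SH + SL, the
  claim is about the ratio \<open>r\<close> of the share computed from the estimate \<open>a\<close>
  to the true share. It lies between 1 - M and 1 + 2 * M \<le> 2, so the factor 1 + V costs at most
  2 * V.\<close>

lemma share_heavy_error:
  fixes a SH SL M V e :: real
  assumes SH: "SH > 0" and SL: "SL \<ge> 0" and M: "0 \<le> M" "M \<le> 1 / 2"
    and a: "(1 - M) * SH \<le> a" "a \<le> (1 + 2 * M) * SH" and V: "V \<ge> 0"
    and e: "a / (a + SL) \<le> e" "e \<le> (1 + V) * (a / (a + SL))"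
  shows "\<bar>e / SH - 1 / (SH + SL)\<bar> \<le> (2 * M + 2 * V) / (SH + SL)"
proof -
  have "0 < (1 - M) * SH" using M SH by simp
  then have a0: "a > 0" using a(1) by linarith
  define r where "r = a / (a + SL) * ((SH + SL) / SH)"
  have p: "SH + SL > 0" "a + SL > 0" using SH SL a0 by auto
  have q: "SH * (a + SL) > 0" using p SH by simp
  have r_eq: "r = a * (SH + SL) / (SH * (a + SL))" by (simp add: r_def)
  have r1: "1 - M \<le> r"
  proof -
    have "(1 - M) * SH * SL \<le> a * SL"
      using a(1) SL by (rule mult_right_mono)
    moreover have "(1 - M) * (SH * a) \<le> 1 * (SH * a)"
      by (rule mult_right_mono) (use M SH a0 in simp_all)
    ultimately have "(1 - M) * (SH * (a + SL)) \<le> a * (SH + SL)"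
      by (simp add: distrib_left mult_ac)
    then show ?thesis unfolding r_eq pos_le_divide_eq[OF q] .
  qed
  have r2: "r \<le> 1 + 2 * M"
  proof -
    have "a * SL \<le> (1 + 2 * M) * SH * SL"
      using a(2) SL by (rule mult_right_mono)
    moreover have "1 * (SH * a) \<le> (1 + 2 * M) * (SH * a)"
      by (rule mult_right_mono) (use M SH a0 in simp_all)
    ultimately have "a * (SH + SL) \<le> (1 + 2 * M) * (SH * (a + SL))"
      by (simp add: distrib_left mult_ac)
    then show ?thesis unfolding r_eq pos_divide_le_eq[OF q] .
  qed
  have "r \<le> e * ((SH + SL) / SH)"
    unfolding r_def by (rule mult_right_mono[OF e(1)]) (use p SH in simp)
  moreover have "e * ((SH + SL) / SH) \<le> (1 + V) * r"
    unfolding r_def mult.assoc[symmetric] by (rule mult_right_mono[OF e(2)]) (use p SH in simp)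
  moreover have "(1 + V) * r \<le> 1 + 2 * M + 2 * V"
  proof -
    have "V * r \<le> V * 2" using r2 M V by (intro mult_left_mono) auto
    then show ?thesis using r2 unfolding distrib_right by linarith
  qed
  ultimately have "\<bar>e * ((SH + SL) / SH) - 1\<bar> \<le> 2 * M + 2 * V"
    using r1 M V unfolding abs_le_iff by linarith
  then have "\<bar>e * ((SH + SL) / SH) - 1\<bar> / (SH + SL) \<le> (2 * M + 2 * V) / (SH + SL)"
    using p by (intro divide_right_mono) auto
  moreover have "e / SH - 1 / (SH + SL) = (e * ((SH + SL) / SH) - 1) / (SH + SL)"
    using p SH by (simp add: diff_divide_distrib)
  ultimately show ?thesis using p by simp
qed

text \<open>The light share decreases in \<open>a\<close>, so the two bounds on \<open>a\<close>
  exchange their roles. The lower bound on \<open>r\<close> uses (1 - 2 * M) * (1 + 2 * M) \<le>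
  1.\<close>

lemma share_light_error:
  fixes a SH SL M V e :: real
  assumes SH: "SH \<ge> 0" and SL: "SL > 0" and M: "0 \<le> M" "M \<le> 1 / 2"
    and a: "(1 - M) * SH \<le> a" "a \<le> (1 + 2 * M) * SH" and V: "V \<ge> 0"
    and e: "(1 - V) * (SL / (a + SL)) \<le> e" "e \<le> SL / (a + SL)"
  shows "\<bar>e / SL - 1 / (SH + SL)\<bar> \<le> (2 * M + 2 * V) / (SH + SL)"
proof -
  have "0 \<le> (1 - M) * SH" using M SH by simp
  then have a0: "a \<ge> 0" using a(1) by linarith
  define r where "r = SL / (a + SL) * ((SH + SL) / SL)"
  have p: "SH + SL > 0" "a + SL > 0" using SH SL a0 by auto
  have r_eq: "r = (SH + SL) / (a + SL)" unfolding r_def using SL by simp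
  have r1: "1 - 2 * M \<le> r"
  proof -
    have "(1 - 2 * M) * a \<le> (1 - 2 * M) * ((1 + 2 * M) * SH)"
      using a M by (intro mult_left_mono) auto
    also have "\<dots> \<le> 1 * SH"
      unfolding mult.assoc[symmetric] using SH by (intro mult_right_mono) (auto simp: algebra_simps)
    finally have "(1 - 2 * M) * a \<le> SH" by simp
    moreover have "(1 - 2 * M) * SL \<le> SL" using M SL by (simp add: algebra_simps)
    ultimately show ?thesis unfolding r_eq pos_le_divide_eq[OF p(2)] by (simp add: distrib_left)
  qed
  have r2: "r \<le> 1 + 2 * M"
  proof -
    \<comment> \<open>(1 + 2 * M) * (1 - M) = 1 + M * (1 - 2 * M), which is at least 1 for M \<le> 1
      / 2.\<close>
    have "SH * 1 \<le> SH * ((1 + 2 * M) * (1 - M))"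
      using M SH by (intro mult_left_mono) (auto simp: algebra_simps intro: mult_left_le)
    also have "\<dots> = (1 + 2 * M) * ((1 - M) * SH)" by simp
    also have "\<dots> \<le> (1 + 2 * M) * a" using a M by (intro mult_left_mono) auto
    finally have "SH \<le> (1 + 2 * M) * a" by simp
    moreover have "SL \<le> (1 + 2 * M) * SL" using M SL by (simp add: algebra_simps)
    ultimately show ?thesis unfolding r_eq pos_divide_le_eq[OF p(2)] by (simp add: distrib_left)
  qed
  have "(1 - V) * r \<le> e * ((SH + SL) / SL)"
    unfolding r_def mult.assoc[symmetric] by (rule mult_right_mono[OF e(1)]) (use p SL in simp)
  moreover have "e * ((SH + SL) / SL) \<le> r"
    unfolding r_def by (rule mult_right_mono[OF e(2)]) (use p SL in simp)
  moreover have "1 - 2 * M - 2 * V \<le> (1 - V) * r"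
  proof -
    have "V * r \<le> V * 2" using r2 M V by (intro mult_left_mono) auto
    then show ?thesis using r1 unfolding left_diff_distrib by linarith
  qed
  ultimately have "\<bar>e * ((SH + SL) / SL) - 1\<bar> \<le> 2 * M + 2 * V"
    using r2 M V unfolding abs_le_iff by linarith
  then have "\<bar>e * ((SH + SL) / SL) - 1\<bar> / (SH + SL) \<le> (2 * M + 2 * V) / (SH + SL)"
    using p by (intro divide_right_mono) auto
  moreover have "e / SL - 1 / (SH + SL) = (e * ((SH + SL) / SL) - 1) / (SH + SL)"
    using p SL by (simp add: diff_divide_distrib)
  ultimately show ?thesis using p by simp
qed

section \<open>Concentration\<close>

text \<open>Length at least 2 makes ln n positive and all arrays non-empty. The shorter streams are
  degenerate and treated at the end.\<close>

locale similarity_stream =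
  fixes f :: "'a \<Rightarrow> 'a \<Rightarrow> real" and \<sigma> :: "'a list" and \<epsilon> :: real
  assumes similarity: "similarity f" and eps: "0 < \<epsilon>" "\<epsilon> < 1" and len: "length \<sigma> \<ge> 2"
begin

definition n :: nat where "n = length \<sigma>"
definition l :: real where "l = ln (real n)"
definition xs :: "'a node list" where "xs = List.enumerate 1 \<sigma>"
definition A :: "'a node set" where "A = set xs"
definition d :: "'a node \<Rightarrow> real" where "d x = (\<Sum>y\<in>A. f (snd x) (snd y))"

lemma f01: "0 \<le> f x y" "f x y \<le> 1" "f x x = 1" "f x y = f y x"
  using similarity by (auto simp: similarity_def)

lemma n2: "n \<ge> 2" "real n \<ge> 2" "sqrt (real n) > 0" "sqrt (real n) \<le> real n" "sqrt (real n) \<ge> 1"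
proof -
  show "n \<ge> 2" using len by (simp add: n_def)
  then show *: "real n \<ge> 2" "sqrt (real n) > 0" "sqrt (real n) \<ge> 1" by auto
  have "sqrt (real n) * 1 \<le> sqrt (real n) * sqrt (real n)" using * by (intro mult_left_mono) auto
  then show "sqrt (real n) \<le> real n" by simp
qed

lemma l_ge: "l \<ge> 2 / 3"
proof -
  have "2 / 3 \<le> ln (2::real)" using ln2_ge_two_thirds by simp
  also have "\<dots> \<le> l" using n2 by (simp add: l_def)
  finally show ?thesis .
qed

lemma exp_l: "exp (real k * l) = real n ^ k"
  using n2 by (simp add: l_def exp_of_nat_mult)

lemma l_over_eps: "l \<le> l / \<epsilon>" "l / \<epsilon> \<le> l / \<epsilon>\<^sup>2" "l \<le> l / \<epsilon>\<^sup>2" "2 / 3 \<le> l / \<epsilon>\<^sup>2"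
proof -
  show 1: "l \<le> l / \<epsilon>" using l_ge eps by (simp add: field_simps)
  have "l / \<epsilon> * 1 \<le> l / \<epsilon> * (1 / \<epsilon>)" using l_ge eps by (intro mult_left_mono) auto
  then show 2: "l / \<epsilon> \<le> l / \<epsilon>\<^sup>2" by (simp add: power2_eq_square)
  show "l \<le> l / \<epsilon>\<^sup>2" "2 / 3 \<le> l / \<epsilon>\<^sup>2" using 1 2 l_ge by linarith+
qed

text \<open>Of the k + 1 copies of l / \<epsilon>^2, \<open>k\<close> pay for the power of n. The
  last one pays for the factor \<epsilon>, since exp (l / \<epsilon>^2) \<ge> l / \<epsilon> \<ge> 2
  / (3 * \<epsilon>).\<close>

lemma exp_small:
  assumes "real (Suc k) * (l / \<epsilon>\<^sup>2) \<le> c"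
  shows "exp (- c) \<le> 3 / 2 * \<epsilon> / real n ^ k"
proof -
  have "real k * l \<le> real k * (l / \<epsilon>\<^sup>2)" using l_over_eps by (intro mult_left_mono) auto
  then have "real k * l + l / \<epsilon>\<^sup>2 \<le> c"
    using assms unfolding of_nat_Suc distrib_right mult_1_left by linarith
  then have "exp (- c) \<le> exp (- (real k * l)) * exp (- (l / \<epsilon>\<^sup>2))"
    by (simp flip: exp_add)
  also have "exp (- (real k * l)) = 1 / real n ^ k" by (simp add: exp_minus exp_l field_simps)
  also have "exp (- (l / \<epsilon>\<^sup>2)) \<le> 3 / 2 * \<epsilon>"
  proof -
    have "1 / (3 / 2 * \<epsilon>) = 2 / 3 / \<epsilon>" by simp
    also have "\<dots> \<le> l / \<epsilon>" using l_ge eps by (intro divide_right_mono) auto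
    also have "\<dots> \<le> exp (l / \<epsilon>\<^sup>2)"
      using l_over_eps(2) exp_ge_add_one_self[of "l / \<epsilon>\<^sup>2"] by linarith
    finally show ?thesis using eps by (simp add: exp_minus field_simps)
  qed
  finally show ?thesis using n2 by (simp add: field_simps)
qed

text \<open>The square of \<epsilon> / 4 contributes a factor 16. An upper bound is stated for
  \<open>size_t1\<close> alone: it keeps the scores of low-degree nodes below the threshold.\<close>

lemma size_bounds:
  "12 * sqrt (real n) * l \<le> real (size_t n)"
  "768 * sqrt (real n) * (l / \<epsilon>\<^sup>2) \<le> real (size_t1 n \<epsilon>)"
  "real (size_t1 n \<epsilon>) \<le> 768 * sqrt (real n) * (l / \<epsilon>\<^sup>2) + 1"
  "576 * sqrt (real n) * (l / \<epsilon>\<^sup>2) \<le> real (size_t2 n \<epsilon>)"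
  "threshold n \<epsilon> = 1536 * (l / \<epsilon>\<^sup>2)"
proof -
  have u: "sqrt (real n) * l \<ge> 0" "sqrt (real n) * (l / \<epsilon>\<^sup>2) \<ge> 0" using n2 l_ge by auto
  have eq: "48 * sqrt (real n) * ln (real n) / (\<epsilon> / 4)\<^sup>2 = 768 * sqrt (real n) * (l / \<epsilon>\<^sup>2)"
    "36 * sqrt (real n) * ln (real n) / (\<epsilon> / 4)\<^sup>2 = 576 * sqrt (real n) * (l / \<epsilon>\<^sup>2)"
    "96 * ln (real n) / (\<epsilon> / 4)\<^sup>2 = 1536 * (l / \<epsilon>\<^sup>2)"
    by (simp_all add: l_def power_divide)
  show "12 * sqrt (real n) * l \<le> real (size_t n)"
    unfolding size_t_def l_def[symmetric] using u by linarith
  show "768 * sqrt (real n) * (l / \<epsilon>\<^sup>2) \<le> real (size_t1 n \<epsilon>)"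
    "real (size_t1 n \<epsilon>) \<le> 768 * sqrt (real n) * (l / \<epsilon>\<^sup>2) + 1"
    "576 * sqrt (real n) * (l / \<epsilon>\<^sup>2) \<le> real (size_t2 n \<epsilon>)"
    unfolding size_t1_def size_t2_def eq using u by linarith+
  show "threshold n \<epsilon> = 1536 * (l / \<epsilon>\<^sup>2)"
    unfolding threshold_def eq ..
qed

lemma size_pos: "real (size_t n) > 0" "real (size_t1 n \<epsilon>) > 0" "real (size_t2 n \<epsilon>) > 0"
proof -
  have "sqrt (real n) * (l / \<epsilon>\<^sup>2) > 0" "sqrt (real n) * l > 0" using n2 l_ge eps by auto
  then show "real (size_t n) > 0" "real (size_t1 n \<epsilon>) > 0" "real (size_t2 n \<epsilon>) > 0"
    using size_bounds by linarith+
qed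

lemma A_image: "A = (\<lambda>i. (i, item \<sigma> i)) ` {1..n}"
proof -
  have "(i, x) \<in> A \<longleftrightarrow> i \<in> {1..n} \<and> x = item \<sigma> i" for i x
    by (auto simp: A_def xs_def n_def item_def in_set_enumerate_eq)
  then show ?thesis by auto
qed

lemma distinct_xs: "distinct xs"
  by (simp add: xs_def)

lemma finite_A: "finite A" and card_A: "card A = n" and A_ne: "A \<noteq> {}"
proof -
  show "finite A" by (simp add: A_def)
  show "card A = n" using distinct_xs by (simp add: A_def distinct_card xs_def n_def)
  then show "A \<noteq> {}" using n2 by auto
qed

lemma node_degree_eq: "node_degree f xs (Some x) = d x"
  unfolding node_degree_def d_def A_def
  using distinct_xs by (simp add: sum_list_distinct_conv_sum_set)

lemma d_bounds: "x \<in> A \<Longrightarrow> 1 \<le> d x" "d x \<le> real n"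
proof -
  show "1 \<le> d x" if "x \<in> A"
  proof -
    have "f (snd x) (snd x) \<le> d x"
      unfolding d_def using that finite_A f01 by (intro member_le_sum) auto
    then show ?thesis by (simp add: f01)
  qed
  have "d x \<le> (\<Sum>y\<in>A. 1)" unfolding d_def by (intro sum_mono f01)
  then show "d x \<le> real n" by (simp add: card_A)
qed

lemma degree_eq: "degree f \<sigma> i = d (i, item \<sigma> i)"
  unfolding degree_def d_def A_image weight_def
  by (subst sum.reindex) (auto simp: inj_on_def n_def)

lemma diversity_index_eq: "diversity_index f \<sigma> = (\<Sum>x\<in>A. 1 / d x)"
  unfolding diversity_index_def A_image
  by (subst sum.reindex) (auto simp: inj_on_def n_def degree_eq inverse_eq_divide)


section \<open>The relative error of the light weight\<close>

lemma inverse_degree_bounds: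
  assumes "B \<subseteq> A" "\<And>x. x \<in> B \<Longrightarrow> d x \<le> 4 * sqrt (real n)" "B \<noteq> {}" "c \<in> set_pmf (uniform_item B)"
  shows "1 / (4 * sqrt (real n)) \<le> 1 / node_degree f xs c" "0 \<le> 1 / node_degree f xs c"
    "1 / node_degree f xs c \<le> 1"
proof -
  obtain x where x: "x \<in> B" "c = Some x"
    using assms finite_subset[OF assms(1) finite_A] by (auto simp: set_uniform_item)
  have "1 \<le> d x" using d_bounds x assms by blast
  then show "1 / (4 * sqrt (real n)) \<le> 1 / node_degree f xs c" "0 \<le> 1 / node_degree f xs c"
    "1 / node_degree f xs c \<le> 1"
    unfolding x(2) node_degree_eq using assms(2)[OF x(1)] n2(3) by (auto intro!: divide_left_mono mult_pos_pos)
qed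

text \<open>In terms of u = w / \<mu> the quantity is (u - 1)^2 / u. For u \<ge> 1 / 2 it is at most
  \<open>\<bar>u - 1\<bar>\<close>, whose mean is bounded by \<epsilon> / 6. For u < 1 / 2 it may
  reach 4 * sqrt n, but this is so unlikely that it costs at most \<epsilon> / 20. The sum is 13/60
  \<epsilon>.\<close>

lemma light_weight_deviation:
  assumes B: "B \<subseteq> A" "B \<noteq> {}" and dB: "\<And>x. x \<in> B \<Longrightarrow> d x \<le> 4 * sqrt (real n)"
  defines "\<mu> \<equiv> \<Sum>x\<in>B. 1 / d x"
  defines "pw \<equiv> map_pmf (light_weight n \<epsilon> f xs (card B)) (replicate_pmf (size_t2 n \<epsilon>) (uniform_item B))"
  shows "\<mu> > 0" "finite (set_pmf pw)" "w \<in> set_pmf pw \<Longrightarrow> w > 0"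
    "measure_pmf.expectation pw (\<lambda>w. w) = \<mu>"
    "measure_pmf.expectation pw (\<lambda>w. (w - \<mu>)\<^sup>2 / (w * \<mu>)) \<le> 13 / 60 * \<epsilon>"
proof -
  let ?Z = "\<lambda>c. 1 / node_degree f xs c"
  let ?t = "size_t2 n \<epsilon>"
  let ?P = "replicate_pmf ?t (uniform_item B)"
  let ?E = "measure_pmf.expectation ?P"
  have finB: "finite B" using B finite_A finite_subset by blast
  have card: "real (card B) > 0" using B finB by (simp add: card_gt_0_iff)
  have finu: "finite (set_pmf (uniform_item B))" by (rule finite_set_uniform_item[OF finB])
  have finP: "finite (set_pmf ?P)" by (rule finite_set_replicate_pmf[OF finu])
  note Z = inverse_degree_bounds[OF B(1) dB B(2)]
  have t: "real ?t > 0" by (rule size_pos)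
  have EZ: "measure_pmf.expectation (uniform_item B) ?Z = \<mu> / real (card B)"
    by (simp add: expectation_uniform_item[OF finB B(2)] node_degree_eq \<mu>_def)
  define m where "m = real ?t * measure_pmf.expectation (uniform_item B) ?Z"
  have "measure_pmf.expectation (uniform_item B) (\<lambda>_. 1 / (4 * sqrt (real n))) \<le>
      measure_pmf.expectation (uniform_item B) ?Z"
    by (rule expectation_mono_finite_pmf[OF finu]) (rule Z(1))
  then have EZ_lower: "1 / (4 * sqrt (real n)) \<le> measure_pmf.expectation (uniform_item B) ?Z"
    by simp
  have "measure_pmf.expectation (uniform_item B) ?Z \<le> measure_pmf.expectation (uniform_item B) (\<lambda>_. 1)"
    by (rule expectation_mono_finite_pmf[OF finu]) (rule Z(3))
  then have EZ_upper: "measure_pmf.expectation (uniform_item B) ?Z \<le> 1" by simp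
  have "0 < 1 / (4 * sqrt (real n))" using n2 by simp
  then have "0 < measure_pmf.expectation (uniform_item B) ?Z" using EZ_lower by linarith
  then show mu: "\<mu> > 0" unfolding EZ using card by (simp add: zero_less_divide_iff)
  have m_lower: "144 * (l / \<epsilon>\<^sup>2) \<le> m"
  proof -
    have "144 * (l / \<epsilon>\<^sup>2) = 576 * sqrt (real n) * (l / \<epsilon>\<^sup>2) * (1 / (4 * sqrt (real n)))"
      using n2 by simp
    also have "\<dots> \<le> real ?t * (1 / (4 * sqrt (real n)))"
      by (rule mult_right_mono[OF size_bounds(4)]) simp
    also have "\<dots> \<le> m"
      unfolding m_def by (rule mult_left_mono[OF EZ_lower]) simp
    finally show ?thesis .
  qed
  have m0: "m > 0" using m_lower l_over_eps by linarith
  have m_upper: "m \<le> real ?t"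
    unfolding m_def using EZ_upper by (simp add: mult_left_le)
  define u where "u = (\<lambda>zs. sum_list (map ?Z zs) / m)"
  have cardpos: "card B > 0" using card by simp
  have weight: "light_weight n \<epsilon> f xs (card B) zs = u zs * \<mu>" for zs
    using mu t card m0 cardpos unfolding light_weight_def u_def m_def EZ by simp
  \<comment> \<open>A bound that holds surely: each summand is at least 1 / (4 * sqrt n), and the
    mean \<open>m\<close> of the sum is at most the number of summands. It controls 1 / u on the
    rare event that u is small.\<close>
  have u_lower: "1 / (4 * sqrt (real n)) \<le> u zs" if "zs \<in> set_pmf ?P" for zs
  proof -
    have zs: "length zs = ?t" "\<And>c. c \<in> set zs \<Longrightarrow> c \<in> set_pmf (uniform_item B)"
      using that by (auto simp: set_replicate_pmf)
    have "real ?t * (1 / (4 * sqrt (real n))) = (\<Sum>c\<leftarrow>zs. 1 / (4 * sqrt (real n)))"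
      by (simp add: sum_list_triv zs(1))
    also have "\<dots> \<le> sum_list (map ?Z zs)"
      by (intro sum_list_mono Z(1) zs)
    finally have "m * (1 / (4 * sqrt (real n))) \<le> sum_list (map ?Z zs)"
      using mult_right_mono[OF m_upper, of "1 / (4 * sqrt (real n))"] n2 by simp
    then show ?thesis unfolding u_def using m0 by (simp add: pos_le_divide_eq mult.commute)
  qed
  have u_pos: "u zs > 0" if "zs \<in> set_pmf ?P" for zs
    using u_lower[OF that] \<open>0 < 1 / (4 * sqrt (real n))\<close> by linarith
  have Eu: "?E u = 1"
    unfolding u_def using m0 by (simp add: expectation_replicate_pmf_sum_list[OF finu] flip: m_def)
  show "finite (set_pmf pw)" using finP by (simp add: pw_def)
  show "w > 0" if "w \<in> set_pmf pw"
    using that u_pos mu by (auto simp: pw_def weight)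
  show "measure_pmf.expectation pw (\<lambda>w. w) = \<mu>"
    by (simp add: pw_def weight Eu)
  \<comment> \<open>Since 12^2 = 144 is the constant in the lower bound on \<open>m\<close>, the
    moment exponent k^2 / m is at most \<open>l\<close>. Then ln b \<le> 2 * l, and 2 * l / k =
    \<epsilon> / 6.\<close>
  define k where "k = 12 * (l / \<epsilon>)"
  define b where "b = 2 * exp (k\<^sup>2 / m)"
  have k0: "k > 0" using l_ge eps by (simp add: k_def)
  have b0: "b > 0" by (simp add: b_def)
  have km: "k \<le> m" unfolding k_def using m_lower l_over_eps l_ge by linarith
  have ksq: "k\<^sup>2 / m \<le> l"
  proof -
    have "k\<^sup>2 = l * (144 * (l / \<epsilon>\<^sup>2))" by (simp add: k_def power2_eq_square)
    also have "\<dots> \<le> l * m" using m_lower l_ge by (intro mult_left_mono) auto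
    finally show ?thesis using m0 by (simp add: pos_divide_le_eq)
  qed
  have lnb: "ln b \<le> 2 * l"
  proof -
    have "ln b = ln 2 + k\<^sup>2 / m" by (simp add: b_def ln_mult)
    moreover have "ln 2 \<le> l" using n2 by (simp add: l_def)
    ultimately show ?thesis using ksq by linarith
  qed
  have mgf: "?E (\<lambda>zs. exp (c * (u zs - 1))) \<le> exp (c\<^sup>2 / m)" if "\<bar>c\<bar> \<le> m" for c
    unfolding u_def
    by (rule expectation_exp_relative_le[OF finu _ _ m0 that]) (use Z in \<open>auto simp: m_def\<close>)
  \<comment> \<open>The last term is the price for u < 1 / 2: its exponentials multiply to exp (m /
    4 * (1 / 2 - u)), which exceeds 1 exactly there, and the factor 4 * sqrt n dominates 1 /
    u.\<close>
  have pointwise: "(w - \<mu>)\<^sup>2 / (w * \<mu>) \<le>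
      (ln b - 1 + (exp (k * (u zs - 1)) + exp (- k * (u zs - 1))) / b) / k +
      4 * sqrt (real n) * exp (- (m / 8)) * exp (- (m / 4) * (u zs - 1))"
    if "zs \<in> set_pmf ?P" "w = u zs * \<mu>" for zs w
  proof -
    define v where "v = u zs"
    have v: "v > 0" "1 / (4 * sqrt (real n)) \<le> v" using u_pos u_lower that by (auto simp: v_def)
    have "(w - \<mu>)\<^sup>2 / (w * \<mu>) = (v - 1)\<^sup>2 / v"
    proof -
      have "(w - \<mu>)\<^sup>2 = (v - 1)\<^sup>2 * \<mu>\<^sup>2"
        unfolding that(2) v_def[symmetric] by (simp add: power2_eq_square algebra_simps)
      moreover have "w * \<mu> = v * \<mu>\<^sup>2" unfolding that(2) v_def by (simp add: power2_eq_square)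
      ultimately show ?thesis using mu by simp
    qed
    also have "\<dots> \<le> \<bar>v - 1\<bar> + 4 * sqrt (real n) * exp (- (m / 8)) * exp (- (m / 4) * (v - 1))"
    proof (cases "v \<ge> 1 / 2")
      case True
      have "(v - 1)\<^sup>2 = \<bar>v - 1\<bar> * \<bar>v - 1\<bar>" by (simp add: power2_eq_square)
      also have "\<dots> \<le> \<bar>v - 1\<bar> * v" using True by (intro mult_left_mono) auto
      finally have "(v - 1)\<^sup>2 / v \<le> \<bar>v - 1\<bar>" using v by (simp add: pos_divide_le_eq)
      moreover have "0 \<le> 4 * sqrt (real n) * exp (- (m / 8)) * exp (- (m / 4) * (v - 1))" by simp
      ultimately show ?thesis by linarith
    next
      case False
      have "(v - 1)\<^sup>2 \<le> 1\<^sup>2" using False v by (intro power2_le_iff_abs_le[THEN iffD2]) auto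
      then have "(v - 1)\<^sup>2 / v \<le> 1 / v" using v by (simp add: divide_right_mono)
      also have "1 / v \<le> 4 * sqrt (real n)"
        using v n2 by (simp add: field_simps)
      also have "\<dots> = 4 * sqrt (real n) * 1" by simp
      also have "\<dots> \<le> 4 * sqrt (real n) * (exp (- (m / 8)) * exp (- (m / 4) * (v - 1)))"
      proof (rule mult_left_mono)
        have "0 \<le> (m / 4) * (1 / 2 - v)" using m0 False by simp
        also have "\<dots> = - (m / 8) + - (m / 4) * (v - 1)" by (simp add: field_simps)
        finally show "1 \<le> exp (- (m / 8)) * exp (- (m / 4) * (v - 1))"
          by (simp flip: exp_add)
      qed simp
      finally show ?thesis by (simp add: mult.assoc)
    qed
    also have "\<bar>v - 1\<bar> \<le> (ln b - 1 + (exp (k * (v - 1)) + exp (- k * (v - 1))) / b) / k"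
      by (rule abs_le_cosh_bound[OF k0 b0])
    finally show ?thesis by (simp add: v_def)
  qed
  let ?g1 = "\<lambda>zs. exp (k * (u zs - 1))" and ?g2 = "\<lambda>zs. exp (- k * (u zs - 1))"
    and ?g3 = "\<lambda>zs. exp (- (m / 4) * (u zs - 1))"
  have "measure_pmf.expectation pw (\<lambda>w. (w - \<mu>)\<^sup>2 / (w * \<mu>)) =
      ?E (\<lambda>zs. (u zs * \<mu> - \<mu>)\<^sup>2 / (u zs * \<mu> * \<mu>))"
    by (simp add: pw_def weight)
  also have "\<dots> \<le> ?E (\<lambda>zs. (ln b - 1 + (?g1 zs + ?g2 zs) / b) / k +
      4 * sqrt (real n) * exp (- (m / 8)) * ?g3 zs)"
    by (rule expectation_mono_finite_pmf[OF finP]) (rule pointwise, auto)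
  also have "\<dots> = (ln b - 1 + (?E ?g1 + ?E ?g2) / b) / k + 4 * sqrt (real n) * exp (- (m / 8)) * ?E ?g3"
    by (simp add: integrable_measure_pmf_finite[OF finP] Bochner_Integration.integral_add add_divide_distrib
        diff_divide_distrib del: mult_minus_left)
  finally have main: "measure_pmf.expectation pw (\<lambda>w. (w - \<mu>)\<^sup>2 / (w * \<mu>)) \<le>
      (ln b - 1 + (?E ?g1 + ?E ?g2) / b) / k + 4 * sqrt (real n) * exp (- (m / 8)) * ?E ?g3" .
  have "(?E ?g1 + ?E ?g2) / b \<le> 1"
    using mgf[of k] mgf[of "- k"] km k0 b0 by (simp add: b_def)
  then have "(ln b - 1 + (?E ?g1 + ?E ?g2) / b) / k \<le> 2 * l / k"
    using lnb k0 by (intro divide_right_mono) auto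
  also have "2 * l / k = \<epsilon> / 6"
    using l_ge eps by (simp add: k_def)
  finally have part1: "(ln b - 1 + (?E ?g1 + ?E ?g2) / b) / k \<le> \<epsilon> / 6" .
  have "4 * sqrt (real n) * exp (- (m / 8)) * ?E ?g3 \<le> 4 * sqrt (real n) * exp (- (m / 8)) * exp (m / 16)"
  proof (rule mult_left_mono)
    have eq: "(- (m / 4))\<^sup>2 / m = m / 16" using m0 by (simp add: power2_eq_square)
    have "\<bar>- (m / 4)\<bar> \<le> m" using m0 by simp
    then show "?E ?g3 \<le> exp (m / 16)" using mgf[of "- (m / 4)"] unfolding eq by blast
  qed simp
  also have "\<dots> = 4 * sqrt (real n) * exp (- (m / 16))"
    by (simp add: mult.assoc flip: exp_add)
  \<comment> \<open>m / 16 is at least 9 * (l / \<epsilon>^2), because 144 / 16 = 9; this gives the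
    exponent 8.\<close>
  also have "\<dots> \<le> 4 * real n * (3 / 2 * \<epsilon> / real n ^ 8)"
    by (intro mult_mono exp_small) (use n2 m_lower in auto)
  also have "\<dots> = 6 * \<epsilon> / real n ^ 7"
    using n2 by (simp add: eval_nat_numeral)
  also have "\<dots> \<le> 6 * \<epsilon> / 2 ^ 7"
    using n2 eps by (intro divide_left_mono power_mono) auto
  also have "\<dots> \<le> \<epsilon> / 20"
    using eps by simp
  finally show "measure_pmf.expectation pw (\<lambda>w. (w - \<mu>)\<^sup>2 / (w * \<mu>)) \<le> 13 / 60 * \<epsilon>"
    using main part1 by linarith
qed


section \<open>Degree estimates from the first sample\<close>

definition samples :: "'a node option list pmf" where
  "samples = replicate_pmf (size_t1 n \<epsilon>) (uniform_item A)"

text \<open>Fixed by the stream, in contrast to the heavy class, which depends on \<open>S1\<close>.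
  Sums over this set can therefore be exchanged with expectations.\<close>

definition high :: "'a node set" where
  "high = {x \<in> A. sqrt (real n) \<le> d x}"

definition mean_score :: "'a node \<Rightarrow> real" where
  "mean_score x = real (size_t1 n \<epsilon>) * d x / real n"

text \<open>The relative error of the degree estimate: the scaled score of the second pass is the
  degree times 1 + \<open>dev s x\<close>.\<close>

definition dev :: "'a node option list \<Rightarrow> 'a node \<Rightarrow> real" where
  "dev s x = score f s x / mean_score x - 1"

definition good :: "'a node option list \<Rightarrow> bool" where
  "good s \<longleftrightarrow> (\<forall>x\<in>high. \<bar>dev s x\<bar> < 1 / 2) \<and> (\<forall>x\<in>A - high. score f s x < threshold n \<epsilon>)"

lemma finite_samples: "finite (set_pmf samples)"
  unfolding samples_def by (intro finite_set_replicate_pmf finite_set_uniform_item finite_A)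

lemma sim_item_bounds: "0 \<le> sim f c x" "sim f c x \<le> 1"
  using f01 by (cases c; simp)+

lemma expectation_sim: "measure_pmf.expectation (uniform_item A) (\<lambda>c. sim f c x) = d x / real n"
  by (simp add: expectation_uniform_item finite_A A_ne card_A d_def f01(4)[of _ "snd x"])

lemma mean_score_eq:
  "mean_score x = real (size_t1 n \<epsilon>) * measure_pmf.expectation (uniform_item A) (\<lambda>c. sim f c x)"
  by (simp add: mean_score_def expectation_sim)

lemma sqrt_frac: "sqrt (real n) * (sqrt (real n) / real n) = 1"
  using n2 by simp

lemma mean_score_high:
  assumes "x \<in> high"
  shows "768 * (l / \<epsilon>\<^sup>2) \<le> mean_score x" "mean_score x > 0"
proof -
  have "768 * (l / \<epsilon>\<^sup>2) = 768 * sqrt (real n) * (l / \<epsilon>\<^sup>2) * (sqrt (real n) / real n)"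
    using arg_cong[OF sqrt_frac, of "\<lambda>z. 768 * (l / \<epsilon>\<^sup>2) * z"] by (simp only: mult_ac mult_1_right)
  also have "\<dots> \<le> real (size_t1 n \<epsilon>) * (sqrt (real n) / real n)"
    by (rule mult_right_mono[OF size_bounds(2)]) simp
  also have "\<dots> \<le> real (size_t1 n \<epsilon>) * (d x / real n)"
    using assms by (intro mult_left_mono divide_right_mono) (auto simp: high_def)
  finally show "768 * (l / \<epsilon>\<^sup>2) \<le> mean_score x" by (simp add: mean_score_def)
  then show "mean_score x > 0" using l_over_eps by linarith
qed

lemma expectation_exp_dev:
  assumes "x \<in> high" "\<bar>k\<bar> \<le> mean_score x"
  shows "measure_pmf.expectation samples (\<lambda>s. exp (k * dev s x)) \<le> exp (k\<^sup>2 / mean_score x)"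
  unfolding samples_def dev_def score_def
  by (rule expectation_exp_relative_le[OF _ _ mean_score_eq mean_score_high(2)[OF assms(1)] assms(2)])
     (simp_all add: sim_item_bounds finite_set_uniform_item finite_A)

text \<open>An upper bound on all relative deviations at once that has a small expectation. A union bound
  at deviation \<open>\<epsilon> / 4\<close> would not suffice: its failure probability does not shrink with \<open>\<epsilon>\<close>, whereas
  the target probabilities must be met up to the factor \<open>1 \<plusminus> \<epsilon>\<close> for every \<open>n\<close>.\<close>

definition dev_bound :: "'a node option list \<Rightarrow> real" where
  "dev_bound s =
     (let k = 32 * (l / \<epsilon>); b = 2 * real n * exp (4 / 3 * l)
      in (ln b - 1 + (\<Sum>x\<in>high. exp (k * dev s x) + exp (- k * dev s x)) / b) / k)"

lemma finite_high: "finite high" and card_high: "card high \<le> n"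
  using finite_A card_A card_mono[of A high] by (auto simp: high_def)

text \<open>The mean score is at least 768 * (l / \<epsilon>^2) and 32^2 / 768 = 4 / 3, so each
  exponential has mean at most exp (4 / 3 * l). Two signs and at most n nodes make \<open>b\<close>
  a bound on the whole sum, which leaves ln b / k. Finally ln b \<le> ln 2 + 7 / 3 * l \<le> 10 / 3
  * l, and 10 / 3 divided by 32 is 5 / 48.\<close>

lemma dev_bound_nonneg: "dev_bound s \<ge> 0"
  and abs_dev_le_dev_bound: "x \<in> high \<Longrightarrow> \<bar>dev s x\<bar> \<le> dev_bound s"
  and expectation_dev_bound: "measure_pmf.expectation samples dev_bound \<le> 5 / 48 * \<epsilon>"
proof -
  define k where "k = 32 * (l / \<epsilon>)"
  define b where "b = 2 * real n * exp (4 / 3 * l)"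
  let ?g = "\<lambda>s x. exp (k * dev s x) + exp (- k * dev s x)"
  have k: "k > 0" using l_ge eps by (simp add: k_def)
  have b: "b > 0" using n2 by (simp add: b_def)
  have D: "dev_bound s = (ln b - 1 + (\<Sum>x\<in>high. ?g s x) / b) / k" for s
    by (simp add: dev_bound_def Let_def k_def b_def)
  have lnb: "ln b = ln 2 + l + 4 / 3 * l"
    using n2 by (simp add: b_def ln_mult l_def)
  have "ln b \<ge> 1" using lnb l_ge ln2_ge_two_thirds by linarith
  moreover have "0 \<le> (\<Sum>x\<in>high. ?g s x) / b" using b by (intro divide_nonneg_pos sum_nonneg) auto
  ultimately show "dev_bound s \<ge> 0" unfolding D using k by (intro divide_nonneg_pos) auto
  show "\<bar>dev s x\<bar> \<le> dev_bound s" if "x \<in> high"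
  proof -
    have "\<bar>dev s x\<bar> \<le> (ln b - 1 + ?g s x / b) / k"
      by (rule abs_le_cosh_bound[OF k b])
    also have "\<dots> \<le> dev_bound s"
      unfolding D using that k b finite_high
      by (intro divide_right_mono add_left_mono member_le_sum[of x high "?g s"]) auto
    finally show ?thesis .
  qed
  have E1: "measure_pmf.expectation samples (\<lambda>s. exp (c * dev s x)) \<le> exp (4 / 3 * l)"
    if "x \<in> high" "c = k \<or> c = - k" for x c
  proof -
    have "\<bar>c\<bar> \<le> mean_score x"
      using that k mean_score_high[OF that(1)] l_over_eps l_ge by (auto simp: k_def)
    moreover have "c\<^sup>2 / mean_score x \<le> 4 / 3 * l"
    proof -
      have "c\<^sup>2 = 4 / 3 * l * (768 * (l / \<epsilon>\<^sup>2))"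
        using that by (auto simp: k_def power2_eq_square)
      also have "\<dots> \<le> 4 / 3 * l * mean_score x"
        using mean_score_high[OF that(1)] l_ge by (intro mult_left_mono) auto
      finally show ?thesis using mean_score_high[OF that(1)] by (simp add: pos_divide_le_eq)
    qed
    ultimately show ?thesis
      using expectation_exp_dev[OF that(1)] by (meson exp_le_cancel_iff order_trans)
  qed
  have "measure_pmf.expectation samples dev_bound =
      (ln b - 1 + (\<Sum>x\<in>high. measure_pmf.expectation samples (\<lambda>s. exp (k * dev s x)) +
        measure_pmf.expectation samples (\<lambda>s. exp (- k * dev s x))) / b) / k"
    by (simp add: D[abs_def] integrable_measure_pmf_finite[OF finite_samples] Bochner_Integration.integral_add
        Bochner_Integration.integral_sum del: mult_minus_left)
  also have "\<dots> \<le> (ln b - 1 + 1) / k"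
  proof (intro divide_right_mono add_left_mono)
    have "(\<Sum>x\<in>high. measure_pmf.expectation samples (\<lambda>s. exp (k * dev s x)) +
        measure_pmf.expectation samples (\<lambda>s. exp (- k * dev s x))) \<le> (\<Sum>x\<in>high. 2 * exp (4 / 3 * l))"
    proof (rule sum_mono)
      fix x assume x: "x \<in> high"
      show "measure_pmf.expectation samples (\<lambda>s. exp (k * dev s x)) +
          measure_pmf.expectation samples (\<lambda>s. exp (- k * dev s x)) \<le> 2 * exp (4 / 3 * l)"
        using E1[OF x disjI1[OF refl]] E1[OF x disjI2[OF refl]] by linarith
    qed
    also have "\<dots> \<le> real n * (2 * exp (4 / 3 * l))"
      using card_high by (simp add: mult_right_mono)
    also have "\<dots> = b" by (simp add: b_def)
    finally show "(\<Sum>x\<in>high. measure_pmf.expectation samples (\<lambda>s. exp (k * dev s x)) +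
        measure_pmf.expectation samples (\<lambda>s. exp (- k * dev s x))) / b \<le> 1"
      using b by simp
  qed (use k in simp)
  also have "\<dots> \<le> (10 / 3 * l) / k"
  proof (intro divide_right_mono)
    have "ln 2 \<le> l" using n2 by (simp add: l_def)
    then show "ln b - 1 + 1 \<le> 10 / 3 * l" using lnb by linarith
  qed (use k in simp)
  also have "\<dots> = 5 / 48 * \<epsilon>"
    using l_ge eps by (simp add: k_def)
  finally show "measure_pmf.expectation samples dev_bound \<le> 5 / 48 * \<epsilon>" .
qed

text \<open>A union bound with Markov's inequality built in: a node violating goodness makes its own
  summand \<open>?g\<close> at least 1. For high nodes the moment exp (mean / 16) against the
  penalty exp (- mean / 8) leaves exp (- mean / 16), and 768 / 16 = 48 is the constant in
  \<open>c\<close>.\<close>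

lemma expectation_not_good:
  "measure_pmf.expectation samples (\<lambda>s. of_bool (\<not> good s)) \<le> \<epsilon> / (100 * real n ^ 2)"
proof -
  define c where "c = 48 * (l / \<epsilon>\<^sup>2)"
  let ?E = "measure_pmf.expectation samples"
  note int = integrable_measure_pmf_finite[OF finite_samples]
  let ?g = "\<lambda>s x. if x \<in> high then exp (- (mean_score x / 8)) * exp (mean_score x / 4 * dev s x) +
      exp (- (mean_score x / 8)) * exp (- (mean_score x / 4) * dev s x)
    else exp (- (threshold n \<epsilon> / 4)) * exp (1 / 4 * score f s x)"
  have pointwise: "of_bool (\<not> good s) \<le> (\<Sum>x\<in>A. ?g s x)" for s
  proof (cases "good s")
    case True
    then show ?thesis by (auto intro!: sum_nonneg)
  next
    case False
    then obtain x where x: "x \<in> A" "x \<in> high \<and> \<bar>dev s x\<bar> \<ge> 1 / 2 \<or> x \<notin> high \<and> score f s x \<ge> threshold n \<epsilon>"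
      by (auto simp: good_def not_less high_def)
    have "1 \<le> ?g s x"
    proof (cases "x \<in> high")
      case True
      then have "dev s x \<ge> 1 / 2 \<or> dev s x \<le> - (1 / 2)" using x by auto
      then show ?thesis
      proof
        assume "dev s x \<ge> 1 / 2"
        then have "0 \<le> mean_score x / 4 * (dev s x - 1 / 2)"
          using mean_score_high[OF True] by simp
        also have "\<dots> = - (mean_score x / 8) + mean_score x / 4 * dev s x" by (simp add: field_simps)
        finally have "1 \<le> exp (- (mean_score x / 8)) * exp (mean_score x / 4 * dev s x)"
          by (simp flip: exp_add)
        moreover have "0 \<le> exp (- (mean_score x / 8)) * exp (- (mean_score x / 4) * dev s x)" by simp
        ultimately show ?thesis unfolding if_P[OF True] by linarith
      next
        assume "dev s x \<le> - (1 / 2)"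
        then have "0 \<le> mean_score x / 4 * (- dev s x - 1 / 2)"
          using mean_score_high[OF True] by simp
        also have "\<dots> = - (mean_score x / 8) + - (mean_score x / 4) * dev s x" by (simp add: field_simps)
        finally have "1 \<le> exp (- (mean_score x / 8)) * exp (- (mean_score x / 4) * dev s x)"
          by (simp flip: exp_add)
        moreover have "0 \<le> exp (- (mean_score x / 8)) * exp (mean_score x / 4 * dev s x)" by simp
        ultimately show ?thesis unfolding if_P[OF True] by linarith
      qed
    next
      case False
      then have "0 \<le> - (threshold n \<epsilon> / 4) + 1 / 4 * score f s x" using x by simp
      then show ?thesis using False by (simp flip: exp_add)
    qed
    also have "\<dots> \<le> (\<Sum>x\<in>A. ?g s x)"
      by (rule member_le_sum[of x A "?g s"]) (auto simp: x finite_A)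
    finally show ?thesis using False by simp
  qed
  have each: "?E (\<lambda>s. ?g s x) \<le> 2 * exp (- c)" if "x \<in> A" for x
  proof (cases "x \<in> high")
    case True
    note m = mean_score_high[OF True]
    have 1: "?E (\<lambda>s. exp (k * dev s x)) \<le> exp (mean_score x / 16)"
      if "k = mean_score x / 4 \<or> k = - (mean_score x / 4)" for k
    proof -
      have "k\<^sup>2 / mean_score x = mean_score x / 16" "\<bar>k\<bar> \<le> mean_score x"
        using that m(2) by (elim disjE; hypsubst; simp add: power2_eq_square)+
      with expectation_exp_dev[OF True, of k] show ?thesis by (simp only:)
    qed
    have "?E (\<lambda>s. ?g s x) = exp (- (mean_score x / 8)) * ?E (\<lambda>s. exp (mean_score x / 4 * dev s x)) +
       exp (- (mean_score x / 8)) * ?E (\<lambda>s. exp (- (mean_score x / 4) * dev s x))"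
      using True by (simp add: int Bochner_Integration.integral_add)
    also have "\<dots> \<le> exp (- (mean_score x / 8)) * exp (mean_score x / 16) +
        exp (- (mean_score x / 8)) * exp (mean_score x / 16)"
      by (intro add_mono mult_left_mono 1) auto
    also have "\<dots> = 2 * exp (- (mean_score x / 16))"
      by (simp flip: exp_add)
    also have "\<dots> \<le> 2 * exp (- c)" using m by (simp add: c_def)
    finally show ?thesis .
  next
    case False
    have "mean_score x \<le> real (size_t1 n \<epsilon>) * (sqrt (real n) / real n)"
      unfolding mean_score_def times_divide_eq_right[symmetric] using False that
      by (intro mult_left_mono divide_right_mono) (auto simp: high_def)
    also have "\<dots> \<le> (768 * sqrt (real n) * (l / \<epsilon>\<^sup>2) + 1) * (sqrt (real n) / real n)"
      by (rule mult_right_mono[OF size_bounds(3)]) simp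
    also have "\<dots> = 768 * (l / \<epsilon>\<^sup>2) + sqrt (real n) / real n"
      using arg_cong[OF sqrt_frac, of "\<lambda>z. 768 * (l / \<epsilon>\<^sup>2) * z"]
      unfolding distrib_right mult_1_left by (simp only: mult_ac mult_1_right)
    also have "\<dots> \<le> 768 * (l / \<epsilon>\<^sup>2) + 1" using n2 by simp
    finally have m: "mean_score x \<le> 768 * (l / \<epsilon>\<^sup>2) + 1" .
    have "?E (\<lambda>s. ?g s x) = exp (- (threshold n \<epsilon> / 4)) * ?E (\<lambda>s. exp (1 / 4 * score f s x))"
      using False by simp
    also have "\<dots> \<le> exp (- (threshold n \<epsilon> / 4)) * exp (mean_score x * (1 / 4 + (1 / 4)\<^sup>2))"
    proof (rule mult_left_mono)
      show "?E (\<lambda>s. exp (1 / 4 * score f s x)) \<le> exp (mean_score x * (1 / 4 + (1 / 4)\<^sup>2))"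
        unfolding samples_def score_def mean_score_eq
        by (rule expectation_exp_sum_list_le)
           (auto simp: sim_item_bounds finite_set_uniform_item finite_A)
    qed simp
    also have "\<dots> \<le> exp (- c)"
    proof -
      have "mean_score x * (1 / 4 + (1 / 4)\<^sup>2) = 5 / 16 * mean_score x" by (simp add: power2_eq_square)
      \<comment> \<open>In units of l / \<epsilon>^2: 5 / 16 * 768 = 240 on the left, 1536 / 4 - 48
        = 336 on the right. The gap of 96 covers the 5 / 16 caused by rounding up the array
        size.\<close>
      also have "\<dots> \<le> threshold n \<epsilon> / 4 - c"
        unfolding size_bounds(5) c_def using m l_over_eps(4) by argo
      finally show ?thesis by (simp flip: exp_add)
    qed
    also have "\<dots> \<le> 2 * exp (- c)" by simp
    finally show ?thesis .
  qed
  have "?E (\<lambda>s. of_bool (\<not> good s)) \<le> ?E (\<lambda>s. \<Sum>x\<in>A. ?g s x)"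
    by (rule expectation_mono_finite_pmf[OF finite_samples pointwise])
  also have "\<dots> = (\<Sum>x\<in>A. ?E (\<lambda>s. ?g s x))"
    by (rule Bochner_Integration.integral_sum) (rule int)
  also have "\<dots> \<le> (\<Sum>x\<in>A. 2 * exp (- c))"
    by (intro sum_mono each)
  also have "\<dots> = 2 * real n * exp (- c)" by (simp add: card_A)
  \<comment> \<open>48 copies of l / \<epsilon>^2 give 47 powers of n and the factor
    \<epsilon>.\<close>
  also have "\<dots> \<le> 2 * real n * (3 / 2 * \<epsilon> / real n ^ 47)"
    by (intro mult_left_mono exp_small) (auto simp: c_def)
  also have "\<dots> = 3 * \<epsilon> / real n ^ 46"
    using n2 by (simp add: power_Suc[of "real n" 46, symmetric] eval_nat_numeral)
  also have "\<dots> \<le> \<epsilon> / (100 * real n ^ 2)"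
  proof -
    have "(300::real) \<le> 2 ^ 44" by simp
    also have "\<dots> \<le> real n ^ 44" using n2 by (intro power_mono) auto
    finally have "300 * real n ^ 2 \<le> real n ^ 44 * real n ^ 2" by (intro mult_right_mono) auto
    also have "\<dots> = real n ^ 46" by (simp flip: power_add)
    finally have *: "3 * (100 * real n ^ 2) \<le> real n ^ 46" by simp
    have "3 * \<epsilon> * (100 * real n ^ 2) \<le> \<epsilon> * real n ^ 46"
      using mult_left_mono[OF *, of \<epsilon>] eps by (simp add: mult_ac)
    then show ?thesis using n2 by (simp add: pos_divide_le_eq pos_le_divide_eq)
  qed
  finally show ?thesis .
qed

end

section \<open>The output distribution is that of a sampler\<close>

lemma expectation_accepted_False: "measure_pmf.expectation p (\<lambda>r. of_bool (accepted False r)) = (1::real)"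
  by (simp add: accepted_def)

lemma expectation_accepted_True:
  "measure_pmf.expectation p (\<lambda>r. of_bool (accepted True r)) = 1 - pmf p None"
proof -
  have "measure_pmf.expectation p (\<lambda>r. of_bool (accepted True r)) =
      measure_pmf.expectation p (\<lambda>r. 1 - indicat_real {None} r)"
    by (intro expectation_cong_pmf) (auto simp: accepted_def indicator_def)
  also have "\<dots> = 1 - measure_pmf.prob p {None}"
    by (subst Bochner_Integration.integral_diff) (auto simp: measure_pmf.emeasure_eq_measure)
  finally show ?thesis by (simp add: measure_pmf_single)
qed

context similarity_stream
begin

text \<open>The acceptance scale \<open>c\<close> is sqrt n for the heavy and 1 for the light loop.
  It cancels in the distribution given success and matters only for the failure probability, through
  the lower bound \<open>r\<close> on the acceptance probability.\<close>

lemma pick_distribution: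
  assumes B: "B \<subseteq> A" "B \<noteq> {}" and c: "c > 0"
    and g: "\<And>x. x \<in> B \<Longrightarrow> g (Some x) = c / d x" "\<And>x. x \<in> B \<Longrightarrow> c / d x \<le> 1" "\<And>x. x \<in> B \<Longrightarrow> r \<le> c / d x"
  defines "R \<equiv> bind_pmf (replicate_pmf (size_t n) (uniform_item B)) (rej g)"
  shows "set_pmf R \<subseteq> insert None (Some ` B)" "finite (set_pmf R)"
    "x \<in> B \<Longrightarrow> pmf R (Some x) = (1 - pmf R None) * (1 / d x / (\<Sum>x\<in>B. 1 / d x))"
    "pmf R None \<le> exp (- (real (size_t n) * r))"
proof -
  have finB: "finite B" using B finite_A finite_subset by blast
  have dpos: "d x > 0" if "x \<in> B" for x using d_bounds(1)[of x] that B by auto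
  have card: "real (card B) > 0" using B finB by (simp add: card_gt_0_iff)
  show "set_pmf R \<subseteq> insert None (Some ` B)"
  proof
    fix z assume "z \<in> set_pmf R"
    then obtain cs where cs: "cs \<in> set_pmf (replicate_pmf (size_t n) (uniform_item B))"
        "z \<in> set_pmf (rej g cs)"
      by (auto simp: R_def)
    have "set cs \<subseteq> Some ` B"
      using cs(1) B finB by (auto simp: set_replicate_pmf set_uniform_item)
    then show "z \<in> insert None (Some ` B)" using cs(2) set_rej[of g cs] by blast
  qed
  then show "finite (set_pmf R)" by (rule finite_subset) (simp add: finB)
  have g01: "0 \<le> g (Some x) \<and> g (Some x) \<le> 1" if "x \<in> B" for x
    unfolding g(1)[OF that] using g(2)[OF that] c dpos[OF that] by simp
  have pos: "(\<Sum>x\<in>B. g (Some x)) > 0"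
    using B finB g dpos c by (intro sum_pos) auto
  have eq: "(\<Sum>x\<in>B. g (Some x)) = c * (\<Sum>x\<in>B. 1 / d x)"
    by (simp add: g sum_distrib_left)
  define a where "a = (\<Sum>x\<in>B. g (Some x)) / real (card B)"
  have none: "pmf R None = (1 - a) ^ size_t n"
    unfolding R_def a_def by (rule pmf_rej(1)[OF finB B(2) _ pos]) (rule g01)
  have some: "pmf R (Some x) = g (Some x) / (\<Sum>x\<in>B. g (Some x)) * (1 - (1 - a) ^ size_t n)" if "x \<in> B" for x
    unfolding R_def a_def by (rule pmf_rej(2)[OF finB B(2) _ pos that]) (rule g01)
  show "pmf R (Some x) = (1 - pmf R None) * (1 / d x / (\<Sum>x\<in>B. 1 / d x))" if "x \<in> B"
    using c unfolding some[OF that] none eq g(1)[OF that] by simp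
  have "(\<Sum>x\<in>B. g (Some x)) \<le> (\<Sum>x\<in>B. 1)" using g01 by (intro sum_mono) auto
  then have a1: "a \<le> 1" using card by (simp add: a_def)
  have "(\<Sum>x\<in>B. r) \<le> (\<Sum>x\<in>B. g (Some x))" using g by (intro sum_mono) auto
  then have ra: "r \<le> a" using card by (simp add: a_def pos_le_divide_eq mult.commute)
  have "(1 - a) ^ size_t n \<le> exp (- a) ^ size_t n"
    using a1 exp_ge_add_one_self[of "- a"] by (intro power_mono) auto
  also have "\<dots> = exp (- (real (size_t n) * a))" by (simp flip: exp_of_nat_mult)
  also have "\<dots> \<le> exp (- (real (size_t n) * r))" using ra by (simp add: mult_left_mono)
  finally show "pmf R None \<le> exp (- (real (size_t n) * r))" using none by simp
qed

section \<open>The two classes and the output for a good sample\<close>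

abbreviation "heavies s \<equiv> heavy n \<epsilon> f s A"
abbreviation "lights s \<equiv> light n \<epsilon> f s A"
definition "index_sum = (\<Sum>x\<in>A. 1 / d x)"

lemma heavy_light: "heavies s \<union> lights s = A" "heavies s \<inter> lights s = {}" "heavies s \<subseteq> A" "lights s \<subseteq> A"
  by (auto simp: heavy_def light_def)

lemma total_split: "index_sum = (\<Sum>x\<in>heavies s. 1 / d x) + (\<Sum>x\<in>lights s. 1 / d x)"
  unfolding index_sum_def
  by (subst sum.union_disjoint[symmetric]) (auto simp: heavy_light finite_heavy finite_light finite_A)

lemma heavy_high: "good s \<Longrightarrow> heavies s \<subseteq> high"
  by (force simp: good_def heavy_def)

text \<open>Beyond degree 4 * sqrt n the mean score is at least twice the threshold, and in a good
  sample a high node loses less than half of its mean score.\<close>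

lemma light_degree:
  assumes "good s" "x \<in> lights s"
  shows "d x \<le> 4 * sqrt (real n)"
proof (rule ccontr)
  assume "\<not> ?thesis"
  then have dx: "4 * sqrt (real n) < d x" by simp
  have "sqrt (real n) \<le> d x" using dx n2(3) by linarith
  then have x: "x \<in> high" using assms by (auto simp: light_def high_def)
  have "threshold n \<epsilon> = 768 * sqrt (real n) * (l / \<epsilon>\<^sup>2) * (4 * sqrt (real n) / (2 * real n))"
  proof -
    have "768 * r * c * (4 * r / (2 * k)) = 1536 * c * (r * (r / k))" for r c k :: real
      by simp
    then show ?thesis unfolding size_bounds(5) by (simp only: sqrt_frac mult_1_right)
  qed
  also have "\<dots> \<le> real (size_t1 n \<epsilon>) * (4 * sqrt (real n) / (2 * real n))"
    by (rule mult_right_mono[OF size_bounds(2)]) simp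
  also have "\<dots> \<le> real (size_t1 n \<epsilon>) * (d x / (2 * real n))"
    using dx by (intro mult_left_mono divide_right_mono) auto
  also have "\<dots> = mean_score x / 2" by (simp add: mean_score_def)
  also have "\<dots> \<le> score f s x"
  proof -
    have "- (1 / 2) < dev s x" using assms(1) x by (auto simp: good_def)
    then have "1 / 2 < score f s x / mean_score x" unfolding dev_def by linarith
    then show ?thesis using mean_score_high(2)[OF x] by (simp add: pos_less_divide_eq)
  qed
  finally show False using assms(2) by (simp add: light_def)
qed

text \<open>The estimate of an inverse degree is off by the factor 1 / (1 + e) with
  \<open>\<bar>e\<bar> \<le> M\<close>. The cap 1 / 2 in \<open>M\<close> is justified by goodness
  and is what makes 1 + 2 * M an upper bound on this factor.\<close>

lemma heavy_weight_bounds: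
  assumes "good s"
  defines "M \<equiv> min (dev_bound s) (1 / 2)"
  shows "(1 - M) * (\<Sum>x\<in>heavies s. 1 / d x) \<le> heavy_weight n \<epsilon> f s A"
    "heavy_weight n \<epsilon> f s A \<le> (1 + 2 * M) * (\<Sum>x\<in>heavies s. 1 / d x)"
    "0 \<le> M" "M \<le> 1 / 2"
proof -
  show M: "0 \<le> M" "M \<le> 1 / 2" using dev_bound_nonneg by (auto simp: M_def)
  have "(1 - M) * (1 / d x) \<le> inverse (real n / real (size_t1 n \<epsilon>) * score f s x) \<and>
      inverse (real n / real (size_t1 n \<epsilon>) * score f s x) \<le> (1 + 2 * M) * (1 / d x)"
    if "x \<in> heavies s" for x
  proof -
    have x: "x \<in> high" using heavy_high[OF assms(1)] that by blast
    have dx: "d x > 0" using x d_bounds(1)[of x] by (auto simp: high_def)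
    define e where "e = dev s x"
    have "\<bar>e\<bar> \<le> M"
      using abs_dev_le_dev_bound[OF x] assms(1) x by (auto simp: M_def e_def good_def less_imp_le)
    then have e: "- M \<le> e" "e \<le> M" by auto
    have "score f s x = mean_score x * (1 + e)"
      using mean_score_high(2)[OF x] by (simp add: e_def dev_def)
    then have "real n / real (size_t1 n \<epsilon>) * score f s x = d x * (1 + e)"
      using size_pos n2 by (simp add: mean_score_def)
    then have eq: "inverse (real n / real (size_t1 n \<epsilon>) * score f s x) = inverse (1 + e) * (1 / d x)"
      by (simp add: inverse_eq_divide)
    have pos: "1 + e > 0" using e M by linarith
    have "(1 - M) * (1 + e) \<le> (1 - M) * (1 + M)" using e M by (intro mult_left_mono) auto
    also have "\<dots> \<le> 1" by (simp add: algebra_simps)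
    finally have 1: "1 - M \<le> inverse (1 + e)" using pos by (simp add: inverse_eq_divide pos_le_divide_eq)
    have "1 \<le> 1 + M * (1 - 2 * M)" using M by simp
    also have "\<dots> = (1 + 2 * M) * (1 - M)" by (simp add: algebra_simps)
    also have "\<dots> \<le> (1 + 2 * M) * (1 + e)" using e M by (intro mult_left_mono) auto
    finally have 2: "inverse (1 + e) \<le> 1 + 2 * M" using pos by (simp add: inverse_eq_divide pos_divide_le_eq)
    show ?thesis
      unfolding eq using 1 2 dx by (intro conjI mult_right_mono) auto
  qed
  then show "(1 - M) * (\<Sum>x\<in>heavies s. 1 / d x) \<le> heavy_weight n \<epsilon> f s A"
    "heavy_weight n \<epsilon> f s A \<le> (1 + 2 * M) * (\<Sum>x\<in>heavies s. 1 / d x)"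
    unfolding heavy_weight_def sum_distrib_left by (auto intro!: sum_mono)
qed

text \<open>Comparing with the target times the success probability leaves only errors of the
  weights: \<open>dev_bound\<close> comes from \<open>WH\<close>, and 13/30 is twice the 13/60 of
  the light weight. Failure means that one of two independent loops exhausts its array.\<close>

lemma good_outcome:
  assumes good: "good s"
  defines "T \<equiv> outcome n \<epsilon> f xs s"
  shows "pmf T Fail \<le> 1 / real n ^ 12 + 1 / real n ^ 3"
    and "x \<in> A \<Longrightarrow> \<bar>pmf T (Return (Some x)) - 1 / d x / index_sum * (1 - pmf T Fail)\<bar> \<le>
      1 / d x / index_sum * (2 * dev_bound s + 13 / 30 * \<epsilon>)"
proof -
  define H L where "H = heavies s" and "L = lights s"
  define ph where "ph = (if H \<noteq> {} then bind_pmf (replicate_pmf (size_t n) (uniform_item H))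
    (pick_heavy n f xs) else return_pmf None)"
  define pl where "pl = (if L \<noteq> {} then bind_pmf (replicate_pmf (size_t n) (uniform_item L))
    (pick_light f xs) else return_pmf None)"
  define pw where "pw = map_pmf (light_weight n \<epsilon> f xs (card L))
    (replicate_pmf (size_t2 n \<epsilon>) (uniform_item L))"
  define a where "a = heavy_weight n \<epsilon> f s A"
  define SH SL where "SH = (\<Sum>x\<in>H. 1 / d x)" and "SL = (\<Sum>x\<in>L. 1 / d x)"
  define M where "M = min (dev_bound s) (1 / 2)"
  define V where "V = 13 / 60 * \<epsilon>"
  have T: "T = do {rh \<leftarrow> ph; rl \<leftarrow> pl; w \<leftarrow> pw; decide (H \<noteq> {}) (L \<noteq> {}) a rh rl w}"
    unfolding T_def outcome_def Let_def ph_def pl_def pw_def a_def H_def L_def A_def ..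
  have HL: "H \<union> L = A" "H \<inter> L = {}" "H \<subseteq> A" "L \<subseteq> A" unfolding H_def L_def by (rule heavy_light)+
  have fin: "finite H" "finite L" using HL finite_A finite_subset by blast+
  have dpos: "d x > 0" if "x \<in> A" for x using d_bounds(1)[OF that] by simp
  have tot: "index_sum = SH + SL" unfolding SH_def SL_def H_def L_def by (rule total_split)
  have SHL0: "SH \<ge> 0" "SL \<ge> 0" unfolding SH_def SL_def
    using HL dpos by (auto intro!: sum_nonneg simp: less_imp_le subset_iff)
  note hw = heavy_weight_bounds[OF good, folded M_def H_def a_def, folded SH_def]
  have "0 \<le> (1 - M) * SH" using hw SHL0 by simp
  then have a0: "a \<ge> 0" using hw(1) by linarith
  have V0: "V \<ge> 0" using eps by (simp add: V_def)
  have dL: "d x \<le> 4 * sqrt (real n)" if "x \<in> L" for x using light_degree[OF good] that by (simp add: L_def)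
  have dH: "sqrt (real n) \<le> d x" if "x \<in> H" for x using heavy_high[OF good] that by (auto simp: H_def high_def)
  define ah where "ah = measure_pmf.expectation ph (\<lambda>r. of_bool (accepted (H \<noteq> {}) r) :: real)"
  define al where "al = measure_pmf.expectation pl (\<lambda>r. of_bool (accepted (L \<noteq> {}) r) :: real)"
  have ph: "set_pmf ph \<subseteq> insert None (Some ` H) \<and> finite (set_pmf ph) \<and> 0 \<le> ah \<and> ah \<le> 1 \<and>
    1 - ah \<le> 1 / real n ^ 12 \<and> (\<forall>x\<in>H. pmf ph (Some x) = ah * (1 / d x / SH))"
  proof (cases "H = {}")
    case True
    then show ?thesis by (simp add: ph_def ah_def expectation_accepted_False)
  next
    case False
    have nd: "min 1 (sqrt (real n) / node_degree f xs (Some x)) = sqrt (real n) / d x" if "x \<in> H" for x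
      using dH[OF that] dpos[of x] that HL unfolding node_degree_eq by auto
    have ph_eq: "ph = bind_pmf (replicate_pmf (size_t n) (uniform_item H)) (pick_heavy n f xs)"
      using False by (simp add: ph_def)
    have ub: "sqrt (real n) / d x \<le> 1" if "x \<in> H" for x
      using dH[OF that] dpos[of x] that HL by auto
    have lb: "sqrt (real n) / real n \<le> sqrt (real n) / d x" if "x \<in> H" for x
      using d_bounds(2)[of x] dpos[of x] that HL n2 by (intro divide_left_mono) auto
    note p = pick_distribution[OF HL(3) False n2(3), of "\<lambda>c. min 1 (sqrt (real n) / node_degree f xs c)",
        OF nd ub lb, folded pick_heavy_def, folded ph_eq SH_def]
    have ah: "ah = 1 - pmf ph None"
      using False by (simp add: ah_def expectation_accepted_True)
    \<comment> \<open>A heavy node is accepted with probability at least sqrt n / n, so about 12 * l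
      acceptances are expected.\<close>
    have "12 * l = 12 * sqrt (real n) * l * (sqrt (real n) / real n)"
      using arg_cong[OF sqrt_frac, of "\<lambda>z. 12 * l * z"] by (simp only: mult_ac mult_1_right)
    also have "\<dots> \<le> real (size_t n) * (sqrt (real n) / real n)"
      by (rule mult_right_mono[OF size_bounds(1)]) simp
    finally have "exp (- (real (size_t n) * (sqrt (real n) / real n))) \<le> exp (- (real 12 * l))" by simp
    also have "\<dots> = 1 / real n ^ 12" unfolding exp_minus exp_l by (simp add: inverse_eq_divide)
    finally have "pmf ph None \<le> 1 / real n ^ 12" using p(4) by linarith
    then show ?thesis
      using p(1,2,3) ah pmf_le_1[of ph None] pmf_nonneg[of ph None] by simp
  qed
  have pl: "set_pmf pl \<subseteq> insert None (Some ` L) \<and> finite (set_pmf pl) \<and> 0 \<le> al \<and> al \<le> 1 \<and>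
    1 - al \<le> 1 / real n ^ 3 \<and> (\<forall>x\<in>L. pmf pl (Some x) = al * (1 / d x / SL))"
  proof (cases "L = {}")
    case True
    then show ?thesis by (simp add: pl_def al_def expectation_accepted_False)
  next
    case False
    have pl_eq: "pl = bind_pmf (replicate_pmf (size_t n) (uniform_item L)) (pick_light f xs)"
      using False by (simp add: pl_def)
    have nd: "1 / node_degree f xs (Some x) = 1 / d x" for x by (simp add: node_degree_eq)
    have ub: "1 / d x \<le> 1" if "x \<in> L" for x
      using d_bounds(1)[of x] that HL by auto
    have lb: "1 / (4 * sqrt (real n)) \<le> 1 / d x" if "x \<in> L" for x
      using dL[OF that] dpos[of x] that HL n2 by (intro divide_left_mono) auto
    note p = pick_distribution[OF HL(4) False zero_less_one, of "\<lambda>c. 1 / node_degree f xs c",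
        OF nd ub lb, folded pick_light_def, folded pl_eq SL_def]
    have al: "al = 1 - pmf pl None"
      using False by (simp add: al_def expectation_accepted_True)
    \<comment> \<open>A light node is accepted with probability at least 1 / (4 * sqrt n); the
      factor 4 reduces the exponent from 12 to 3.\<close>
    have "3 * l = 12 * sqrt (real n) * l * (1 / (4 * sqrt (real n)))"
      using n2 by simp
    also have "\<dots> \<le> real (size_t n) * (1 / (4 * sqrt (real n)))"
      by (rule mult_right_mono[OF size_bounds(1)]) simp
    finally have "exp (- (real (size_t n) * (1 / (4 * sqrt (real n))))) \<le> exp (- (real 3 * l))" by simp
    also have "\<dots> = 1 / real n ^ 3" unfolding exp_minus exp_l by (simp add: inverse_eq_divide)
    finally have "pmf pl None \<le> 1 / real n ^ 3" using p(4) by linarith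
    then show ?thesis
      using p(1,2,3) al pmf_le_1[of pl None] pmf_nonneg[of pl None] by simp
  qed
  have finw: "finite (set_pmf pw)"
    unfolding pw_def by (simp add: finite_set_replicate_pmf finite_set_uniform_item fin)
  note lw = light_weight_deviation[OF HL(4) _ dL, folded SL_def pw_def, folded V_def]
  \<comment> \<open>Without light nodes the weight is constantly 0, and the deviation bound for
    positive weights does not apply. The heavy share is then exactly 1.\<close>
  have pw_empty: "pw = return_pmf 0" if "L = {}"
    using that by (simp add: pw_def light_weight_def map_pmf_def bind_pmf_const)
  have w0: "0 \<le> w" if "w \<in> set_pmf pw" for w
  proof (cases "L = {}")
    case True
    then show ?thesis using that pw_empty by simp
  next
    case False
    then show ?thesis using lw(3)[OF False] that by (simp add: less_imp_le)
  qed
  have finp: "finite (set_pmf ph)" "finite (set_pmf pl)" using ph pl by auto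
  note D = pmf_bind_decide[where h = "H \<noteq> {}" and l = "L \<noteq> {}", OF finp finw a0 w0, folded T ah_def al_def]
  have fail: "pmf T Fail = 1 - ah * al" by (rule D(1))
  have "1 - ah * al = (1 - ah) * al + (1 - al)" by (simp add: algebra_simps)
  also have "\<dots> \<le> (1 - ah) * 1 + (1 - al)" using ph pl by (intro add_mono mult_left_mono) auto
  also have "\<dots> \<le> 1 / real n ^ 12 + 1 / real n ^ 3" using ph pl by auto
  finally show "pmf T Fail \<le> 1 / real n ^ 12 + 1 / real n ^ 3" using fail by simp
  show "\<bar>pmf T (Return (Some x)) - 1 / d x / index_sum * (1 - pmf T Fail)\<bar> \<le>
      1 / d x / index_sum * (2 * dev_bound s + 13 / 30 * \<epsilon>)" if x: "x \<in> A"
  proof -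
    have tot0: "index_sum > 0"
      unfolding index_sum_def using dpos by (intro sum_pos) (auto simp: finite_A A_ne)
    have ahl: "0 \<le> ah * al" "ah * al \<le> 1" using ph pl by (auto intro: mult_le_one)
    \<comment> \<open>\<open>e\<close> is the mean probability of deciding for the class of
      \<open>x\<close>, divided by the total inverse degree of that class; ideally it is 1 /
      index_sum. The success probability splits off by independence.\<close>
    have "\<exists>e. pmf T (Return (Some x)) = ah * al * (1 / d x) * e \<and> \<bar>e - 1 / index_sum\<bar> \<le> (2 * M + 2 * V) / index_sum"
    proof (cases "x \<in> H")
      case True
      have "0 < 1 / d y" if "y \<in> H" for y
      proof -
        have "y \<in> A" using that HL(3) by blast
        then show ?thesis using dpos by simp
      qed
      then have SH: "SH > 0" unfolding SH_def using True fin(1) by (intro sum_pos) auto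
      define e where "e = measure_pmf.expectation pw (\<lambda>w. a / (a + w))"
      have "0 < (1 - M) * SH" using hw SH by simp
      then have apos: "a > 0" using hw(1) by linarith
      have "Some x \<notin> set_pmf pl" using pl True HL(2) by blast
      then have "pmf T (Return (Some x)) = pmf ph (Some x) * al * e"
        unfolding e_def by (intro D(2))
      moreover have "pmf ph (Some x) = ah * (1 / d x / SH)" using ph True by blast
      ultimately have 1: "pmf T (Return (Some x)) = ah * al * (1 / d x) * (e / SH)" by simp
      have "a / (a + SL) \<le> e \<and> e \<le> (1 + V) * (a / (a + SL))"
      proof (cases "L = {}")
        case True
        then show ?thesis using pw_empty apos V0 by (simp add: e_def SL_def)
      next
        case False
        have "(1 + measure_pmf.expectation pw (\<lambda>w. (w - SL)\<^sup>2 / (w * SL))) * (a / (a + SL)) \<le>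
           (1 + V) * (a / (a + SL))"
          using lw(5)[OF False] apos SHL0 by (intro mult_right_mono) auto
        then show ?thesis
          unfolding e_def
          using expectation_share_bounds(1,2)[OF finw lw(3)[OF False] lw(4)[OF False] lw(1)[OF False] a0 refl]
          by linarith
      qed
      then have "\<bar>e / SH - 1 / (SH + SL)\<bar> \<le> (2 * M + 2 * V) / (SH + SL)"
        using share_heavy_error[OF SH SHL0(2) hw(3,4,1,2) V0] by blast
      then show ?thesis using 1 unfolding tot by blast
    next
      case False
      then have xL: "x \<in> L" using x HL by blast
      then have ne: "L \<noteq> {}" by blast
      have SL: "SL > 0" by (rule lw(1)[OF ne])
      define e where "e = measure_pmf.expectation pw (\<lambda>w. 1 - a / (a + w))"
      have "Some x \<notin> set_pmf ph" using ph False by blast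
      then have "pmf T (Return (Some x)) = ah * pmf pl (Some x) * e"
        unfolding e_def by (intro D(3))
      moreover have "pmf pl (Some x) = al * (1 / d x / SL)" using pl xL by blast
      ultimately have 1: "pmf T (Return (Some x)) = ah * al * (1 / d x) * (e / SL)" by simp
      have "(1 - V) * (SL / (a + SL)) \<le> (1 - measure_pmf.expectation pw (\<lambda>w. (w - SL)\<^sup>2 / (w * SL))) * (SL / (a + SL))"
        using lw(5)[OF ne] a0 SL by (intro mult_right_mono) auto
      then have "(1 - V) * (SL / (a + SL)) \<le> e \<and> e \<le> SL / (a + SL)"
        unfolding e_def
        using expectation_share_bounds(3,4)[OF finw lw(3)[OF ne] lw(4)[OF ne] lw(1)[OF ne] a0 refl]
        by linarith
      then have "\<bar>e / SL - 1 / (SH + SL)\<bar> \<le> (2 * M + 2 * V) / (SH + SL)"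
        using share_light_error[OF SHL0(1) SL hw(3,4,1,2) V0] by blast
      then show ?thesis using 1 unfolding tot by blast
    qed
    then obtain e where e: "pmf T (Return (Some x)) = ah * al * (1 / d x) * e"
      "\<bar>e - 1 / index_sum\<bar> \<le> (2 * M + 2 * V) / index_sum" by blast
    have "pmf T (Return (Some x)) - 1 / d x / index_sum * (1 - pmf T Fail) =
        (ah * al) * (1 / d x * (e - 1 / index_sum))"
      unfolding e(1) fail by (simp add: right_diff_distrib)
    moreover have "\<bar>ah * al\<bar> = ah * al" using ahl(1) by (rule abs_of_nonneg)
    moreover have "\<bar>1 / d x\<bar> = 1 / d x" using dpos[OF x] by simp
    ultimately have "\<bar>pmf T (Return (Some x)) - 1 / d x / index_sum * (1 - pmf T Fail)\<bar> =
        (ah * al) * (1 / d x * \<bar>e - 1 / index_sum\<bar>)"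
      by (simp only: abs_mult[of "ah * al"] abs_mult[of "1 / d x"])
    also have "\<dots> \<le> 1 * (1 / d x * ((2 * M + 2 * V) / index_sum))"
      using ahl dpos[OF x] e(2) by (intro mult_mono) (auto intro: order_trans[OF abs_ge_zero])
    also have "\<dots> = 1 / d x / index_sum * (2 * M + 2 * V)" by simp
    also have "\<dots> \<le> 1 / d x / index_sum * (2 * dev_bound s + 13 / 30 * \<epsilon>)"
      using dpos[OF x] tot0 by (intro mult_left_mono) (auto simp: M_def V_def)
    finally show ?thesis .
  qed
qed


section \<open>Averaging over the first sample\<close>

lemma run_eq: "run (algorithm_B n \<epsilon>) f \<sigma> = bind_pmf samples (outcome n \<epsilon> f xs)"
  unfolding run_algorithm_B samples_def A_def xs_def ..

lemma index_sum_bounds: "0 < index_sum" "index_sum \<le> real n"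
proof -
  have d: "0 < 1 / d x" "1 / d x \<le> 1" if "x \<in> A" for x
    using d_bounds(1)[OF that] by auto
  then show "0 < index_sum"
    unfolding index_sum_def by (intro sum_pos) (auto simp: finite_A A_ne)
  have "index_sum \<le> (\<Sum>x\<in>A. 1)" unfolding index_sum_def by (intro sum_mono d)
  then show "index_sum \<le> real n" by (simp add: card_A)
qed

text \<open>Degrees and the diversity index are at most n. The lower bound lets a bad sample be
  charged to the target of any node.\<close>

lemma target_bounds:
  assumes "x \<in> A"
  shows "1 / real n ^ 2 \<le> 1 / d x / index_sum" "1 / d x / index_sum \<le> 1"
proof -
  have d: "0 < d x" using d_bounds(1)[OF assms] by simp
  have "d x * index_sum \<le> real n * real n"
    using d_bounds(2) index_sum_bounds d by (intro mult_mono) auto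
  then show "1 / real n ^ 2 \<le> 1 / d x / index_sum"
    using d index_sum_bounds by (simp add: power2_eq_square frac_le)
  have "1 / d x \<le> index_sum"
    unfolding index_sum_def using assms finite_A
    by (intro member_le_sum) (use d_bounds(1) in \<open>auto intro: order_trans[OF zero_le_one]\<close>)
  then show "1 / d x / index_sum \<le> 1"
    unfolding pos_divide_le_eq[OF index_sum_bounds(1)] by simp
qed

lemma run_bounds:
  defines "p \<equiv> run (algorithm_B n \<epsilon>) f \<sigma>"
  shows "pmf p Fail \<le> 1 / real n ^ 2"
    "x \<in> A \<Longrightarrow> \<bar>pmf p (Return (Some x)) - 1 / d x / index_sum * (1 - pmf p Fail)\<bar> \<le>
      3 / 4 * \<epsilon> * (1 / d x / index_sum)"
proof -
  let ?E = "measure_pmf.expectation samples"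
  let ?T = "outcome n \<epsilon> f xs"
  note int = integrable_measure_pmf_finite[OF finite_samples]
  have pmf_p: "pmf p z = ?E (\<lambda>s. pmf (?T s) z)" for z
    by (simp add: p_def run_eq pmf_bind)
  have bad: "?E (\<lambda>s. of_bool (\<not> good s)) \<le> \<epsilon> / 100 * (1 / real n ^ 2)"
    using expectation_not_good by simp
  have "pmf p Fail \<le> ?E (\<lambda>s. (1 / real n ^ 12 + 1 / real n ^ 3) + of_bool (\<not> good s))"
    unfolding pmf_p
  proof (rule expectation_mono_finite_pmf[OF finite_samples])
    fix s
    show "pmf (?T s) Fail \<le> (1 / real n ^ 12 + 1 / real n ^ 3) + of_bool (\<not> good s)"
      using good_outcome(1)[of s] pmf_le_1[of "?T s" Fail]
      by (cases "good s") (auto intro: add_increasing)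
  qed
  also have "\<dots> = (1 / real n ^ 12 + 1 / real n ^ 3) + ?E (\<lambda>s. of_bool (\<not> good s))"
    by (simp add: int Bochner_Integration.integral_add)
  also have "\<dots> \<le> (1 / 1024 * (1 / real n ^ 2) + 1 / 2 * (1 / real n ^ 2)) + 1 / 100 * (1 / real n ^ 2)"
  proof (intro add_mono)
    have "2 ^ 10 * real n ^ 2 \<le> real n ^ 10 * real n ^ 2"
      using n2 by (intro mult_right_mono power_mono) auto
    also have "\<dots> = real n ^ 12" by (simp flip: power_add)
    finally show "1 / real n ^ 12 \<le> 1 / 1024 * (1 / real n ^ 2)"
      using n2 by (simp add: frac_le)
    have "2 * real n ^ 2 \<le> real n * real n ^ 2"
      using n2 by (intro mult_right_mono) auto
    also have "\<dots> = real n ^ 3" by (simp add: eval_nat_numeral)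
    finally show "1 / real n ^ 3 \<le> 1 / 2 * (1 / real n ^ 2)"
      using n2 by (simp add: frac_le)
    have "\<epsilon> / 100 * (1 / real n ^ 2) \<le> 1 / 100 * (1 / real n ^ 2)"
      using eps by (intro mult_right_mono) auto
    then show "?E (\<lambda>s. of_bool (\<not> good s)) \<le> 1 / 100 * (1 / real n ^ 2)" using bad by linarith
  qed
  also have "\<dots> \<le> 1 / real n ^ 2"
  proof -
    have "0 \<le> 1 / real n ^ 2" by simp
    then show ?thesis by linarith
  qed
  finally show "pmf p Fail \<le> 1 / real n ^ 2" .
  show "\<bar>pmf p (Return (Some x)) - 1 / d x / index_sum * (1 - pmf p Fail)\<bar> \<le>
      3 / 4 * \<epsilon> * (1 / d x / index_sum)" if x: "x \<in> A"
  proof -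
    define q where "q = 1 / d x / index_sum"
    note q = target_bounds[OF x, folded q_def]
    have q0: "0 \<le> q" using q(1) by (rule order_trans[rotated]) simp
    let ?D = "\<lambda>s. pmf (?T s) (Return (Some x)) - q * (1 - pmf (?T s) Fail)"
    have "pmf p (Return (Some x)) - q * (1 - pmf p Fail) = ?E ?D"
      unfolding pmf_p by (simp add: int)
    then have "\<bar>pmf p (Return (Some x)) - q * (1 - pmf p Fail)\<bar> \<le> ?E (\<lambda>s. \<bar>?D s\<bar>)"
      by (simp only: integral_abs_bound)
    \<comment> \<open>On a bad sample the difference is only known to be at most 1, which the
      indicator pays for.\<close>
    also have "\<dots> \<le> ?E (\<lambda>s. (q * (13 / 30 * \<epsilon>) + (q * 2) * dev_bound s) + of_bool (\<not> good s))"
    proof (rule expectation_mono_finite_pmf[OF finite_samples])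
      fix s
      show "\<bar>?D s\<bar> \<le> (q * (13 / 30 * \<epsilon>) + (q * 2) * dev_bound s) + of_bool (\<not> good s)"
      proof (cases "good s")
        case True
        have "q * (13 / 30 * \<epsilon>) + (q * 2) * dev_bound s = q * (2 * dev_bound s + 13 / 30 * \<epsilon>)"
          by (simp add: algebra_simps)
        then show ?thesis using good_outcome(2)[OF True x, folded q_def] True by simp
      next
        case False
        have "0 \<le> q * (1 - pmf (?T s) Fail)" "q * (1 - pmf (?T s) Fail) \<le> 1"
          using q0 pmf_le_1[of "?T s" Fail] pmf_nonneg[of "?T s" Fail]
          by (auto intro: mult_le_one[OF q(2)])
        then have "\<bar>?D s\<bar> \<le> 1"
          using pmf_le_1[of "?T s" "Return (Some x)"] pmf_nonneg[of "?T s" "Return (Some x)"] by linarith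
        moreover have "0 \<le> q * (13 / 30 * \<epsilon>) + (q * 2) * dev_bound s"
          using q0 eps dev_bound_nonneg by simp
        ultimately show ?thesis using False by simp
      qed
    qed
    also have "\<dots> = (q * (13 / 30 * \<epsilon>) + (q * 2) * ?E dev_bound) + ?E (\<lambda>s. of_bool (\<not> good s))"
      by (simp add: int Bochner_Integration.integral_add)
    also have "\<dots> \<le> (q * (13 / 30 * \<epsilon>) + (q * 2) * (5 / 48 * \<epsilon>)) + \<epsilon> / 100 * q"
    proof (intro add_mono order_refl mult_left_mono expectation_dev_bound)
      have "\<epsilon> / 100 * (1 / real n ^ 2) \<le> \<epsilon> / 100 * q" using q eps by (intro mult_left_mono) auto
      then show "?E (\<lambda>s. of_bool (\<not> good s)) \<le> \<epsilon> / 100 * q" using bad by linarith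
    qed (use q0 in simp)
    \<comment> \<open>The contributions of the light weight, the degree estimates and the bad
      samples. The slack below 1 is reserved for the conditioning on success.\<close>
    also have "\<dots> = (13 / 30 + 10 / 48 + 1 / 100) * (\<epsilon> * q)"
      by (simp add: field_simps)
    also have "\<dots> \<le> 3 / 4 * (\<epsilon> * q)"
      using q0 eps by (intro mult_right_mono) auto
    finally show ?thesis by (simp add: q_def)
  qed
qed

lemma L_DI_sampler_run: "L_DI_sampler \<epsilon> (1 / real n ^ 2) f \<sigma> (run (algorithm_B n \<epsilon>) f \<sigma>)"
  unfolding L_DI_sampler_def Let_def
proof (intro conjI impI ballI)
  define p where "p = run (algorithm_B n \<epsilon>) f \<sigma>"
  show fail: "pmf (run (algorithm_B n \<epsilon>) f \<sigma>) Fail \<le> 1 / real n ^ 2" by (rule run_bounds)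
  fix i assume "i \<in> {1..length \<sigma>}"
  then have x: "(i, item \<sigma> i) \<in> A" by (auto simp: A_image n_def)
  define q where "q = 1 / d (i, item \<sigma> i) / index_sum"
  have q_eq: "inverse (degree f \<sigma> i) / diversity_index f \<sigma> = q"
    by (simp add: q_def degree_eq diversity_index_eq index_sum_def inverse_eq_divide)
  have q0: "0 \<le> q" unfolding q_def using target_bounds(1)[OF x] by (rule order_trans[rotated]) simp
  define c where "c = 1 - pmf p Fail"
  \<comment> \<open>From n \<ge> 2 the success probability \<open>c\<close> is at least 3 / 4, so
    the unconditional error 3/4 \<epsilon> is at most \<open>c\<close> times \<epsilon> and survives
    the division by \<open>c\<close>.\<close>
  have "1 / real n ^ 2 \<le> 1 / 2 ^ 2" using n2 by (intro divide_left_mono power_mono) auto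
  then have c: "3 / 4 \<le> c" using fail by (simp add: c_def p_def)
  have prob: "measure_pmf.prob p (- {Fail}) = c"
    using measure_pmf.prob_compl[of "{Fail}" p] by (simp add: measure_pmf_single Compl_eq_Diff_UNIV c_def)
  then have "set_pmf p \<inter> - {Fail} \<noteq> {}"
    using c measure_pmf_zero_iff[of p "- {Fail}"] by auto
  then have cond: "pmf (cond_pmf p (- {Fail})) (Return (Some (i, item \<sigma> i))) =
      pmf p (Return (Some (i, item \<sigma> i))) / c"
    by (simp add: pmf_cond prob)
  have "\<bar>pmf p (Return (Some (i, item \<sigma> i))) - q * c\<bar> \<le> 3 / 4 * (\<epsilon> * q)"
    using run_bounds(2)[OF x] by (simp add: q_def c_def p_def)
  also have "\<dots> \<le> c * (\<epsilon> * q)" using c q0 eps by (intro mult_right_mono) auto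
  finally have b: "\<bar>pmf p (Return (Some (i, item \<sigma> i))) - q * c\<bar> \<le> c * (\<epsilon> * q)" .
  have "(1 - \<epsilon>) * q * c \<le> pmf p (Return (Some (i, item \<sigma> i)))"
    "pmf p (Return (Some (i, item \<sigma> i))) \<le> (1 + \<epsilon>) * q * c"
    using b by (simp_all add: abs_le_iff algebra_simps)
  then show "(1 - \<epsilon>) * (inverse (degree f \<sigma> i) / diversity_index f \<sigma>) \<le>
      pmf (cond_pmf (run (algorithm_B n \<epsilon>) f \<sigma>) (- {Fail})) (Return (Some (i, item \<sigma> i)))"
    "pmf (cond_pmf (run (algorithm_B n \<epsilon>) f \<sigma>) (- {Fail})) (Return (Some (i, item \<sigma> i))) \<le>
      (1 + \<epsilon>) * (inverse (degree f \<sigma> i) / diversity_index f \<sigma>)"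
    unfolding q_eq p_def[symmetric] cond using c by (simp_all add: pos_le_divide_eq pos_divide_le_eq)
qed

end

text \<open>ln 1 = 0 leaves the arrays of the rejection loops empty. The class of the only node is
  non-empty, but its loop has nothing to select.\<close>

lemma run_fails_of_length_1:
  assumes "length \<sigma> = 1"
  shows "pmf (run (algorithm_B (length \<sigma>) \<epsilon>) f \<sigma>) Fail = 1"
proof -
  let ?xs = "List.enumerate 1 \<sigma>"
  have t: "size_t (Suc 0) = 0" by (simp add: size_t_def)
  have "outcome 1 \<epsilon> f ?xs s = return_pmf Fail" for s
  proof -
    have "heavy 1 \<epsilon> f s (set ?xs) \<union> light 1 \<epsilon> f s (set ?xs) = set ?xs"
      by (auto simp: heavy_def light_def)
    moreover have "set ?xs \<noteq> {}" using assms by (cases \<sigma>) auto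
    ultimately have "heavy 1 \<epsilon> f s (set ?xs) \<noteq> {} \<or> light 1 \<epsilon> f s (set ?xs) \<noteq> {}" by (metis Un_empty)
    then show ?thesis
      by (auto simp: outcome_def Let_def t pick_heavy_def pick_light_def bind_return_pmf decide_def)
  qed
  then have "outcome 1 \<epsilon> f ?xs = (\<lambda>_. return_pmf Fail)" by blast
  then show ?thesis by (simp add: run_algorithm_B assms)
qed

text \<open>With no positions there is nothing to sample, and at length 1 certain failure makes the
  conditional requirement vacuous. The failure bound 1 covers both cases.\<close>

lemma L_DI_sampler_algorithm_B:
  assumes "similarity f" "0 < \<epsilon>" "\<epsilon> < 1"
  shows "L_DI_sampler \<epsilon> (if length \<sigma> < 2 then 1 else 1 / real (length \<sigma>) ^ 2) f \<sigma>
    (run (algorithm_B (length \<sigma>) \<epsilon>) f \<sigma>)"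
proof -
  consider "length \<sigma> = 0" | "length \<sigma> = 1" | "length \<sigma> \<ge> 2" by linarith
  then show ?thesis
  proof cases
    case 1
    then show ?thesis by (simp add: L_DI_sampler_def pmf_le_1)
  next
    case 2
    then show ?thesis using run_fails_of_length_1[OF 2, of \<epsilon> f] by (simp add: L_DI_sampler_def)
  next
    case 3
    interpret similarity_stream f \<sigma> \<epsilon> by standard (use assms 3 in auto)
    show ?thesis using L_DI_sampler_run 3 by (simp add: n_def)
  qed
qed

theorem theorem4:
  shows "(\<forall>\<epsilon>::real. 0 < \<epsilon> \<and> \<epsilon> < 1 \<longrightarrow>
           (\<exists>\<delta> :: nat \<Rightarrow> real. \<delta> \<longlonglongrightarrow> 0 \<and>
             (\<forall>(f :: 'u \<Rightarrow> 'u \<Rightarrow> real) (\<sigma> :: 'u list). similarity f \<longrightarrow>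
                L_DI_sampler \<epsilon> (\<delta> (length \<sigma>)) f \<sigma> (run (algorithm_B (length \<sigma>) \<epsilon>) f \<sigma>))))
       \<and> (\<forall>(\<epsilon>::real) (f :: 'u \<Rightarrow> 'u \<Rightarrow> real) (\<sigma> :: 'u list).
           0 < \<epsilon> \<and> \<epsilon> < 1 \<and> similarity f \<longrightarrow>
           length (passes (algorithm_B (length \<sigma>) \<epsilon> :: ('u, 'u mem, 'u result) stream_alg)) = 3 \<and>
           queries_only_memory (algorithm_B (length \<sigma>) \<epsilon>) f \<sigma>)
       \<and> (\<exists>C::real. C > 0 \<and>
           (\<forall>(\<epsilon>::real) (f :: 'u \<Rightarrow> 'u \<Rightarrow> real) (\<sigma> :: 'u list).
              0 < \<epsilon> \<and> \<epsilon> < 1 \<and> similarity f \<and> length \<sigma> \<ge> 2 \<longrightarrow>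
              space_bounded_by (algorithm_B (length \<sigma>) \<epsilon>) f \<sigma>
                (C * (1 / \<epsilon>\<^sup>2 * sqrt (real (length \<sigma>)) * ln (real (length \<sigma>))))))"
proof (intro conjI)
  \<comment> \<open>One rate serves all \<epsilon>. Its value 1 below length 2 accounts for the
    certain failure at length 1 and does not affect the limit.\<close>
  let ?\<delta> = "\<lambda>n. if n < 2 then 1 else 1 / real n ^ 2"
  have "(\<lambda>n. 1 / real n ^ 2) \<longlonglongrightarrow> 0"
    using tendsto_power[OF lim_1_over_n, of 2] by (simp add: power_divide)
  moreover have "\<forall>\<^sub>F n in sequentially. 1 / real n ^ 2 = ?\<delta> n"
    using eventually_ge_at_top[of 2] by eventually_elim auto
  ultimately have "?\<delta> \<longlonglongrightarrow> 0"
    by (rule Lim_transform_eventually)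
  then show "\<forall>\<epsilon>::real. 0 < \<epsilon> \<and> \<epsilon> < 1 \<longrightarrow>
           (\<exists>\<delta> :: nat \<Rightarrow> real. \<delta> \<longlonglongrightarrow> 0 \<and>
             (\<forall>(f :: 'u \<Rightarrow> 'u \<Rightarrow> real) (\<sigma> :: 'u list). similarity f \<longrightarrow>
                L_DI_sampler \<epsilon> (\<delta> (length \<sigma>)) f \<sigma> (run (algorithm_B (length \<sigma>) \<epsilon>) f \<sigma>)))"
    using L_DI_sampler_algorithm_B by (intro allI impI exI[of _ ?\<delta>]) blast
next
  show "\<forall>(\<epsilon>::real) (f :: 'u \<Rightarrow> 'u \<Rightarrow> real) (\<sigma> :: 'u list).
           0 < \<epsilon> \<and> \<epsilon> < 1 \<and> similarity f \<longrightarrow>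
           length (passes (algorithm_B (length \<sigma>) \<epsilon> :: ('u, 'u mem, 'u result) stream_alg)) = 3 \<and>
           queries_only_memory (algorithm_B (length \<sigma>) \<epsilon>) f \<sigma>"
    using queries_only_memory_algorithm_B by (auto simp: algorithm_B_def)
next
  show "\<exists>C::real. C > 0 \<and>
           (\<forall>(\<epsilon>::real) (f :: 'u \<Rightarrow> 'u \<Rightarrow> real) (\<sigma> :: 'u list).
              0 < \<epsilon> \<and> \<epsilon> < 1 \<and> similarity f \<and> length \<sigma> \<ge> 2 \<longrightarrow>
              space_bounded_by (algorithm_B (length \<sigma>) \<epsilon>) f \<sigma>
                (C * (1 / \<epsilon>\<^sup>2 * sqrt (real (length \<sigma>)) * ln (real (length \<sigma>)))))"
    using space_bounded_by_algorithm_B by (intro exI[of _ 4000]) auto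
qed

end
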